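(* Suppose that $V\in P_0(\mathcal T)$ is piecewise constant. For every $k\in\mathbb{N}$, the $k$-th exact eigenvalue $\lambda=\lambda_k$ of the Schrödinger eigenvalue problem and the $k$-th enriched Crouzeix–Raviart eigenvalue $\lambda_{\mathrm{eCR}}=\lambda_{\mathrm{eCR}(k)}$ satisfy $$\mathrm{GLB}_{\mathrm{eCR}}:=\frac{\lambda_{\mathrm{eCR}}}{1+\delta'+\dfrac{\varepsilon'^2\lambda_{\mathrm{eCR}}^2}{1+\delta'+\varepsilon'\lambda_{\mathrm{eCR}}}}\le\lambda .$$
   Context: Let $\Omega\subset\mathbb{R}^n$, $n\ge2$, be a polyhedral bounded Lipschitz domain and $V\in L^\infty(\Omega)$ with $\operatorname{ess\,inf}_\Omega V=0$. Write $(v,w)_V:=\int_\Omega V v w\,dx$. The exact eigenvalues $0<\lambda_1\le\lambda_2\le\dots$ (counted with multiplicity) are those of: find $(\lambda,u)\in\mathbb{R}_+\times H_0^1(\Omega)$, $u\ne0$, with $\int_\Omega\nabla u\cdot\nabla v\,dx+(u,v)_V=\lambda\int_\Omega uv\,dx$ for all $v\in H^1_0(\Omega)$. $\mathcal{T}$ is a regular (face-to-face) triangulation of $\Omega$ into non-degenerate compact $n$-simplices, $h_T:=\operatorname{diam}(T)$, $h_{\mathcal T}|_T:=h_T$, $\mathcal F$ is the set of all faces, $\mathcal V(T)$ the set of vertices of $T$, $\operatorname{mid}(\cdot)$ denotes the barycenter. The jump $[v]_F$ of a piecewise continuous function is the difference of the traces from the two adjacent simplices if $F$ is interior and the trace $v|_F$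 if $F\subset\partial\Omega$. $P_m(\mathcal T)$ is the space of piecewise polynomials of total degree at most $m$. Set $\mathrm{CR}_0^1(\mathcal T):=\{v\in P_1(\mathcal T): [v]_F(\operatorname{mid}(F))=0\ \forall F\in\mathcal F\}$. For $T\in\mathcal T$ the bubble is $$\flat_T(x):=\frac{n+2}{2}-\frac{n(n+1)^2(n+2)}{\sum_{P\ne Q\in\mathcal V(T)}|P-Q|^2}\,|x-\operatorname{mid}(T)|^2\quad(x\in T),$$ extended by zero outside $T$ (sum over ordered pairs, so that $\int_F\flat_T\,ds=0$ for each face $F$ of $T$ and $|T|^{-1}\int_T\flat_T\,dx=1$). Let $B(\mathcal T)$ be the span of all $\flat_T$, $T\in\mathcal T$, and $\mathrm{eCR}_0^1(\mathcal T):=\mathrm{CR}_0^1(\mathcal T)\oplus B(\mathcal T)$. Let $a_{\mathrm{pw}}(v,w):=\sum_{T\in\mathcal T}\int_T\nabla v\cdot\nabla w\,dx$. The eCR eigenvalues $0<\lambda_{\mathrm{eCR}(1)}\le\dots\le\lambda_{\mathrm{eCR}(N)}$, $N=\dim\mathrm{eCR}_0^1(\mathcal T)$, are those of: find $(\lambda_h,u_h)\in\mathbb{R}_+\times\mathrm{eCR}_0^1(\mathcal T)$, $u_h\ne0$, with $a_{\mathrm{pw}}(u_h,v_h)+(u_h,v_h)_V=\lambda_h\int_\Omega u_hv_h\,dx$ for all $v_h\in\mathrm{eCR}_0^1(\mathcal T)$. Convention: $\lambda_{\mathrm{eCR}(k)}=+\infty$ for $k>N$, and the bound is then read as its limit for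 $\lambda_{\mathrm{eCR}}\to\infty$. $C_P>0$ is a Poincaré constant, i.e. $\|f-|T|^{-1}\int_Tf\,dx\|_{L^2(T)}\le C_Ph_T\|\nabla f\|_{L^2(T)}$ for all $f\in H^1(T)$, $T\in\mathcal T$ (e.g. $C_P=1/\pi$, or $C_P=1/j_{11}$ for $n=2$ with the first positive root $j_{11}$ of the Bessel function $J_1$). Set $\varepsilon':=\|C_P^2h_{\mathcal T}^2\|_{L^\infty(\Omega)}$ and $\delta':=\|C_P^2h_{\mathcal T}^2V\|_{L^\infty(\Omega)}$. *)

theory Defs
  imports "HOL-Analysis.Analysis" "HOL-Probability.Essential_Supremum"
begin

section \<open>Domains\<close>

text \<open>Near each boundary point, a Lipschitz domain is the strict epigraph of a Lipschitz function
  \<open>g\<close> over the hyperplane orthogonal to a unit vector \<open>e\<close>.\<close>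

definition lipschitz_boundary :: "'a::euclidean_space set \<Rightarrow> bool" where
  "lipschitz_boundary \<Omega> \<longleftrightarrow>
     (\<forall>z \<in> frontier \<Omega>. \<exists>r e L (g :: 'a \<Rightarrow> real).
        0 < r \<and> norm e = 1 \<and> L-lipschitz_on {w. w \<bullet> e = 0} g \<and>
        \<Omega> \<inter> ball z r = {y \<in> ball z r. g (y - (y \<bullet> e) *\<^sub>R e) < y \<bullet> e})"

definition polyhedral_lipschitz_domain :: "'a::euclidean_space set \<Rightarrow> bool" where
  "polyhedral_lipschitz_domain \<Omega> \<longleftrightarrow>
     open \<Omega> \<and> connected \<Omega> \<and> \<Omega> \<noteq> {} \<and> bounded \<Omega> \<and> lipschitz_boundary \<Omega> \<and>
     (\<exists>\<P>. finite \<P> \<and> (\<forall>P \<in> \<P>. polytope P) \<and> closure \<Omega> = \<Union>\<P>)"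

section \<open>Lebesgue and Sobolev spaces\<close>

text \<open>Elements of Lebesgue and Sobolev spaces are represented by functions on the whole space;
  only their values on the set \<open>U\<close>, up to null sets, matter.\<close>

definition L2 :: "'a::euclidean_space set \<Rightarrow> ('a \<Rightarrow> 'b::euclidean_space) set" where
  "L2 U = {f \<in> borel_measurable (lebesgue_on U).
             integrable (lebesgue_on U) (\<lambda>x. (norm (f x))\<^sup>2)}"

definition L2_norm :: "'a::euclidean_space set \<Rightarrow> ('a \<Rightarrow> 'b::euclidean_space) \<Rightarrow> real" where
  "L2_norm U f = sqrt (LINT x|lebesgue_on U. (norm (f x))\<^sup>2)"

definition L2_inner :: "'a::euclidean_space set \<Rightarrow> ('a \<Rightarrow> real) \<Rightarrow> ('a \<Rightarrow> real) \<Rightarrow> real" where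
  "L2_inner U f g = (LINT x|lebesgue_on U. f x * g x)"

definition Linfty :: "'a::euclidean_space set \<Rightarrow> ('a \<Rightarrow> real) set" where
  "Linfty U = {f \<in> borel_measurable (lebesgue_on U).
                 esssup (lebesgue_on U) (\<lambda>x. ereal \<bar>f x\<bar>) < \<infinity>}"

definition Linfty_norm :: "'a::euclidean_space set \<Rightarrow> ('a \<Rightarrow> real) \<Rightarrow> real" where
  "Linfty_norm U f = real_of_ereal (esssup (lebesgue_on U) (\<lambda>x. ereal \<bar>f x\<bar>))"

definition essinf :: "'a measure \<Rightarrow> ('a \<Rightarrow> real) \<Rightarrow> ereal" where
  "essinf M f = - esssup M (\<lambda>x. - ereal (f x))"

definition grad :: "('a::euclidean_space \<Rightarrow> real) \<Rightarrow> 'a \<Rightarrow> 'a" where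
  "grad f x = (\<Sum>b\<in>Basis. frechet_derivative f (at x) b *\<^sub>R b)"

primrec Ck :: "nat \<Rightarrow> ('a::euclidean_space \<Rightarrow> real) \<Rightarrow> bool" where
  "Ck 0 f \<longleftrightarrow> continuous_on UNIV f"
| "Ck (Suc k) f \<longleftrightarrow> (\<forall>x. f differentiable (at x)) \<and>
     (\<forall>b\<in>Basis. Ck k (\<lambda>x. frechet_derivative f (at x) b))"

definition test_function :: "'a::euclidean_space set \<Rightarrow> ('a \<Rightarrow> real) \<Rightarrow> bool" where
  "test_function U \<phi> \<longleftrightarrow> (\<forall>k. Ck k \<phi>) \<and>
     compact (closure {x. \<phi> x \<noteq> 0}) \<and> closure {x. \<phi> x \<noteq> 0} \<subseteq> U"

definition weak_gradient :: "'a::euclidean_space set \<Rightarrow> ('a \<Rightarrow> real) \<Rightarrow> ('a \<Rightarrow> 'a) \<Rightarrow> bool" where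
  "weak_gradient U f g \<longleftrightarrow>
     (\<forall>\<phi>. test_function U \<phi> \<longrightarrow>
        (LINT x|lebesgue_on U. f x *\<^sub>R grad \<phi> x) = - (LINT x|lebesgue_on U. \<phi> x *\<^sub>R g x))"

definition H1 :: "'a::euclidean_space set \<Rightarrow> ('a \<Rightarrow> real) set" where
  "H1 U = {f \<in> L2 U. \<exists>g \<in> L2 U. weak_gradient U f g}"

text \<open>The weak gradient is unique up to null sets, so the choice below is immaterial under
  integrals.\<close>

definition wgrad :: "'a::euclidean_space set \<Rightarrow> ('a \<Rightarrow> real) \<Rightarrow> 'a \<Rightarrow> 'a" where
  "wgrad U f = (SOME g. g \<in> L2 U \<and> weak_gradient U f g)"

text \<open>\<open>H10 U\<close> is the closure of the test functions in the norm of \<open>H1 U\<close>.\<close>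

definition H10 :: "'a::euclidean_space set \<Rightarrow> ('a \<Rightarrow> real) set" where
  "H10 U = {f \<in> H1 U. \<exists>\<phi>. (\<forall>j::nat. test_function U (\<phi> j)) \<and>
     (\<lambda>j. sqrt ((L2_norm U (\<lambda>x. f x - \<phi> j x))\<^sup>2
              + (L2_norm U (\<lambda>x. wgrad U f x - grad (\<phi> j) x))\<^sup>2)) \<longlonglongrightarrow> 0}"

definition poincare_constant :: "real \<Rightarrow> 'a::euclidean_space set \<Rightarrow> bool" where
  "poincare_constant C T \<longleftrightarrow>
     (\<forall>f \<in> H1 (interior T).
        L2_norm (interior T)
          (\<lambda>x. f x - (LINT y|lebesgue_on (interior T). f y) / measure lebesgue T)
        \<le> C * diameter T * L2_norm (interior T) (wgrad (interior T) f))"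

section \<open>Triangulations and piecewise polynomials\<close>

definition triangulation_of :: "'a::euclidean_space set set \<Rightarrow> 'a set \<Rightarrow> bool" where
  "triangulation_of \<T> \<Omega> \<longleftrightarrow>
     triangulation \<T> \<and> (\<forall>T \<in> \<T>. int DIM('a) simplex T) \<and> \<Union>\<T> = closure \<Omega>"

definition vertices :: "'a::euclidean_space set \<Rightarrow> 'a set" where
  "vertices T = {x. x extreme_point_of T}"

definition mid :: "'a::euclidean_space set \<Rightarrow> 'a" where
  "mid S = (1 / real (card (vertices S))) *\<^sub>R (\<Sum>P\<in>vertices S. P)"

text \<open>The mesh-size function; its value on the skeleton, a null set, is irrelevant.\<close>

definition mesh_size :: "'a::euclidean_space set set \<Rightarrow> 'a \<Rightarrow> real" where
  "mesh_size \<T> x = (\<Sum>T\<in>\<T>. diameter T * indicator (interior T) x)"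

definition poly_total_degree_le :: "nat \<Rightarrow> ('a::euclidean_space \<Rightarrow> real) \<Rightarrow> bool" where
  "poly_total_degree_le m p \<longleftrightarrow>
     (\<exists>A (c :: ('a \<Rightarrow> nat) \<Rightarrow> real). finite A \<and> (\<forall>\<alpha>\<in>A. (\<Sum>b\<in>Basis. \<alpha> b) \<le> m) \<and>
        (\<forall>x. p x = (\<Sum>\<alpha>\<in>A. c \<alpha> * (\<Prod>b\<in>Basis. (x \<bullet> b) ^ \<alpha> b))))"

text \<open>A piecewise polynomial is prescribed on the open simplices only; traces on the skeleton are
  one-sided limits from a given simplex.\<close>

definition pw_poly :: "nat \<Rightarrow> 'a::euclidean_space set set \<Rightarrow> ('a \<Rightarrow> real) set" where
  "pw_poly m \<T> = {v. \<forall>T\<in>\<T>. \<exists>p. poly_total_degree_le m p \<and> (\<forall>x\<in>interior T. v x = p x)}"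

definition trace_from :: "'a::euclidean_space set \<Rightarrow> ('a \<Rightarrow> real) \<Rightarrow> 'a \<Rightarrow> real" where
  "trace_from T v z = Lim (at z within interior T) v"

definition faces :: "'a::euclidean_space set set \<Rightarrow> 'a set set" where
  "faces \<T> = {F. \<exists>T\<in>\<T>. F facet_of T}"

text \<open>Vanishing of the jump across \<open>F\<close> at \<open>z\<close>; this does not depend on the order of the two
  simplices adjacent to an interior face.\<close>

definition jump_vanishes ::
  "'a::euclidean_space set \<Rightarrow> 'a set set \<Rightarrow> ('a \<Rightarrow> real) \<Rightarrow> 'a set \<Rightarrow> 'a \<Rightarrow> bool" where
  "jump_vanishes \<Omega> \<T> v F z \<longleftrightarrow>
     (if F \<subseteq> frontier \<Omega>
      then \<forall>T\<in>\<T>. F facet_of T \<longrightarrow> trace_from T v z = 0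
      else \<forall>T\<in>\<T>. \<forall>T'\<in>\<T>. T \<noteq> T' \<and> F facet_of T \<and> F facet_of T' \<longrightarrow>
             trace_from T v z - trace_from T' v z = 0)"

definition CR0 :: "'a::euclidean_space set \<Rightarrow> 'a set set \<Rightarrow> ('a \<Rightarrow> real) set" where
  "CR0 \<Omega> \<T> = {v \<in> pw_poly 1 \<T>. \<forall>F\<in>faces \<T>. jump_vanishes \<Omega> \<T> v F (mid F)}"

definition bubble :: "'a::euclidean_space set \<Rightarrow> 'a \<Rightarrow> real" where
  "bubble T x =
     (let n = real DIM('a) in
      if x \<in> T
      then (n + 2) / 2
           - n * (n + 1)\<^sup>2 * (n + 2) / (\<Sum>P\<in>vertices T. \<Sum>Q\<in>vertices T - {P}. (norm (P - Q))\<^sup>2)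
             * (norm (x - mid T))\<^sup>2
      else 0)"

definition bubble_space :: "'a::euclidean_space set set \<Rightarrow> ('a \<Rightarrow> real) set" where
  "bubble_space \<T> = {\<lambda>x. \<Sum>T\<in>\<T>. c T * bubble T x | c. True}"

definition eCR0 :: "'a::euclidean_space set \<Rightarrow> 'a set set \<Rightarrow> ('a \<Rightarrow> real) set" where
  "eCR0 \<Omega> \<T> = {\<lambda>x. v x + b x | v b. v \<in> CR0 \<Omega> \<T> \<and> b \<in> bubble_space \<T>}"

section \<open>Eigenvalue problems\<close>

definition schroedinger_form ::
  "'a::euclidean_space set \<Rightarrow> ('a \<Rightarrow> real) \<Rightarrow> ('a \<Rightarrow> real) \<Rightarrow> ('a \<Rightarrow> real) \<Rightarrow> real" where
  "schroedinger_form \<Omega> V u v =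
     (LINT x|lebesgue_on \<Omega>. wgrad \<Omega> u x \<bullet> wgrad \<Omega> v x)
     + (LINT x|lebesgue_on \<Omega>. V x * u x * v x)"

definition pw_schroedinger_form ::
  "'a::euclidean_space set \<Rightarrow> 'a set set \<Rightarrow> ('a \<Rightarrow> real) \<Rightarrow> ('a \<Rightarrow> real) \<Rightarrow> ('a \<Rightarrow> real) \<Rightarrow> real" where
  "pw_schroedinger_form \<Omega> \<T> V u v =
     (\<Sum>T\<in>\<T>. LINT x|lebesgue_on (interior T). grad u x \<bullet> grad v x)
     + (LINT x|lebesgue_on \<Omega>. V x * u x * v x)"

text \<open>\<open>X\<close> has dimension \<open>m\<close> when functions are identified if they agree almost everywhere
  in \<open>\<Omega>\<close>.\<close>

definition has_dim_ae :: "'a::euclidean_space set \<Rightarrow> ('a \<Rightarrow> real) set \<Rightarrow> nat \<Rightarrow> bool" where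
  "has_dim_ae \<Omega> X m \<longleftrightarrow>
     (\<exists>e :: nat \<Rightarrow> 'a \<Rightarrow> real.
        (\<forall>i<m. e i \<in> X) \<and>
        (\<forall>c. (AE x in lebesgue_on \<Omega>. (\<Sum>i<m. c i * e i x) = 0) \<longrightarrow> (\<forall>i<m. c i = 0)) \<and>
        (\<forall>f\<in>X. \<exists>c. AE x in lebesgue_on \<Omega>. f x = (\<Sum>i<m. c i * e i x)))"

definition eigenspace ::
  "('a \<Rightarrow> real) set \<Rightarrow> (('a \<Rightarrow> real) \<Rightarrow> ('a \<Rightarrow> real) \<Rightarrow> real) \<Rightarrow>
   (('a \<Rightarrow> real) \<Rightarrow> ('a \<Rightarrow> real) \<Rightarrow> real) \<Rightarrow> real \<Rightarrow> ('a \<Rightarrow> real) set" where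
  "eigenspace X a b \<mu> = {u \<in> X. \<forall>v\<in>X. a u v = \<mu> * b u v}"

text \<open>The family \<open>ev\<close>, indexed by \<open>I\<close>, lists the positive eigenvalues in nondecreasing order, each
  as often as its multiplicity. A number \<open>\<mu>\<close> with trivial eigenspace is not listed.\<close>

definition enumerates_eigenvalues ::
  "'a::euclidean_space set \<Rightarrow> ('a \<Rightarrow> real) set \<Rightarrow> (('a \<Rightarrow> real) \<Rightarrow> ('a \<Rightarrow> real) \<Rightarrow> real) \<Rightarrow>
   nat set \<Rightarrow> (nat \<Rightarrow> real) \<Rightarrow> bool" where
  "enumerates_eigenvalues \<Omega> X a I ev \<longleftrightarrow>
     (\<forall>i\<in>I. 0 < ev i) \<and> mono_on I ev \<and>
     (\<forall>\<mu>>0. finite {i\<in>I. ev i = \<mu>} \<and>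
        has_dim_ae \<Omega> (eigenspace X a (L2_inner \<Omega>) \<mu>) (card {i\<in>I. ev i = \<mu>}))"

definition exact_eigenvalues ::
  "'a::euclidean_space set \<Rightarrow> ('a \<Rightarrow> real) \<Rightarrow> (nat \<Rightarrow> real) \<Rightarrow> bool" where
  "exact_eigenvalues \<Omega> V ev \<longleftrightarrow>
     enumerates_eigenvalues \<Omega> (H10 \<Omega>) (schroedinger_form \<Omega> V) {1..} ev"

text \<open>The discrete eigenvalues, continued by \<open>\<infinity>\<close> beyond the dimension of the discrete space.\<close>

definition eCR_eigenvalues ::
  "'a::euclidean_space set \<Rightarrow> 'a set set \<Rightarrow> ('a \<Rightarrow> real) \<Rightarrow> (nat \<Rightarrow> ereal) \<Rightarrow> bool" where
  "eCR_eigenvalues \<Omega> \<T> V ev \<longleftrightarrow>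
     (\<exists>N ev'. has_dim_ae \<Omega> (eCR0 \<Omega> \<T>) N \<and>
        enumerates_eigenvalues \<Omega> (eCR0 \<Omega> \<T>) (pw_schroedinger_form \<Omega> \<T> V) {1..N} ev' \<and>
        (\<forall>k\<in>{1..N}. ev k = ereal (ev' k)) \<and> (\<forall>k>N. ev k = \<infinity>))"

section \<open>The guaranteed lower bound\<close>

definition GLB_real :: "real \<Rightarrow> real \<Rightarrow> real \<Rightarrow> real" where
  "GLB_real \<epsilon> \<delta> t = t / (1 + \<delta> + \<epsilon>\<^sup>2 * t\<^sup>2 / (1 + \<delta> + \<epsilon> * t))"

definition GLB_eCR :: "real \<Rightarrow> real \<Rightarrow> ereal \<Rightarrow> real" where
  "GLB_eCR \<epsilon> \<delta> t = (if t = \<infinity> then Lim at_top (GLB_real \<epsilon> \<delta>) else GLB_real \<epsilon> \<delta> (real_of_ereal t))"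

end

theory Submission
  imports Defs
begin

text \<open>Let \<open>u\<close> be a linear combination of the first \<open>k\<close> exact eigenfunctions and \<open>v\<close> its interpolant in
  the discrete space, so that on each simplex \<open>u - v\<close> has mean zero and \<open>\<nabla>(u - v)\<close> is orthogonal to
  constants and to \<open>x\<close>, hence to \<open>\<nabla>v\<close>. Pick \<open>u\<close> such that \<open>v\<close> is orthogonal to the first \<open>k - 1\<close>
  discrete eigenfunctions; then the discrete Rayleigh quotient of \<open>v\<close> is at least the \<open>k\<close>-th
  discrete eigenvalue. Let \<open>\<Pi>\<close> be the projection onto piecewise constants, \<open>A = \<lambda>\<^sub>e\<^sub>C\<^sub>R / (1 + \<delta>)\<close> and
  \<open>p = \<parallel>\<nabla>v\<parallel>\<^sup>2 + \<parallel>\<Pi>u\<parallel>\<^sup>2\<^sub>V\<close>, \<open>q = \<parallel>\<nabla>(u - v)\<parallel>\<^sup>2\<close>. The Poincare inequality for \<open>v\<close> turns this into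
  \<open>\<parallel>v\<parallel>\<^sup>2 \<le> p / A\<close>, and, applied to both \<open>u\<close> and \<open>u - v\<close>, it gives
  \<open>\<parallel>u\<parallel>\<^sup>2 - \<parallel>v\<parallel>\<^sup>2 \<le> \<theta>\<epsilon>(p + q) + (1/\<theta> - 1)\<epsilon>q\<close> for \<open>0 < \<theta> \<le> 1\<close>. With \<open>\<theta> = \<epsilon>A / (1 + \<epsilon>A)\<close> this becomes
  \<open>\<parallel>u\<parallel>\<^sup>2 \<le> (p + q)(1/A + \<theta>\<epsilon>)\<close>, while \<open>p + q \<le> \<lambda>\<parallel>u\<parallel>\<^sup>2\<close>.

  Traces of Sobolev functions are avoided: the mean of \<open>u\<close> over a facet is expressed by an integral
  of \<open>u\<close> and \<open>\<nabla>u\<close> over an adjacent simplex. For test functions its independence of the simplex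
  follows from an affine change of variables, and it passes to the limit in \<open>H10\<close>.\<close>

section \<open>Affine changes of variables and integrals over cones\<close>

text \<open>On a simplex a discrete function has n + 2 free parameters, matched by n + 1 facet means
  and one volume mean. The orthogonality comes from this match alone: the gradient error tested with
  \<open>x - P\<close> has integral zero for every vertex \<open>P\<close>, and being affine in
  \<open>P\<close> this forces both moments to vanish.

  Since the potential is constant on a simplex, its energy splits like the squared norm into a mean
  part shared by \<open>u\<close> and \<open>v\<close> and fluctuations. The fluctuation energy of
  \<open>v\<close> is charged to the gradient, which produces the factor 1 + \<delta>.

  Two features of the encoding shape the rest. \<open>wgrad\<close> is an arbitrary choice of weak
  gradient on a given set, so the Poincare hypothesis on a simplex reaches restrictions and
  classical gradients only through uniqueness of weak gradients, which needs smooth bumps. And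
  eigenvalues are described by dimensions of eigenspaces, without orthonormal bases, so spectral
  inequalities rest on orthogonality between distinct eigenvalues and on counting
  dimensions.\<close>

lemma nn_integral_lborel_translate:
  fixes f :: "'a::euclidean_space \<Rightarrow> ennreal"
  assumes [measurable]: "f \<in> borel_measurable borel"
  shows "(\<integral>\<^sup>+x. f (c + x) \<partial>lborel) = (\<integral>\<^sup>+x. f x \<partial>lborel)"
  by (subst (2) lborel_distr_plus[symmetric, of c]) (simp add: nn_integral_distr)

lemma nn_integral_lborel_reflect:
  fixes f :: "'a::euclidean_space \<Rightarrow> ennreal"
  assumes [measurable]: "f \<in> borel_measurable borel"
  shows "(\<integral>\<^sup>+x. f (c - x) \<partial>lborel) = (\<integral>\<^sup>+x. f x \<partial>lborel)"
  by (subst (2) lborel_affine[of "-1" c])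
     (simp_all add: nn_integral_density nn_integral_distr)

text \<open>An invertible affine map carries Lebesgue measure to a translation invariant measure,
  which must be a multiple of Lebesgue measure. The factor is left unidentified: in the change of
  variables between two simplices it cancels against the ratio of their volumes.\<close>

lemma integral_lborel_affine_bijection:
  fixes L :: "'a::euclidean_space \<Rightarrow> 'a"
  assumes L: "linear L" "inj L"
  obtains c where "c > 0" "\<And>f :: 'a \<Rightarrow> real. f \<in> borel_measurable borel \<Longrightarrow>
     (LINT x|lborel. f (L x + b)) = c * (LINT x|lborel. f x)"
proof -
  define A where "A x = L x + b" for x
  define Li where "Li = inv L"
  have surj: "surj L" using L linear_injective_imp_surjective by blast
  have LLi: "L (Li y) = y" for y by (simp add: Li_def surj surj_f_inv_f)
  have LiL: "Li (L y) = y" for y by (simp add: Li_def L inv_f_f)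
  have linLi: "linear Li"
    using L inj_linear_imp_inv_linear Li_def by blast
  have contA: "continuous_on UNIV A" unfolding A_def
    by (intro continuous_intros linear_continuous_on linear_conv_bounded_linear[THEN iffD1] L)
  have contLi: "continuous_on UNIV Li"
    by (intro linear_continuous_on linear_conv_bounded_linear[THEN iffD1] linLi)
  have [measurable]: "A \<in> borel_measurable borel" "Li \<in> borel_measurable borel"
    using contA contLi by (auto intro: borel_measurable_continuous_onI)
  \<comment> \<open>Subtracting \<open>y\<close> after \<open>A\<close> is a translation by
    \<open>- Li y\<close> before it; this is the substitution in the Fubini computation
    below.\<close>
  have Ash: "A (- Li y + x) = A x - y" for x y
    unfolding A_def using L(1) by (simp add: linear_add linear_neg LLi linear_diff)
  define M where "M = distr lborel borel A"
  define B :: "'a set" where "B = cbox 0 One"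
  have [measurable]: "B \<in> sets borel" by (simp add: B_def)
  have B1: "(\<integral>\<^sup>+y. indicator B y \<partial>lborel) = 1"
    by (simp add: B_def emeasure_lborel_cbox_eq inner_Basis)
  have MS: "emeasure M S = emeasure M B * emeasure lborel S" if [measurable]: "S \<in> sets borel" for S
  proof -
    have eS: "emeasure M S = (\<integral>\<^sup>+x. indicator S (A x) \<partial>lborel)" if [measurable]: "S \<in> sets borel" for S
      using nn_integral_distr[of A lborel borel "indicator S"] by (simp add: M_def)
    \<comment> \<open>Uniqueness of translation invariant measures by Fubini: insert the unit cube
      translated by \<open>A x\<close>, exchange the integrals, shift \<open>x\<close> so that
      \<open>S\<close> carries the translation instead of the cube, and exchange back.\<close>
    have "emeasure M S = (\<integral>\<^sup>+x. indicator S (A x) * (\<integral>\<^sup>+y. indicator B y \<partial>lborel) \<partial>lborel)"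
      by (simp add: eS B1)
    also have "\<dots> = (\<integral>\<^sup>+x. indicator S (A x) * (\<integral>\<^sup>+y. indicator B (A x + y) \<partial>lborel) \<partial>lborel)"
      by (subst nn_integral_lborel_translate) auto
    also have "\<dots> = (\<integral>\<^sup>+x. (\<integral>\<^sup>+y. indicator S (A x) * indicator B (A x + y) \<partial>lborel) \<partial>lborel)"
      by (subst nn_integral_cmult) auto
    also have "\<dots> = (\<integral>\<^sup>+y. (\<integral>\<^sup>+x. indicator S (A x) * indicator B (A x + y) \<partial>lborel) \<partial>lborel)"
      by (rule lborel_pair.Fubini'[symmetric]) measurable
    also have "\<dots> = (\<integral>\<^sup>+y. (\<integral>\<^sup>+x. indicator S (A (- Li y + x)) * indicator B (A (- Li y + x) + y)
        \<partial>lborel) \<partial>lborel)"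
      by (subst nn_integral_lborel_translate[where f = "\<lambda>x. indicator S (A x) * indicator B (A x +
          _)"]) auto
    also have "\<dots> = (\<integral>\<^sup>+y. (\<integral>\<^sup>+x. indicator S (A x - y) * indicator B (A x) \<partial>lborel) \<partial>lborel)"
      by (simp only: Ash) simp
    also have "\<dots> = (\<integral>\<^sup>+x. (\<integral>\<^sup>+y. indicator S (A x - y) * indicator B (A x) \<partial>lborel) \<partial>lborel)"
      by (rule lborel_pair.Fubini') measurable
    also have "\<dots> = (\<integral>\<^sup>+x. (\<integral>\<^sup>+y. indicator S y \<partial>lborel) * indicator B (A x) \<partial>lborel)"
      by (simp add: nn_integral_multc nn_integral_lborel_reflect)
    also have "\<dots> = emeasure lborel S * emeasure M B"
      by (simp add: eS nn_integral_cmult)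
    finally show ?thesis by (simp add: mult.commute)
  qed
  have "A -` B = (\<lambda>y. Li (y - b)) ` B"
  proof (intro equalityI subsetI)
    fix x assume "x \<in> A -` B"
    then show "x \<in> (\<lambda>y. Li (y - b)) ` B"
      by (intro image_eqI[of _ _ "A x"]) (auto simp: A_def LiL)
  qed (auto simp: A_def LLi)
  moreover have "compact ((\<lambda>y. Li (y - b)) ` B)"
    unfolding B_def
    by (intro compact_continuous_image continuous_on_compose2[OF contLi] continuous_intros) auto
  ultimately have "bounded (A -` B)"
    by (simp add: compact_imp_bounded)
  then have "emeasure lborel (A -` B) < \<infinity>"
    by (rule emeasure_bounded_finite)
  then have fin: "emeasure M B < \<infinity>"
    by (simp add: M_def emeasure_distr)
  \<comment> \<open>If \<open>B\<close> had measure zero under \<open>M\<close>, \<open>MS\<close>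
    would give the whole space measure zero.\<close>
  have "emeasure M UNIV = \<infinity>"
    by (simp add: M_def emeasure_distr)
  with MS[of UNIV] have pos: "emeasure M B \<noteq> 0" by auto
  define c where "c = measure M B"
  have cM: "emeasure M B = ennreal c" using fin by (simp add: c_def emeasure_eq_ennreal_measure)
  have "c > 0" using pos cM by (metis c_def ennreal_0 measure_nonneg order_le_less)
  have Mc: "M = density lborel (\<lambda>_. ennreal c)"
    by (rule measure_eqI) (auto simp: M_def emeasure_density nn_integral_cmult MS[unfolded M_def]
        cM[unfolded M_def])
  show ?thesis
  proof
    show "c > 0" by fact
    fix f :: "'a \<Rightarrow> real" assume [measurable]: "f \<in> borel_measurable borel"
    have "(LINT x|lborel. f (A x)) = (LINT x|M. f x)"
      by (simp add: M_def integral_distr)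
    also have "\<dots> = c * (LINT x|lborel. f x)"
      using \<open>c > 0\<close> by (simp add: Mc integral_density)
    finally show "(LINT x|lborel. f (L x + b)) = c * (LINT x|lborel. f x)" by (simp add: A_def)
  qed
qed

lemma integral_lborel_dilation:
  fixes f :: "'a::euclidean_space \<Rightarrow> real"
  assumes [measurable]: "f \<in> borel_measurable borel" and "s > 0"
  shows "(LINT x|lborel. f x) = s ^ DIM('a) * (LINT x|lborel. f (P + s *\<^sub>R (x - P)))"
proof -
  have "(LINT x|lborel. f x) = s ^ DIM('a) * (LINT x|lborel. f ((P - s *\<^sub>R P) + s *\<^sub>R x))"
    using \<open>s > 0\<close>
    by (subst lborel_affine[of s "P - s *\<^sub>R P"]) (simp_all add: integral_density integral_distr)
  then show ?thesis by (simp add: algebra_simps)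
qed

lemma integral_lebesgue_on_compact:
  fixes f :: "'a::euclidean_space \<Rightarrow> 'b::euclidean_space"
  assumes "compact T" "f \<in> borel_measurable borel"
  shows "(LINT x|lebesgue_on T. f x) = (LINT x|lborel. indicator T x *\<^sub>R f x)"
proof -
  have [measurable]: "T \<in> sets borel" using assms(1) by (simp add: borel_compact)
  note [measurable] = assms(2)
  have "(LINT x|lebesgue_on T. f x) = (LINT x|lebesgue. indicator T x *\<^sub>R f x)"
    by (rule integral_restrict_space) auto
  also have "\<dots> = (LINT x|lborel. indicator T x *\<^sub>R f x)"
    by (rule integral_completion) measurable
  finally show ?thesis .
qed

lemma integrable_indicator_compact:
  fixes f :: "'a::euclidean_space \<Rightarrow> 'b::euclidean_space"
  assumes "compact T" "continuous_on UNIV f"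
  shows "integrable lborel (\<lambda>x. indicator T x *\<^sub>R f x)"
  using borel_integrable_compact[of T f] assms continuous_on_subset[OF assms(2), of T]
  by (simp add: set_integrable_def)

text \<open>The integral is the derivative at \<open>s = 1\<close> of the integral of \<open>\<psi>\<close> over the cone contracted
  by \<open>s\<close> towards its apex; since \<open>\<psi> = O(1 - s)\<close> on the removed layer, this derivative is \<open>0\<close>.\<close>

lemma integral_cone_eq_0:
  fixes \<psi> :: "'a::euclidean_space \<Rightarrow> real" and g :: "'a \<Rightarrow> 'a"
  assumes F: "compact F" "convex F" "F \<noteq> {}" and T: "T = convex hull (insert P F)"
    and \<psi>: "\<And>x. (\<psi> has_derivative (\<lambda>h. g x \<bullet> h)) (at x)" and g: "continuous_on UNIV g"
    and zero: "\<And>x. x \<in> F \<Longrightarrow> \<psi> x = 0"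
  shows "(LINT x|lebesgue_on T. real DIM('a) * \<psi> x + g x \<bullet> (x - P)) = 0"
proof -
  let ?n = "DIM('a)"
  have cT: "compact T" unfolding T using F by (simp add: compact_convex_hull)
  have convT: "convex T" by (simp add: T)
  have PT: "P \<in> T" and FT: "F \<subseteq> T" unfolding T by (auto intro: hull_inc)
  have c\<psi>: "continuous_on UNIV \<psi>"
    by (rule has_derivative_continuous_on[OF has_derivative_at_withinI[OF \<psi>]])
  have [measurable]: "\<psi> \<in> borel_measurable borel" "g \<in> borel_measurable borel"
    using c\<psi> g by (auto intro: borel_measurable_continuous_onI)
  have [measurable]: "T \<in> sets borel" using cT by (simp add: borel_compact)
  obtain D where D: "\<And>x. x \<in> T \<Longrightarrow> norm (x - P) \<le> D"
    using compact_imp_bounded[OF cT] unfolding bounded_any_center[where a=P]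
    by (metis dist_norm norm_minus_commute)
  obtain M where M: "\<And>x. x \<in> T \<Longrightarrow> norm (g x) \<le> M"
    using compact_imp_bounded[OF compact_continuous_image[OF continuous_on_subset[OF g subset_UNIV] cT]]
    unfolding bounded_iff by auto
  obtain K where K: "\<And>x. x \<in> T \<Longrightarrow> norm (\<psi> x) \<le> K"
    using compact_imp_bounded[OF compact_continuous_image[OF continuous_on_subset[OF c\<psi> subset_UNIV] cT]]
    unfolding bounded_iff by auto
  have D0: "D \<ge> 0" and M0: "M \<ge> 0" and K0: "K \<ge> 0"
    using D[OF PT] M[OF PT] K[OF PT] norm_ge_zero order_trans by blast+
  have lip: "\<bar>\<psi> x - \<psi> y\<bar> \<le> M * norm (x - y)" if "x \<in> T" "y \<in> T" for x y
  proof -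
    have "norm (\<psi> x - \<psi> y) \<le> M * norm (x - y)"
    proof (rule differentiable_bound[OF convT _ _ that(1) that(2)])
      fix z assume "z \<in> T"
      show "(\<psi> has_derivative (\<lambda>h. g z \<bullet> h)) (at z within T)"
        using \<psi> has_derivative_at_withinI by blast
      show "onorm (\<lambda>h. g z \<bullet> h) \<le> M"
      proof (rule onorm_bound[OF M0])
        show "norm (g z \<bullet> h) \<le> M * norm h" for h
          using mult_right_mono[OF M[OF \<open>z \<in> T\<close>] norm_ge_zero[of h]]
            Cauchy_Schwarz_ineq2[of "g z" h] by simp
      qed
    qed
    then show ?thesis by simp
  qed
  \<comment> \<open>The shift by 2 keeps every \<open>s j\<close> strictly between 0 and 1.\<close>
  define s where "s j = 1 - 1 / real (j + 2)" for j :: nat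
  have s: "0 < s j" "s j < 1" for j by (auto simp: s_def)
  have s1: "s \<longlonglongrightarrow> 1"
  proof -
    have "(\<lambda>j. 1 - 1 / real (j + 2)) \<longlonglongrightarrow> 1 - 0"
      by (intro tendsto_intros LIMSEQ_ignore_initial_segment[OF lim_1_over_n])
    then show ?thesis by (simp add: s_def[abs_def])
  qed
  have inT: "P + t *\<^sub>R (x - P) \<in> T" if "x \<in> T" "0 \<le> t" "t \<le> 1" for x t
    using convexD_alt[OF convT PT that(1), of t] that by (simp add: algebra_simps)
  \<comment> \<open>Pulled back to \<open>T\<close>, the integral over the cone contracted by
    \<open>s\<close> has integrand \<open>s ^ n * \<psi> (P + s *\<^sub>R (x - P))\<close> with n
    the dimension. \<open>q\<close> is its difference quotient at 1, and the pointwise limit is the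
    integrand of the claim.\<close>
  define q where "q j x = indicator T x * ((\<psi> x - s j ^ ?n * \<psi> (P + s j *\<^sub>R (x - P))) / (1 - s
      j))" for j x
  \<comment> \<open>Bounds the difference quotients of the n-th power uniformly in \<open>j\<close>,
    for dominated convergence.\<close>
  have bern: "1 - t ^ ?n \<le> real ?n * (1 - t)" if "0 < t" "t < 1" for t :: real
    using Bernoulli_inequality[of "t - 1" ?n] that by (simp add: algebra_simps)
  have intT: "integrable lborel (\<lambda>x. indicator T x * f x)" if "continuous_on UNIV f" for f :: "'a \<Rightarrow> real"
    using integrable_indicator_compact[OF cT that] by simp
  have lim1: "(\<lambda>j. LINT x|lborel. q j x) \<longlonglongrightarrow>
      (LINT x|lborel. indicator T x * (real ?n * \<psi> x + g x \<bullet> (x - P)))"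
  proof (rule integral_dominated_convergence)
    show "integrable lborel (\<lambda>x. indicator T x * (M * D + real ?n * K))"
      by (rule intT) (intro continuous_intros)
    show "AE x in lborel. (\<lambda>j. q j x) \<longlonglongrightarrow> indicator T x * (real ?n * \<psi> x + g x \<bullet> (x - P))"
    proof (rule AE_I2)
      fix x
      define h where "h t = t ^ ?n * \<psi> (P + t *\<^sub>R (x - P))" for t
      have "((\<lambda>t. P + t *\<^sub>R (x - P)) has_derivative (\<lambda>t. t *\<^sub>R (x - P))) (at 1)"
        by (auto intro!: derivative_eq_intros)
      from has_derivative_compose[OF this, of \<psi> "\<lambda>h. g x \<bullet> h"] \<psi>[of x]
      have "((\<lambda>t. \<psi> (P + t *\<^sub>R (x - P))) has_derivative (\<lambda>t. g x \<bullet> (t *\<^sub>R (x - P)))) (at 1)"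
        by simp
      then have "((\<lambda>t. \<psi> (P + t *\<^sub>R (x - P))) has_real_derivative g x \<bullet> (x - P)) (at 1)"
        unfolding has_field_derivative_def by (rule has_derivative_eq_rhs) auto
      then have "(h has_real_derivative (real ?n * \<psi> x + g x \<bullet> (x - P))) (at 1)"
        unfolding h_def by (auto intro!: derivative_eq_intros)
      then have "((\<lambda>t. (h t - h 1) / (t - 1)) \<longlongrightarrow> (real ?n * \<psi> x + g x \<bullet> (x - P))) (at 1)"
        by (simp add: has_field_derivative_iff)
      moreover have "filterlim s (at 1) sequentially"
        using s1 s(2) less_imp_neq by (fastforce simp: filterlim_at intro!: eventuallyI)
      ultimately have "(\<lambda>j. (h (s j) - h 1) / (s j - 1)) \<longlonglongrightarrow> (real ?n * \<psi> x + g x \<bullet> (x - P))"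
        by (rule filterlim_compose)
      moreover have "(h (s j) - h 1) / (s j - 1) = (\<psi> x - s j ^ ?n * \<psi> (P + s j *\<^sub>R (x - P))) / (1
          - s j)" for j
        using s(2)[of j] by (simp add: h_def divide_simps) (simp add: algebra_simps)
      ultimately show "(\<lambda>j. q j x) \<longlonglongrightarrow> indicator T x * (real ?n * \<psi> x + g x \<bullet> (x - P))"
        unfolding q_def by (intro tendsto_intros) simp
    qed
    show "AE x in lborel. norm (q j x) \<le> indicator T x * (M * D + real ?n * K)" for j
    proof (rule AE_I2)
      fix x
      show "norm (q j x) \<le> indicator T x * (M * D + real ?n * K)"
      proof (cases "x \<in> T")
        case True
        let ?y = "P + s j *\<^sub>R (x - P)"
        have y: "?y \<in> T" using inT[OF True, of "s j"] s[of j] by simp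
        have "x - ?y = (1 - s j) *\<^sub>R (x - P)" by (simp add: algebra_simps)
        then have nxy: "norm (x - ?y) \<le> (1 - s j) * D"
          using s(2)[of j] D[OF True] by (simp add: mult_left_mono)
        have "\<psi> x - s j ^ ?n * \<psi> ?y = (\<psi> x - \<psi> ?y) + (1 - s j ^ ?n) * \<psi> ?y"
          by (simp add: algebra_simps)
        then have "\<bar>\<psi> x - s j ^ ?n * \<psi> ?y\<bar> \<le> \<bar>\<psi> x - \<psi> ?y\<bar> + \<bar>1 - s j ^ ?n\<bar> * \<bar>\<psi> ?y\<bar>"
          by (metis abs_mult abs_triangle_ineq)
        also have "\<dots> \<le> M * ((1 - s j) * D) + (real ?n * (1 - s j)) * K"
        proof (rule add_mono)
          show "\<bar>\<psi> x - \<psi> ?y\<bar> \<le> M * ((1 - s j) * D)"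
            using lip[OF True y] nxy M0 by (meson mult_left_mono order_trans)
          have "s j ^ ?n \<le> 1" using s[of j] by (simp add: power_le_one)
          then show "\<bar>1 - s j ^ ?n\<bar> * \<bar>\<psi> ?y\<bar> \<le> (real ?n * (1 - s j)) * K"
            using bern[OF s] K[OF y] s(2)[of j] by (intro mult_mono) auto
        qed
        also have "\<dots> = (M * D + real ?n * K) * (1 - s j)" by (simp add: algebra_simps)
        finally show ?thesis
          using s(2)[of j] True by (simp add: q_def divide_simps)
      qed (simp add: q_def)
    qed
  qed (auto simp: q_def)
  define V where "V = (LINT x|lborel. indicat_real T x)"
  have Qb: "\<bar>LINT x|lborel. q j x\<bar> \<le> M * D * (V * (1 - s j ^ ?n))" for j
  proof -
    let ?s = "s j"
    \<comment> \<open>After the dilation, \<open>k\<close> is \<psi> restricted to the contracted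
      cone and \<open>d\<close> is the indicator of the removed layer, of volume
      \<open>V * (1 - s ^ n)\<close>.\<close>
    define k where "k z = indicator T (P + (1/?s) *\<^sub>R (z - P)) * \<psi> z" for z
    define d where "d z = indicat_real T z - indicator T (P + (1/?s) *\<^sub>R (z - P))" for z
    have [measurable]: "k \<in> borel_measurable borel" and [measurable]: "(\<lambda>z. indicat_real T (P +
        (1/?s) *\<^sub>R (z - P))) \<in> borel_measurable borel"
      unfolding k_def by measurable
    have ik: "(LINT z|lborel. k z) = ?s ^ ?n * (LINT x|lborel. indicator T x * \<psi> (P + ?s *\<^sub>R (x - P)))"
      using integral_lborel_dilation[of k ?s P] s(1)[of j] by (simp add: k_def)
    have iV: "(LINT z|lborel. indicat_real T (P + (1/?s) *\<^sub>R (z - P))) = ?s ^ ?n * V"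
      using integral_lborel_dilation[of "\<lambda>z. indicat_real T (P + (1/?s) *\<^sub>R (z - P))" ?s P] s(1)[of j]
      by (simp add: V_def)
    have sub: "z \<in> T" if "P + (1/?s) *\<^sub>R (z - P) \<in> T" for z
      using inT[OF that, of ?s] s[of j] by simp
    have int\<psi>: "integrable lborel (\<lambda>x. indicator T x * \<psi> x)" by (rule intT[OF c\<psi>])
    have int1: "integrable lborel (indicat_real T)" using intT[of "\<lambda>_. 1"] by simp
    have intk: "integrable lborel k"
      by (rule Bochner_Integration.integrable_bound[OF int\<psi>]) (auto simp: k_def indicator_def sub)
    have int1': "integrable lborel (\<lambda>z. indicat_real T (P + (1/?s) *\<^sub>R (z - P)))"
      by (rule Bochner_Integration.integrable_bound[OF int1]) (auto simp: indicator_def sub)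
    have dV: "(LINT z|lborel. d z) = V - ?s ^ ?n * V"
      unfolding d_def Bochner_Integration.integral_diff[OF int1 int1'] iV V_def ..
    have int2: "integrable lborel (\<lambda>x. indicator T x * \<psi> (P + ?s *\<^sub>R (x - P)))"
      by (intro intT continuous_on_compose2[OF c\<psi>] continuous_intros) auto
    have bound: "\<bar>indicator T z * \<psi> z - k z\<bar> \<le> M * D * (1 - ?s) * d z" for z
    proof (cases "z \<in> T \<and> P + (1/?s) *\<^sub>R (z - P) \<notin> T")
      case True
      then obtain u v y where uv: "u \<ge> 0" "v \<ge> 0" "u + v = 1" "y \<in> F" and z: "z = u *\<^sub>R P + v *\<^sub>R y"
        using F unfolding T convex_hull_insert[OF F(3)] by (auto simp: hull_same)
      have u1: "u = 1 - v" using uv by simp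
      have zP: "z - P = v *\<^sub>R (y - P)" by (simp add: z u1 algebra_simps)
      \<comment> \<open>The point lies on the segment from \<open>P\<close> to \<open>y\<close> in
        the facet. Being outside the contracted cone puts it beyond parameter \<open>s\<close>,
        hence within \<open>(1 - s) * D\<close> of \<open>y\<close>, where \<psi> vanishes.\<close>
      have "v > ?s"
      proof (rule ccontr)
        assume "\<not> v > ?s"
        then have "P + (v / ?s) *\<^sub>R (y - P) \<in> T" using uv FT s(1)[of j] by (intro inT) auto
        then show False using True by (simp add: zP)
      qed
      have "\<bar>\<psi> z\<bar> = \<bar>\<psi> z - \<psi> y\<bar>" using zero[OF uv(4)] by simp
      also have "\<dots> \<le> M * norm (z - y)" using lip True uv FT by blast
      also have "z - y = (-u) *\<^sub>R (y - P)" by (simp add: z u1 algebra_simps)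
      also have "M * norm ((-u) *\<^sub>R (y - P)) \<le> M * ((1 - ?s) * D)"
        using uv \<open>v > ?s\<close> D[of y] FT M0 D0
        by (intro mult_left_mono) (auto intro!: mult_mono)
      finally show ?thesis using True by (simp add: k_def d_def algebra_simps)
    next
      case False
      then show ?thesis using sub by (auto simp: k_def d_def indicator_def)
    qed
    have "(1 - ?s) * q j x = indicator T x * \<psi> x - ?s ^ ?n * (indicator T x * \<psi> (P + ?s *\<^sub>R (x -
        P)))" for x
      using s(2)[of j] by (simp add: q_def indicator_def)
    then have "(1 - ?s) * (LINT x|lborel. q j x) =
        (LINT x|lborel. indicator T x * \<psi> x - ?s ^ ?n * (indicator T x * \<psi> (P + ?s *\<^sub>R (x - P))))"
      by (simp flip: Bochner_Integration.integral_mult_right_zero)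
    also have "\<dots> = (LINT x|lborel. indicator T x * \<psi> x) - (LINT z|lborel. k z)"
      using int\<psi> int2 by (simp add: ik)
    also have "\<dots> = (LINT z|lborel. indicator T z * \<psi> z - k z)"
      using int\<psi> intk by simp
    also have "\<bar>\<dots>\<bar> \<le> (LINT z|lborel. M * D * (1 - ?s) * d z)"
      using bound int\<psi> intk int1 int1'
      by (intro order_trans[OF integral_abs_bound] integral_mono) (auto simp: d_def)
    also have "\<dots> = (1 - ?s) * (M * D * (V * (1 - ?s ^ ?n)))"
      unfolding Bochner_Integration.integral_mult_right_zero dV by (simp add: algebra_simps)
    finally show ?thesis using s(2)[of j] by (simp add: abs_mult)
  qed
  have lim2: "(\<lambda>j. LINT x|lborel. q j x) \<longlonglongrightarrow> 0"
  proof (rule Lim_null_comparison)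
    show "\<forall>\<^sub>F j in sequentially. norm (LINT x|lborel. q j x) \<le> M * D * (V * (1 - s j ^ ?n))"
      using Qb by simp
    have "(\<lambda>j. M * D * (V * (1 - s j ^ ?n))) \<longlonglongrightarrow> M * D * (V * (1 - 1 ^ ?n))"
      by (intro tendsto_intros s1)
    then show "(\<lambda>j. M * D * (V * (1 - s j ^ ?n))) \<longlonglongrightarrow> 0" by simp
  qed
  show ?thesis
    using LIMSEQ_unique[OF lim1 lim2]
    by (subst integral_lebesgue_on_compact[OF cT]) simp_all
qed

section \<open>Barycentric coordinates and face functionals\<close>

text \<open>Barycentric coordinates are kept as a gradient and a constant on the whole space,
  because the interpolant and the affine map between neighbouring simplices are written in terms of
  both.\<close>

definition bary_grad :: "'a::euclidean_space set \<Rightarrow> 'a \<Rightarrow> 'a" where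
  "bary_grad C P = (SOME a. \<exists>c. \<forall>Q\<in>C. a \<bullet> Q + c = (if Q = P then 1 else 0))"

definition bary_const :: "'a::euclidean_space set \<Rightarrow> 'a \<Rightarrow> real" where
  "bary_const C P = (SOME c. \<forall>Q\<in>C. bary_grad C P \<bullet> Q + c = (if Q = P then 1 else 0))"

definition bary :: "'a::euclidean_space set \<Rightarrow> 'a \<Rightarrow> 'a \<Rightarrow> real" where
  "bary C P x = bary_grad C P \<bullet> x + bary_const C P"

text \<open>Seen from another vertex \<open>R\<close>, the remaining vertices are linearly
  independent directions, so a linear functional can be prescribed on them.\<close>

lemma bary_exists:
  fixes C :: "'a::euclidean_space set"
  assumes "\<not> affine_dependent C" "P \<in> C"
  shows "\<exists>a c. \<forall>Q\<in>C. a \<bullet> Q + c = (if Q = P then 1 else 0 :: real)"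
proof (cases "C = {P}")
  case True
  then show ?thesis by (intro exI[of _ 0] exI[of _ 1]) auto
next
  case False
  then obtain R where R: "R \<in> C" "R \<noteq> P" using assms by blast
  let ?B = "(+) (- R) ` (C - {R})"
  have "independent ?B"
    using affine_dependent_iff_dependent2[OF R(1)] assms(1) by simp
  then obtain g :: "'a \<Rightarrow> real" where g: "linear g" "\<forall>x\<in>?B. g x = (if x = P - R then 1 else 0)"
    using real_vector.linear_independent_extend[of ?B "\<lambda>x. if x = P - R then 1 else 0"] by blast
  \<comment> \<open>The vector that represents the functional \<open>g\<close>.\<close>
  define a where "a = adjoint g 1"
  have a: "a \<bullet> x = g x" for x
    using adjoint_works[OF g(1), of x 1] by (simp add: a_def inner_commute)
  show ?thesis
  proof (intro exI[of _ a] exI[of _ "- (a \<bullet> R)"] ballI)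
    fix Q assume Q: "Q \<in> C"
    have "a \<bullet> Q + - (a \<bullet> R) = g (Q - R)" by (simp add: a[symmetric] inner_diff_right)
    also have "\<dots> = (if Q = P then 1 else 0)"
    proof (cases "Q = R")
      case True
      then show ?thesis using R linear_0[OF g(1)] by auto
    next
      case False
      then have "Q - R \<in> ?B" using Q by (intro image_eqI[of _ _ Q]) auto
      then show ?thesis using g(2) by auto
    qed
    finally show "a \<bullet> Q + - (a \<bullet> R) = (if Q = P then 1 else 0)" .
  qed
qed

lemma bary_vertex:
  fixes C :: "'a::euclidean_space set"
  assumes "\<not> affine_dependent C" "P \<in> C" "Q \<in> C"
  shows "bary C P Q = (if Q = P then 1 else 0)"
proof -
  have "\<exists>c. \<forall>Q\<in>C. bary_grad C P \<bullet> Q + c = (if Q = P then 1 else 0)"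
    unfolding bary_grad_def by (rule someI_ex) (use bary_exists[OF assms(1,2)] in blast)
  then have "\<forall>Q\<in>C. bary_grad C P \<bullet> Q + bary_const C P = (if Q = P then 1 else 0)"
    unfolding bary_const_def by (rule someI_ex)
  then show ?thesis using assms by (auto simp: bary_def)
qed

lemma bary_facet_eq_0:
  fixes C :: "'a::euclidean_space set"
  assumes "\<not> affine_dependent C" "P \<in> C" "x \<in> convex hull (C - {P})"
  shows "bary C P x = 0"
proof -
  have "convex hull (C - {P}) \<subseteq> {x. bary_grad C P \<bullet> x = - bary_const C P}"
  proof (rule hull_minimal)
    show "C - {P} \<subseteq> {x. bary_grad C P \<bullet> x = - bary_const C P}"
      using bary_vertex[OF assms(1,2)] by (force simp: bary_def)
  qed (rule convex_hyperplane)
  then show ?thesis using assms(3) by (auto simp: bary_def)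
qed

lemma bary_diff: "bary C P x - bary C P y = bary_grad C P \<bullet> (x - y)"
  by (simp add: bary_def inner_diff_right)

text \<open>Two affine functions with different gradients agree only on a hyperplane or nowhere, and
  such a set contains no hull with interior. Besides the barycentric identities, this later turns
  one scalar condition per vertex into the vanishing of a vector and a number.\<close>

lemma affine_function_eqI:
  fixes C :: "'a::euclidean_space set"
  assumes "interior (convex hull C) \<noteq> {}" and "\<And>Q. Q \<in> C \<Longrightarrow> a \<bullet> Q + c = a' \<bullet> Q + c'"
  shows "a = a'" "c = c'"
proof -
  have "convex hull C \<subseteq> {x. (a - a') \<bullet> x = c' - c}"
  proof (rule hull_minimal)
    show "C \<subseteq> {x. (a - a') \<bullet> x = c' - c}" using assms(2) by (force simp: inner_diff_left)
  qed (rule convex_hyperplane)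
  moreover from this have "interior (convex hull C) \<subseteq> interior {x. (a - a') \<bullet> x = c' - c}"
    by (rule interior_mono)
  ultimately show "a = a'"
    using assms(1) interior_hyperplane[of "a - a'" "c' - c"] by auto
  have "C \<noteq> {}" using assms(1) by auto
  then show "c = c'" using assms(2) \<open>a = a'\<close> by force
qed

locale full_simplex =
  fixes C :: "'a::euclidean_space set" and T :: "'a set"
  assumes indep: "\<not> affine_dependent C" and card_C: "card C = Suc DIM('a)"
    and T: "T = convex hull C"
begin

lemma finite_C: "finite C" using aff_independent_finite indep by blast
lemma compact_T: "compact T" unfolding T by (simp add: finite_C finite_imp_compact_convex_hull)
lemma convex_T: "convex T" unfolding T by simp
lemma interior_T: "interior T \<noteq> {}" unfolding T using interior_convex_hull_eq_empty[OF card_C]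
    indep by simp
lemma C_sub_T: "C \<subseteq> T" unfolding T by (rule hull_subset)
lemma vertices_T: "vertices T = C"
  unfolding vertices_def T using extreme_point_of_convex_hull_affine_independent[OF indep] by auto

lemma facet_ne:
  assumes "P \<in> C" shows "C - {P} \<noteq> {}"
proof
  assume "C - {P} = {}"
  then have "C = {P}" using assms by auto
  then have "DIM('a) = 0" using card_C by simp
  then show False using DIM_positive[where 'a='a] by simp
qed

lemma vertices_facet:
  assumes "P \<in> C" shows "vertices (convex hull (C - {P})) = C - {P}"
  using extreme_point_of_convex_hull_affine_independent[OF affine_independent_Diff[OF indep, of "{P}"]]
  unfolding vertices_def by auto

lemma mid_T: "mid T = (1 / (real DIM('a) + 1)) *\<^sub>R \<Sum>C"
  by (simp add: mid_def vertices_T card_C add.commute)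

lemma mid_facet:
  assumes "P \<in> C" shows "mid (convex hull (C - {P})) = mid T + (1 / real DIM('a)) *\<^sub>R (mid T - P)"
proof -
  have "mid (convex hull (C - {P})) = (1 / real DIM('a)) *\<^sub>R (\<Sum>C - P)"
    using assms by (simp add: mid_def vertices_facet card_C finite_C sum_diff1)
  also have "\<Sum>C = (real DIM('a) + 1) *\<^sub>R mid T" by (simp add: mid_T)
  finally show ?thesis by (simp add: algebra_simps)
qed

lemma bary_sum: "(\<Sum>P\<in>C. bary C P x) = 1"
proof -
  have "(\<Sum>P\<in>C. bary_grad C P) = 0 \<and> (\<Sum>P\<in>C. bary_const C P) = 1"
  proof
    have *: "(\<Sum>P\<in>C. bary_grad C P) \<bullet> Q + (\<Sum>P\<in>C. bary_const C P) = 0 \<bullet> Q + 1" if "Q \<in> C" for Q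
    proof -
      have "(\<Sum>P\<in>C. bary_grad C P) \<bullet> Q + (\<Sum>P\<in>C. bary_const C P) = (\<Sum>P\<in>C. bary C P Q)"
        by (simp add: bary_def inner_sum_left sum.distrib)
      also have "\<dots> = (\<Sum>P\<in>C. if Q = P then 1 else 0)"
        using that by (intro sum.cong) (auto simp: bary_vertex[OF indep])
      finally show ?thesis using that finite_C by simp
    qed
    show "(\<Sum>P\<in>C. bary_grad C P) = 0" "(\<Sum>P\<in>C. bary_const C P) = 1"
      using affine_function_eqI[OF interior_T[unfolded T] *] by auto
  qed
  then show ?thesis by (simp add: bary_def sum.distrib inner_sum_left[symmetric])
qed

text \<open>Componentwise, both sides are affine in \<open>x\<close> and agree at the
  vertices.\<close>

lemma bary_combination: "(\<Sum>P\<in>C. bary C P x *\<^sub>R P) = x"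
proof (rule euclidean_eqI)
  fix b :: 'a assume b: "b \<in> Basis"
  have *: "(\<Sum>P\<in>C. (P \<bullet> b) *\<^sub>R bary_grad C P) \<bullet> Q + (\<Sum>P\<in>C. (P \<bullet> b) * bary_const C P)
      = b \<bullet> Q + 0" if "Q \<in> C" for Q
  proof -
    have "(\<Sum>P\<in>C. (P \<bullet> b) *\<^sub>R bary_grad C P) \<bullet> Q + (\<Sum>P\<in>C. (P \<bullet> b) * bary_const C P)
        = (\<Sum>P\<in>C. (P \<bullet> b) * bary C P Q)"
      by (simp add: bary_def inner_sum_left sum.distrib algebra_simps)
    also have "\<dots> = (\<Sum>P\<in>C. if Q = P then P \<bullet> b else 0)"
      using that by (intro sum.cong) (auto simp: bary_vertex[OF indep])
    finally show ?thesis using that finite_C by (simp add: inner_commute)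
  qed
  have "(\<Sum>P\<in>C. (P \<bullet> b) *\<^sub>R bary_grad C P) = b" "(\<Sum>P\<in>C. (P \<bullet> b) * bary_const C P) = 0"
    using affine_function_eqI[OF interior_T[unfolded T] *] by auto
  then have "(\<Sum>P\<in>C. (P \<bullet> b) * bary C P x) = b \<bullet> x"
    by (simp add: bary_def distrib_left sum.distrib inner_sum_left[symmetric] flip: inner_scaleR_left)
  then show "(\<Sum>P\<in>C. bary C P x *\<^sub>R P) \<bullet> b = x \<bullet> b"
    by (simp add: inner_sum_left mult.commute inner_commute[of b])
qed

lemma continuous_bary: "continuous_on S (bary C P)"
  unfolding bary_def[abs_def] by (intro continuous_intros)

lemma bary_has_derivative: "(bary C P has_derivative (\<lambda>h. bary_grad C P \<bullet> h)) (at x)"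
  unfolding bary_def[abs_def] by (auto intro!: derivative_eq_intros)

text \<open>Every vertex can serve as the apex of a cone over the opposite facet; in this form the
  cone identity applies to simplices.\<close>

lemma T_insert: "P \<in> C \<Longrightarrow> T = convex hull (insert P (convex hull (C - {P})))"
  unfolding T by (subst hull_insert[symmetric]) (simp add: insert_absorb)

lemma cone_eq_0:
  assumes "P \<in> C" "\<And>x. (\<psi> has_derivative (\<lambda>h. g x \<bullet> h)) (at x)" "continuous_on UNIV g"
    and "\<And>x. x \<in> convex hull (C - {P}) \<Longrightarrow> \<psi> x = 0"
  shows "(LINT x|lebesgue_on T. real DIM('a) * \<psi> x + g x \<bullet> (x - P)) = 0"
  using facet_ne[OF assms(1)]
  by (intro integral_cone_eq_0[OF _ _ _ T_insert[OF assms(1)]] assms)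
     (auto simp: finite_C finite_imp_compact_convex_hull)

lemma integrable_T [intro]:
  fixes f :: "'a \<Rightarrow> 'b::euclidean_space"
  assumes "continuous_on UNIV f" shows "integrable (lebesgue_on T) f"
proof -
  have "T \<in> sets lborel" using borel_compact[OF compact_T] by simp
  then have *: "T \<inter> space lebesgue \<in> sets lebesgue" by simp
  have [measurable]: "f \<in> borel_measurable borel" "T \<in> sets borel"
    using assms borel_compact[OF compact_T] by (auto intro: borel_measurable_continuous_onI)
  show ?thesis
    unfolding integrable_restrict_space[OF *]
    by (subst integrable_completion) (auto intro: integrable_indicator_compact[OF compact_T assms])
qed

abbreviation "vol \<equiv> measure lebesgue T"

lemma vol_pos: "vol > 0"
proof (rule ccontr)
  assume "\<not> vol > 0"
  then have "vol = 0" using measure_nonneg[of lebesgue T] by linarith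
  then have "negligible T"
    using negligible_iff_measure0[OF lmeasurable_compact[OF compact_T]] by simp
  then have "negligible (interior T)"
    using interior_subset negligible_subset by blast
  then show False using open_not_negligible[OF open_interior interior_T] by simp
qed

lemma measure_restrict_T [simp]: "measure (lebesgue_on T) T = vol"
proof -
  have "T \<in> sets lebesgue" using compact_T by (simp add: lmeasurable_compact fmeasurableD)
  then show ?thesis by (simp add: measure_restrict_space)
qed

end

section \<open>Moments over a simplex and the bubble\<close>

context full_simplex
begin

abbreviation E :: "('a \<Rightarrow> real) \<Rightarrow> real" where "E f \<equiv> (LINT x|lebesgue_on T. f x)"

lemma integrable_const_T [simp]: "integrable (lebesgue_on T) (\<lambda>x. c :: real)"
  by (rule integrable_T) simp

lemma bary_grad_inner:
  "P \<in> C \<Longrightarrow> Q \<in> C \<Longrightarrow> bary_grad C Q \<bullet> (x - P) = bary C Q x - (if P = Q then 1 else 0)"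
  by (simp add: bary_diff[symmetric] bary_vertex[OF indep])

text \<open>The coordinate of \<open>P\<close> vanishes on the facet opposite to \<open>P\<close>,
  and its derivative along \<open>x - P\<close> is the coordinate minus 1. The cone identity
  therefore evaluates the integral without a reference simplex.\<close>

lemma E_bary:
  assumes P: "P \<in> C" shows "E (bary C P) = vol / (real DIM('a) + 1)"
proof -
  have i: "integrable (lebesgue_on T) (bary C P)" by (rule integrable_T[OF continuous_bary])
  have "E (\<lambda>x. real DIM('a) * bary C P x + bary_grad C P \<bullet> (x - P)) = 0"
    by (rule cone_eq_0[OF P bary_has_derivative]) (auto simp: bary_facet_eq_0[OF indep P])
  then have "E (\<lambda>x. (real DIM('a) + 1) * bary C P x - 1) = 0"
    unfolding bary_grad_inner[OF P P] by (simp add: distrib_right add_diff_eq)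
  then have "(real DIM('a) + 1) * E (bary C P) - vol = 0" using i by simp
  then show ?thesis by (simp add: field_simps)
qed

text \<open>The product still vanishes on the facet opposite to \<open>P\<close>, so the cone
  identity reduces this second moment to the first one. For \<open>P = Q\<close> both factors
  contribute the constant at the apex, whence the factor 2.\<close>

lemma E_bary_bary:
  assumes P: "P \<in> C" and Q: "Q \<in> C"
  shows "E (\<lambda>x. bary C P x * bary C Q x) =
    (if P = Q then 2 else 1) * vol / ((real DIM('a) + 1) * (real DIM('a) + 2))"
proof -
  let ?n = "real DIM('a)"
  let ?l = "\<lambda>x. bary C P x * bary C Q x"
  let ?q = "if P = Q then 2 else 1 :: real"
  have i: "integrable (lebesgue_on T) (bary C R)" for R by (rule integrable_T[OF continuous_bary])
  have i2: "integrable (lebesgue_on T) ?l"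
    by (rule integrable_T) (intro continuous_intros continuous_bary)
  have der: "(?l has_derivative (\<lambda>h. (bary C P x *\<^sub>R bary_grad C Q + bary C Q x *\<^sub>R bary_grad C P)
      \<bullet> h)) (at x)" for x
    by (rule has_derivative_eq_rhs[OF has_derivative_mult[OF bary_has_derivative bary_has_derivative]])
       (auto simp: inner_add_left)
  have "E (\<lambda>x. ?n * ?l x + (bary C P x *\<^sub>R bary_grad C Q + bary C Q x *\<^sub>R bary_grad C P) \<bullet> (x - P)) = 0"
    by (rule cone_eq_0[OF P der]) (auto intro!: continuous_intros continuous_bary simp:
        bary_facet_eq_0[OF indep P])
  moreover have "?n * ?l x + (bary C P x *\<^sub>R bary_grad C Q + bary C Q x *\<^sub>R bary_grad C P) \<bullet> (x - P) =
     (?n + 2) * ?l x - ?q * bary C Q x" for x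
    unfolding inner_add_left inner_scaleR_left bary_grad_inner[OF P P] bary_grad_inner[OF P Q]
    by (auto simp: algebra_simps)
  ultimately have "(?n + 2) * E ?l - ?q * E (bary C Q) = 0" using i i2 by simp
  then have "(?n + 2) * E ?l = ?q * (vol / (?n + 1))" by (simp add: E_bary[OF Q])
  moreover have "?n + 2 \<noteq> 0" by linarith
  ultimately have "E ?l = ?q * (vol / (?n + 1)) / (?n + 2)" by (simp add: nonzero_eq_divide_eq
      mult.commute)
  then show ?thesis by simp
qed

lemma E_affine: "E (\<lambda>x. a \<bullet> x + c) = vol * (a \<bullet> mid T + c)"
proof -
  have i: "integrable (lebesgue_on T) (bary C R)" for R by (rule integrable_T[OF continuous_bary])
  have "a \<bullet> x + c = (\<Sum>P\<in>C. bary C P x * (a \<bullet> P)) + c" for x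
    by (subst (1) bary_combination[of x, symmetric]) (simp add: inner_sum_right)
  then have "E (\<lambda>x. a \<bullet> x + c) = E (\<lambda>x. (\<Sum>P\<in>C. bary C P x * (a \<bullet> P)) + c)"
    by (simp only:)
  also have "\<dots> = (\<Sum>P\<in>C. E (bary C P) * (a \<bullet> P)) + vol * c"
    using i by simp
  also have "\<dots> = vol * (a \<bullet> mid T + c)"
    by (simp add: E_bary mid_T inner_sum_right distrib_left
        flip: sum_divide_distrib sum_distrib_left)
  finally show ?thesis .
qed

lemma mid_sum_0: "(\<Sum>P\<in>C. P - mid T) = 0"
  by (simp add: sum_subtractf card_C sum_constant_scaleR mid_T)
     (simp add: add.commute)

text \<open>Around the barycenter, the part of the second moments common to all pairs multiplies the
  squared norm of the sum of all \<open>P - mid T\<close>, which is zero. Only the surplus on the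
  diagonal remains.\<close>

lemma E_square: "E (\<lambda>x. (norm (x - mid T))\<^sup>2) =
    vol * (\<Sum>P\<in>C. (norm (P - mid T))\<^sup>2) / ((real DIM('a) + 1) * (real DIM('a) + 2))"
proof -
  let ?n = "real DIM('a)"
  let ?d = "\<lambda>P. P - mid T"
  let ?w = "vol / ((?n + 1) * (?n + 2))"
  have "x - mid T = (\<Sum>P\<in>C. bary C P x *\<^sub>R ?d P)" for x
    by (simp add: scaleR_diff_right sum_subtractf bary_combination bary_sum flip: scaleR_sum_left)
  then have "(norm (x - mid T))\<^sup>2 = (\<Sum>P\<in>C. bary C P x *\<^sub>R ?d P) \<bullet> (\<Sum>P\<in>C. bary C P x *\<^sub>R ?d P)" for x
    by (metis power2_norm_eq_inner)
  also have "\<dots> x = (\<Sum>P\<in>C. \<Sum>Q\<in>C. (bary C P x * bary C Q x) * (?d P \<bullet> ?d Q))" for x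
    unfolding inner_sum_left inner_sum_right
    by (intro sum.cong refl) (simp add: inner_commute mult.assoc)
  finally have "E (\<lambda>x. (norm (x - mid T))\<^sup>2) = (\<Sum>P\<in>C. \<Sum>Q\<in>C. E (\<lambda>x. bary C P x * bary C Q x) * (?d
      P \<bullet> ?d Q))"
    by (simp add: Bochner_Integration.integral_sum integrable_T continuous_intros continuous_bary)
  also have "\<dots> = (\<Sum>P\<in>C. \<Sum>Q\<in>C. ?w * (?d P \<bullet> ?d Q) + (if P = Q then ?w * (?d P \<bullet> ?d Q) else 0))"
    by (intro sum.cong) (auto simp: E_bary_bary)
  also have "\<dots> = ?w * ((\<Sum>P\<in>C. ?d P) \<bullet> (\<Sum>Q\<in>C. ?d Q)) + (\<Sum>P\<in>C. ?w * (?d P \<bullet> ?d P))"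
    by (simp add: sum.distrib finite_C sum_distrib_left inner_sum_left inner_sum_right)
      (simp add: inner_commute)
  also have "\<dots> = ?w * (\<Sum>P\<in>C. (norm (?d P))\<^sup>2)"
    by (simp add: mid_sum_0 sum_distrib_left power2_norm_eq_inner)
  finally show ?thesis by simp
qed

text \<open>Connects two normalisations: the bubble is defined by squared edge lengths, the second
  moment is expressed by squared distances to the barycenter. Mixed terms cancel because the vectors
  \<open>P - mid T\<close> sum to zero.\<close>

lemma vertex_distance_sum:
  "(\<Sum>P\<in>C. \<Sum>Q\<in>C - {P}. (norm (P - Q))\<^sup>2) = 2 * (real DIM('a) + 1) * (\<Sum>P\<in>C. (norm (P - mid T))\<^sup>2)"
proof -
  let ?d = "\<lambda>P. P - mid T"
  have e: "(norm (P - Q))\<^sup>2 = (norm (?d P))\<^sup>2 + (norm (?d Q))\<^sup>2 - 2 * (?d P \<bullet> ?d Q)" for P Q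
    unfolding power2_norm_eq_inner by (simp add: inner_diff_left inner_diff_right inner_commute)
  have "(\<Sum>P\<in>C. \<Sum>Q\<in>C. (norm (P - Q))\<^sup>2) =
      (\<Sum>P\<in>C. \<Sum>Q\<in>C. (norm (?d P))\<^sup>2 + (norm (?d Q))\<^sup>2 - 2 * (?d P \<bullet> ?d Q))"
    by (intro sum.cong refl e)
  also have "\<dots> = (\<Sum>P\<in>C. \<Sum>Q\<in>C. (norm (?d P))\<^sup>2) + (\<Sum>P\<in>C. \<Sum>Q\<in>C. (norm (?d Q))\<^sup>2)"
  proof -
    have "(\<Sum>P\<in>C. \<Sum>Q\<in>C. ?d P \<bullet> ?d Q) = (\<Sum>P\<in>C. ?d P \<bullet> (\<Sum>Q\<in>C. ?d Q))"
      by (simp only: inner_sum_right)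
    then have "(\<Sum>P\<in>C. \<Sum>Q\<in>C. ?d P \<bullet> ?d Q) = 0" by (simp only: mid_sum_0 inner_zero_right
        sum.neutral_const)
    then show ?thesis
      by (simp only: sum.distrib sum_subtractf sum_distrib_left[symmetric])
  qed
  also have "\<dots> = 2 * (real DIM('a) + 1) * (\<Sum>P\<in>C. (norm (P - mid T))\<^sup>2)"
    by (simp add: card_C sum_distrib_left algebra_simps)
  finally have "(\<Sum>P\<in>C. \<Sum>Q\<in>C. (norm (P - Q))\<^sup>2) = 2 * (real DIM('a) + 1) * (\<Sum>P\<in>C. (norm (P - mid T))\<^sup>2)" .
  moreover have "(\<Sum>Q\<in>C. (norm (P - Q))\<^sup>2) = (\<Sum>Q\<in>C - {P}. (norm (P - Q))\<^sup>2)" if "P \<in> C" for P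
    using that finite_C by (subst sum.remove[of C P]) auto
  ultimately show ?thesis by simp
qed

definition bubble_coeff :: real where
  "bubble_coeff = real DIM('a) * (real DIM('a) + 1)\<^sup>2 * (real DIM('a) + 2) / (\<Sum>P\<in>vertices T.
      \<Sum>Q\<in>vertices T - {P}. (norm (P - Q))\<^sup>2)"

definition bubble_poly :: "'a \<Rightarrow> real" where
  "bubble_poly x = (real DIM('a) + 2) / 2 - bubble_coeff * (norm (x - mid T))\<^sup>2"

lemma bubble_eq: "x \<in> T \<Longrightarrow> bubble T x = bubble_poly x"
  by (simp add: bubble_def bubble_poly_def bubble_coeff_def Let_def)

text \<open>The constant in the bubble is made for this value: with n the dimension, the mean
  becomes \<open>(n + 2) / 2 - n / 2 = 1\<close>, and the same number makes the facet means
  zero.\<close>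

lemma bubble_coeff_moment: "bubble_coeff * E (\<lambda>x. (norm (x - mid T))\<^sup>2) = vol * real DIM('a) / 2"
proof -
  let ?n = "real DIM('a)" and ?S = "\<Sum>P\<in>C. (norm (P - mid T))\<^sup>2"
  have "?S \<noteq> 0"
  proof
    assume "?S = 0"
    then have "\<And>P. P \<in> C \<Longrightarrow> P = mid T" using finite_C by (simp add: sum_nonneg_eq_0_iff)
    moreover obtain P where "P \<in> C" using card_C by fastforce
    ultimately show False using facet_ne[of P] by blast
  qed
  moreover have "?n > 0" by simp
  ultimately show ?thesis
    unfolding bubble_coeff_def vertices_T vertex_distance_sum E_square
    by (simp add: divide_simps power2_eq_square)
qed

lemma cont_sq: "continuous_on UNIV (\<lambda>x. (norm (x - mid T))\<^sup>2)" by (intro continuous_intros)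

lemma E_bubble: "E bubble_poly = vol"
proof -
  have "E bubble_poly = vol * ((real DIM('a) + 2) / 2) - bubble_coeff * E (\<lambda>x. (norm (x - mid T))\<^sup>2)"
    unfolding bubble_poly_def[abs_def] using integrable_T[OF cont_sq]
    by (subst Bochner_Integration.integral_diff) auto
  then show ?thesis by (simp add: bubble_coeff_moment field_simps)
qed

lemma continuous_bubble: "continuous_on UNIV bubble_poly"
  unfolding bubble_poly_def[abs_def] by (intro continuous_intros)

text \<open>By the cone identity, \<open>face_functional P f g\<close> is \<open>n |T|\<close> times the mean of \<open>f\<close> over the
  facet opposite to \<open>P\<close> when \<open>g\<close> is the gradient of \<open>f\<close>; written as an integral over \<open>T\<close>, it makes
  sense for Sobolev functions without a trace operator.\<close>

definition face_functional :: "'a \<Rightarrow> ('a \<Rightarrow> real) \<Rightarrow> ('a \<Rightarrow> 'a) \<Rightarrow> real" where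
  "face_functional P f g = (LINT x|lebesgue_on T. real DIM('a) * f x + g x \<bullet> (x - P))"

lemma face_functional_affine:
  assumes "P \<in> C"
  shows "face_functional P (\<lambda>x. a \<bullet> x + c) (\<lambda>x. a) = real DIM('a) * vol * (a \<bullet> mid (convex hull (C
      - {P})) + c)"
proof -
  let ?n = "real DIM('a)"
  have "?n * (a \<bullet> x + c) + a \<bullet> (x - P) = ((?n + 1) *\<^sub>R a) \<bullet> x + (?n * c - a \<bullet> P)" for x
    by (simp add: algebra_simps inner_diff_right)
  then have "face_functional P (\<lambda>x. a \<bullet> x + c) (\<lambda>x. a) = E (\<lambda>x. ((?n + 1) *\<^sub>R a) \<bullet> x + (?n * c - a \<bullet> P))"
    by (simp add: face_functional_def)
  also have "\<dots> = vol * (((?n + 1) *\<^sub>R a) \<bullet> mid T + (?n * c - a \<bullet> P))" by (rule E_affine)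
  finally show ?thesis by (simp add: mid_facet[OF assms] inner_diff_right inner_add_right
      inner_add_left divide_simps)
    (simp add: algebra_simps)
qed

text \<open>Adding bubbles thus changes the volume mean but no facet mean. Splitting
  \<open>x - P\<close> at the barycenter leaves an affine term that vanishes at
  \<open>mid T\<close>, hence has integral zero, and a radial term settled by
  \<open>bubble_coeff_moment\<close>.\<close>

lemma face_functional_bubble:
  "face_functional P bubble_poly (\<lambda>x. (- 2 * bubble_coeff) *\<^sub>R (x - mid T)) = 0"
proof -
  let ?n = "real DIM('a)" and ?k = "bubble_coeff"
  have "?n * bubble_poly x + ((- 2 * ?k) *\<^sub>R (x - mid T)) \<bullet> (x - P) =
     (?n * ((?n + 2) / 2)) - (?n + 2) * ?k * (norm (x - mid T))\<^sup>2
       + ((- 2 * ?k) *\<^sub>R (mid T - P) \<bullet> x + (2 * ?k) * ((mid T - P) \<bullet> mid T))" for x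
    unfolding bubble_poly_def power2_norm_eq_inner
    by (simp add: inner_diff_left inner_diff_right inner_commute algebra_simps)
  then have "face_functional P bubble_poly (\<lambda>x. (- 2 * ?k) *\<^sub>R (x - mid T)) =
     vol * (?n * ((?n + 2) / 2)) - (?n + 2) * (?k * E (\<lambda>x. (norm (x - mid T))\<^sup>2))
      + E (\<lambda>x. (- 2 * ?k) *\<^sub>R (mid T - P) \<bullet> x + (2 * ?k) * ((mid T - P) \<bullet> mid T))"
    unfolding face_functional_def
    using integrable_T[OF cont_sq] by (simp add: integrable_T continuous_intros)
  also have "\<dots> = 0"
    unfolding E_affine bubble_coeff_moment unfolding inner_scaleR_left by (simp add: field_simps)
  finally show ?thesis .
qed

lemma face_functional_eq_0:
  assumes "P \<in> C" "\<And>x. (\<psi> has_derivative (\<lambda>h. g x \<bullet> h)) (at x)" "continuous_on UNIV g"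
    and "\<And>x. x \<in> convex hull (C - {P}) \<Longrightarrow> \<psi> x = 0"
  shows "face_functional P \<psi> g = 0"
  unfolding face_functional_def by (rule cone_eq_0[OF assms])

end

text \<open>Both sides are n times the mean over the common facet. The affine map that fixes this
  facet and sends \<open>P\<close> to \<open>P'\<close> carries \<open>T\<close> to
  \<open>T'\<close>; the difference of \<phi> and its pullback vanishes on the facet, so the cone
  identity annihilates its functional on \<open>T\<close>.\<close>

lemma face_functional_match:
  fixes C C' :: "'a::euclidean_space set"
  assumes S: "full_simplex C T" and S': "full_simplex C' T'" and P: "P \<in> C" and P': "P' \<in> C'"
    and same: "C - {P} = C' - {P'}"
    and \<phi>: "\<And>x. (\<phi> has_derivative (\<lambda>h. g x \<bullet> h)) (at x)" and g: "continuous_on UNIV g"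
  shows "full_simplex.face_functional T P \<phi> g / measure lebesgue T
       = full_simplex.face_functional T' P' \<phi> g / measure lebesgue T'"
proof -
  interpret S: full_simplex C T by fact
  interpret S': full_simplex C' T' by fact
  define d where "d = P' - P"
  define a where "a = bary_grad C P"
  \<comment> \<open>\<open>A\<close> moves \<open>x\<close> along \<open>P' - P\<close> in
    proportion to its barycentric coordinate at \<open>P\<close>. \<open>L\<close> is the linear
    part of \<open>A\<close>, and \<open>La\<close> is the adjoint of \<open>L\<close>, which
    transports gradients.\<close>
  define L where "L h = h + (a \<bullet> h) *\<^sub>R d" for h
  define b where "b = bary_const C P *\<^sub>R d"
  define A where "A x = L x + b" for x
  define La where "La y = y + (y \<bullet> d) *\<^sub>R a" for y
  have A: "A x = x + bary C P x *\<^sub>R d" for x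
    by (simp add: A_def L_def b_def a_def bary_def algebra_simps)
  have La: "La y \<bullet> h = y \<bullet> L h" for y h
    by (simp add: La_def L_def inner_add_left inner_add_right inner_commute algebra_simps)
  have linL: "linear L"
    by (rule linearI) (simp_all add: L_def algebra_simps inner_add_right)
  have AP: "A P = P'" by (simp add: A bary_vertex[OF S.indep P P] d_def)
  have AQ: "A Q = Q" if "Q \<in> C - {P}" for Q using that by (simp add: A bary_vertex[OF S.indep P])
  have AC: "A ` C = C'"
  proof -
    have "A ` C = insert (A P) (A ` (C - {P}))" using P by blast
    also have "A ` (C - {P}) = C - {P}" using AQ by force
    finally show ?thesis using AP same P' by auto
  qed
  have AL: "A x - A y = L (x - y)" for x y
    by (simp add: A_def linear_diff[OF linL])
  \<comment> \<open>The coordinate of \<open>P'\<close> pulls back to that of \<open>P\<close>,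
    since the two agree at the vertices. Hence \<open>L h = 0\<close> forces
    \<open>a \<bullet> h = 0\<close> and then \<open>h = 0\<close>, which gives injectivity.\<close>
  have LaD: "La (bary_grad C' P') = a"
  proof (rule affine_function_eqI(1)[OF S.interior_T[unfolded S.T]])
    fix Q assume Q: "Q \<in> C"
    have "La (bary_grad C' P') \<bullet> Q + (bary_grad C' P' \<bullet> b + bary_const C' P') = bary C' P' (A Q)"
      by (simp add: La bary_def A_def inner_add_right)
    also have "\<dots> = bary C P Q"
    proof (cases "Q = P")
      case True
      then show ?thesis by (simp add: AP bary_vertex[OF S.indep P P] bary_vertex[OF S'.indep P' P'])
    next
      case False
      then have "Q \<in> C - {P}" using Q by simp
      moreover from this have "Q \<in> C'" "Q \<noteq> P'" unfolding same by auto
      ultimately show ?thesis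
        using False by (simp add: AQ bary_vertex[OF S.indep P Q] bary_vertex[OF S'.indep P'])
    qed
    finally show "La (bary_grad C' P') \<bullet> Q + (bary_grad C' P' \<bullet> b + bary_const C' P')
        = a \<bullet> Q + bary_const C P"
      by (simp add: bary_def a_def)
  qed
  have "inj L"
  proof (rule linear_injective_0[OF linL, THEN iffD2], intro allI impI)
    fix h assume h: "L h = 0"
    have "a \<bullet> h = bary_grad C' P' \<bullet> L h" by (simp flip: LaD La)
    then show "h = 0" using h by (simp add: L_def)
  qed
  then obtain c where c: "c > 0" "\<And>f :: 'a \<Rightarrow> real. f \<in> borel_measurable borel \<Longrightarrow>
     (LINT x|lborel. f (L x + b)) = c * (LINT x|lborel. f x)"
    using integral_lborel_affine_bijection[OF linL] by metis
  have "inj A" using \<open>inj L\<close> by (auto simp: A_def inj_def)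
  have "A ` T = (+) b ` L ` T" by (auto simp: A_def image_image add.commute)
  also have "\<dots> = convex hull ((+) b ` L ` C)"
    by (simp add: S.T convex_hull_linear_image[OF linL] convex_hull_translation)
  also have "(+) b ` L ` C = A ` C" by (auto simp: A_def image_image add.commute)
  finally have AT: "A ` T = T'" by (simp add: AC S'.T)
  have indA: "indicator T' (A x) = (indicator T x :: real)" for x
    using \<open>inj A\<close> by (auto simp: AT[symmetric] indicator_def inj_image_mem_iff)
  have contA: "continuous_on UNIV A" unfolding A[abs_def] by (intro continuous_intros S.continuous_bary)
  have ET: "S'.E f = S.E (\<lambda>x. f (A x)) / c" if f: "continuous_on UNIV f" for f
  proof -
    have [measurable]: "f \<in> borel_measurable borel" "T' \<in> sets borel"
      using f borel_compact[OF S'.compact_T] by (auto intro: borel_measurable_continuous_onI)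
    have fA: "continuous_on UNIV (\<lambda>x. f (A x))"
      using continuous_on_compose2[OF f contA] by simp
    have "c * S'.E f = c * (LINT x|lborel. indicator T' x *\<^sub>R f x)"
      by (subst integral_lebesgue_on_compact[OF S'.compact_T]) simp_all
    also have "\<dots> = (LINT x|lborel. indicator T' (A x) *\<^sub>R f (A x))"
      unfolding A_def by (rule c(2)[symmetric]) measurable
    also have "\<dots> = S.E (\<lambda>x. f (A x))"
      unfolding indA
      by (subst integral_lebesgue_on_compact[OF S.compact_T])
         (use fA in \<open>auto intro: borel_measurable_continuous_onI\<close>)
    finally show ?thesis using c(1) by (simp add: field_simps)
  qed
  have vol: "S'.vol = S.vol / c" using ET[of "\<lambda>_. 1"] by simp
  have c\<phi>: "continuous_on UNIV \<phi>"
    by (rule has_derivative_continuous_on[OF has_derivative_at_withinI[OF \<phi>]])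
  let ?n = "real DIM('a)"
  have contLa: "continuous_on UNIV (\<lambda>x. La (g (A x)))"
    unfolding La_def by (intro continuous_intros continuous_on_compose2[OF g contA]) auto
  have c\<phi>A: "continuous_on UNIV (\<lambda>x. \<phi> (A x))"
    using continuous_on_compose2[OF c\<phi> contA] by simp
  have "S'.face_functional P' \<phi> g = S.E (\<lambda>x. ?n * \<phi> (A x) + g (A x) \<bullet> (A x - P')) / c"
    unfolding S'.face_functional_def by (rule ET) (intro continuous_intros c\<phi> g)
  also have "(\<lambda>x. ?n * \<phi> (A x) + g (A x) \<bullet> (A x - P')) = (\<lambda>x. ?n * \<phi> (A x) + La (g (A x)) \<bullet> (x - P))"
    by (simp add: La AP[symmetric] AL)
  finally have 1: "S'.face_functional P' \<phi> g = S.face_functional P (\<lambda>x. \<phi> (A x)) (\<lambda>x. La (g (A x))) / c"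
    by (simp add: S.face_functional_def)
  have Ader: "(A has_derivative L) (at x)" for x
    unfolding A[abs_def] L_def a_def
    by (auto intro!: derivative_eq_intros S.bary_has_derivative)
  have "S.face_functional P (\<lambda>x. \<phi> x - \<phi> (A x)) (\<lambda>x. g x - La (g (A x))) = 0"
  proof (rule S.face_functional_eq_0[OF P])
    show "((\<lambda>x. \<phi> x - \<phi> (A x)) has_derivative (\<lambda>h. (g x - La (g (A x))) \<bullet> h)) (at x)" for x
      using has_derivative_diff[OF \<phi>[of x] has_derivative_compose[OF Ader[of x] \<phi>[of "A x"]]]
      by (simp add: inner_diff_left La)
    show "continuous_on UNIV (\<lambda>x. g x - La (g (A x)))"
      by (intro continuous_intros g contLa)
    show "\<phi> x - \<phi> (A x) = 0" if "x \<in> convex hull (C - {P})" for x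
      using bary_facet_eq_0[OF S.indep P that] by (simp add: A)
  qed
  moreover have "S.face_functional P (\<lambda>x. \<phi> x - \<phi> (A x)) (\<lambda>x. g x - La (g (A x))) =
     S.face_functional P \<phi> g - S.face_functional P (\<lambda>x. \<phi> (A x)) (\<lambda>x. La (g (A x)))"
    unfolding S.face_functional_def
    by (subst Bochner_Integration.integral_diff[symmetric])
       (auto intro!: S.integrable_T continuous_intros c\<phi> g contLa c\<phi>A simp: inner_diff_left
           algebra_simps)
  ultimately show ?thesis using 1 vol c(1) by simp
qed

section \<open>Weak gradients\<close>

definition flat_exp :: "real poly \<Rightarrow> real \<Rightarrow> real" where
  "flat_exp p t = (if t \<le> 0 then 0 else poly p (1 / t) * exp (- 1 / t))"

lemma tendsto_poly_mult_exp_minus: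
  "((\<lambda>s. poly p s * exp (- s)) \<longlongrightarrow> 0) (at_top :: real filter)"
proof -
  have "((\<lambda>s. \<Sum>i\<le>degree p. coeff p i * (s ^ i / exp s)) \<longlongrightarrow> (\<Sum>i\<le>degree p. coeff p i * 0)) (at_top ::
      real filter)"
    by (intro tendsto_intros tendsto_power_div_exp_0)
  moreover have "poly p s * exp (- s) = (\<Sum>i\<le>degree p. coeff p i * (s ^ i / exp s))" for s :: real
    by (simp add: poly_altdef sum_distrib_right exp_minus divide_inverse mult.assoc)
  ultimately show ?thesis by simp
qed

text \<open>The polynomial factor in \<open>1 / t\<close> makes the family closed under
  differentiation; \<open>monom 1 2\<close> comes from the derivative of \<open>1 / t\<close>. At 0
  all of these functions are flat, because the exponential beats every power.\<close>

lemma flat_exp_has_derivative: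
  "(flat_exp p has_real_derivative flat_exp (monom 1 2 * (p - pderiv p)) t) (at t)"
proof -
  consider "t < 0" | "t > 0" | "t = 0" by linarith
  then show ?thesis
  proof cases
    case 1
    have "((\<lambda>_. 0) has_real_derivative 0) (at t)" by simp
    then have "(flat_exp p has_real_derivative 0) (at t)"
      by (rule has_field_derivative_transform_within_open[of _ _ _ "{..<0}"])
         (use 1 in \<open>auto simp: flat_exp_def\<close>)
    then show ?thesis using 1 by (simp add: flat_exp_def)
  next
    case 2
    have "((\<lambda>t. poly p (1 / t) * exp (- 1 / t)) has_real_derivative
        (poly (pderiv p) (1 / t) * (- 1 / t\<^sup>2)) * exp (- 1 / t) + (exp (- 1 / t) * (1 / t\<^sup>2)) *
            poly p (1 / t)) (at t)"
      using 2 by (auto intro!: derivative_eq_intros DERIV_chain2[OF poly_DERIV] simp: power2_eq_square)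
    then have "(flat_exp p has_real_derivative
        (poly (pderiv p) (1 / t) * (- 1 / t\<^sup>2)) * exp (- 1 / t) + (exp (- 1 / t) * (1 / t\<^sup>2)) *
            poly p (1 / t)) (at t)"
      by (rule has_field_derivative_transform_within_open[of _ _ _ "{0<..}"])
         (use 2 in \<open>auto simp: flat_exp_def\<close>)
    then show ?thesis using 2
      by (simp add: flat_exp_def poly_monom power_divide divide_simps) (simp add: algebra_simps)
  next
    case 3
    \<comment> \<open>Dividing by \<open>t\<close> multiplies the polynomial by its variable, hence
      \<open>pCons 0 p\<close>.\<close>
    have "((\<lambda>s. poly (pCons 0 p) s * exp (- s)) \<longlongrightarrow> 0) (at_top :: real filter)"
      by (rule tendsto_poly_mult_exp_minus)
    then have "((\<lambda>t. poly (pCons 0 p) (inverse t) * exp (- inverse t)) \<longlongrightarrow> 0) (at_right (0::real))"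
      using filterlim_inverse_at_top_right filterlim_compose by fast
    then have r: "((\<lambda>t. flat_exp p t / t) \<longlongrightarrow> 0) (at_right 0)"
      by (rule Lim_transform_eventually)
         (auto simp: eventually_at_filter flat_exp_def divide_inverse)
    have l: "((\<lambda>t. flat_exp p t / t) \<longlongrightarrow> 0) (at_left 0)"
      by (rule Lim_transform_eventually[of "\<lambda>_. 0"]) (auto simp: eventually_at_filter flat_exp_def)
    have "((\<lambda>t. flat_exp p t / t) \<longlongrightarrow> 0) (at 0)"
      using l r by (simp add: filterlim_split_at)
    then show ?thesis using 3 by (simp add: has_field_derivative_iff flat_exp_def)
  qed
qed

text \<open>A class closed under partial derivatives, so that membership gives smoothness of every
  order by a plain induction. Working with \<open>Ck\<close> directly would require a Leibniz rule
  for iterated partial derivatives.\<close>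

inductive smooth_gen :: "('a::euclidean_space \<Rightarrow> real) \<Rightarrow> bool" where
  const: "smooth_gen (\<lambda>_. c)"
| atom: "smooth_gen (\<lambda>x. flat_exp p (a \<bullet> x + c))"
| add: "smooth_gen f \<Longrightarrow> smooth_gen g \<Longrightarrow> smooth_gen (\<lambda>x. f x + g x)"
| mult: "smooth_gen f \<Longrightarrow> smooth_gen g \<Longrightarrow> smooth_gen (\<lambda>x. f x * g x)"

lemma smooth_gen_derivative:
  "smooth_gen f \<Longrightarrow> \<exists>D. (\<forall>x. (f has_derivative D x) (at x)) \<and> (\<forall>b. smooth_gen (\<lambda>x. D x b))"
proof (induction rule: smooth_gen.induct)
  case (const c)
  show ?case by (intro exI[of _ "\<lambda>_ _. 0"]) (auto intro: smooth_gen.const)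
next
  case (atom p a c)
  let ?q = "monom 1 2 * (p - pderiv p)"
  have "((\<lambda>x. flat_exp p (a \<bullet> x + c)) has_derivative (\<lambda>h. flat_exp ?q (a \<bullet> x + c) * (a \<bullet> h))) (at
      x)" for x
    by (rule has_derivative_compose[of "\<lambda>x. a \<bullet> x + c" "\<lambda>h. a \<bullet> h" _ _ "flat_exp p"])
       (use flat_exp_has_derivative[of p "a \<bullet> x + c"] in
         \<open>auto intro!: derivative_eq_intros simp: has_field_derivative_def\<close>)
  then show ?case
    by (intro exI[of _ "\<lambda>x h. flat_exp ?q (a \<bullet> x + c) * (a \<bullet> h)"])
       (auto intro!: smooth_gen.intros)
next
  case (add f g)
  then obtain D E where "\<forall>x. (f has_derivative D x) (at x)" "\<forall>b. smooth_gen (\<lambda>x. D x b)"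
     "\<forall>x. (g has_derivative E x) (at x)" "\<forall>b. smooth_gen (\<lambda>x. E x b)" by blast
  then show ?case
    by (intro exI[of _ "\<lambda>x h. D x h + E x h"]) (auto intro!: smooth_gen.intros has_derivative_add)
next
  case (mult f g)
  then obtain D E where "\<forall>x. (f has_derivative D x) (at x)" "\<forall>b. smooth_gen (\<lambda>x. D x b)"
     "\<forall>x. (g has_derivative E x) (at x)" "\<forall>b. smooth_gen (\<lambda>x. E x b)" by blast
  then show ?case using mult.hyps
    by (intro exI[of _ "\<lambda>x h. f x * E x h + D x h * g x"]) (auto intro!: smooth_gen.intros
        has_derivative_mult)
qed

lemma smooth_gen_imp_Ck: "smooth_gen f \<Longrightarrow> Ck k f"
proof (induction k arbitrary: f)
  case 0
  then show ?case using smooth_gen_derivative has_derivative_continuous_on has_derivative_at_withinI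
    by (metis Ck.simps(1))
next
  case (Suc k)
  obtain D where D: "\<forall>x. (f has_derivative D x) (at x)" "\<forall>b. smooth_gen (\<lambda>x. D x b)"
    using smooth_gen_derivative[OF Suc.prems] by blast
  have "frechet_derivative f (at x) = D x" for x
    using D(1) frechet_derivative_at by metis
  then show ?case using D Suc.IH by (auto simp: differentiable_def)
qed

lemma smooth_gen_prod: "finite I \<Longrightarrow> (\<And>i. i \<in> I \<Longrightarrow> smooth_gen (f i)) \<Longrightarrow> smooth_gen (\<lambda>x. \<Prod>i\<in>I. f i x)"
  by (induction I rule: finite_induct) (auto intro: smooth_gen.intros)

text \<open>A product of one-dimensional cut-offs at both ends of every side, positive exactly on
  the open box; stretching by \<open>Suc k\<close> drives its values there to 1. The arguments are
  written in the shape required by \<open>atom\<close>.\<close>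

definition box_bump :: "'a::euclidean_space \<Rightarrow> 'a \<Rightarrow> nat \<Rightarrow> 'a \<Rightarrow> real" where
  "box_bump a b k x = (\<Prod>i\<in>Basis. flat_exp 1 ((real (Suc k) *\<^sub>R i) \<bullet> x + - real (Suc k) * (a \<bullet> i))
      * flat_exp 1 ((- real (Suc k) *\<^sub>R i) \<bullet> x + real (Suc k) * (b \<bullet> i)))"

lemma flat_exp_one: "0 \<le> flat_exp 1 t" "flat_exp 1 t \<le> 1" "flat_exp 1 t = 0 \<longleftrightarrow> t \<le> 0"
  by (auto simp: flat_exp_def)

lemma box_bump_eq:
  "box_bump a b k x = (\<Prod>i\<in>Basis. flat_exp 1 (real (Suc k) * (x \<bullet> i - a \<bullet> i)) * flat_exp 1 (real
      (Suc k) * (b \<bullet> i - x \<bullet> i)))"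
  unfolding box_bump_def by (intro prod.cong refl arg_cong2[where f="(*)"] arg_cong[where
      f="flat_exp 1"])
    (simp_all add: inner_commute right_diff_distrib del: of_nat_Suc)

lemma box_bump_bounds: "0 \<le> box_bump a b k x" "box_bump a b k x \<le> 1"
  unfolding box_bump_def
  by (auto intro!: prod_nonneg prod_le_1 mult_nonneg_nonneg mult_le_one simp: flat_exp_one)

lemma box_bump_nonzero: "box_bump a b k x \<noteq> 0 \<longleftrightarrow> x \<in> box a b"
  unfolding box_bump_eq by (auto simp: flat_exp_one mem_box mult_le_0_iff not_le)

lemma box_bump_tendsto: "(\<lambda>k. box_bump a b k x) \<longlonglongrightarrow> indicator (box a b) x"
proof (cases "x \<in> box a b")
  case False
  then have "box_bump a b k x = 0" for k using box_bump_nonzero by blast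
  then show ?thesis using False by simp
next
  case True
  have f: "(\<lambda>k. flat_exp 1 (real (Suc k) * s)) \<longlonglongrightarrow> 1" if "s > 0" for s
  proof -
    have "(\<lambda>k. exp (- (inverse (real (Suc k)) * inverse s))) \<longlonglongrightarrow> exp (- (0 * inverse s))"
      by (intro tendsto_intros LIMSEQ_inverse_real_of_nat)
    moreover have "flat_exp 1 (real (Suc k) * s) = exp (- (inverse (real (Suc k)) * inverse s))" for k
      using that by (simp add: flat_exp_def divide_inverse mult_le_0_iff del: of_nat_Suc)
    ultimately show ?thesis by simp
  qed
  have "(\<lambda>k. box_bump a b k x) \<longlonglongrightarrow> (\<Prod>i\<in>(Basis::'a set). 1 * 1)"
    unfolding box_bump_eq using True by (intro tendsto_intros f) (auto simp: mem_box)
  then show ?thesis using True by simp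
qed

lemma test_function_box_bump:
  assumes "cbox a b \<subseteq> U" shows "test_function U (box_bump a b k)"
proof -
  have "smooth_gen (box_bump a b k)"
    unfolding box_bump_def[abs_def] by (intro smooth_gen_prod smooth_gen.intros) auto
  moreover have sub: "closure {x. box_bump a b k x \<noteq> 0} \<subseteq> cbox a b"
    by (rule closure_minimal) (auto simp: box_bump_nonzero intro: box_subset_cbox[THEN subsetD])
  ultimately show ?thesis
    unfolding test_function_def using assms
    by (auto intro: smooth_gen_imp_Ck simp: compact_eq_bounded_closed intro: bounded_subset[OF
        bounded_cbox])
qed

section \<open>Square-integrable functions and test functions\<close>

lemma L2_D:
  assumes "f \<in> L2 U"
  shows "f \<in> borel_measurable (lebesgue_on U)" "integrable (lebesgue_on U) (\<lambda>x. (norm (f x))\<^sup>2)"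
  using assms by (auto simp: L2_def)

lemma norm_mult_le_squares: "a * b \<le> a\<^sup>2 + (b::real)\<^sup>2"
proof -
  have "0 \<le> (a - b)\<^sup>2 + a\<^sup>2 + b\<^sup>2" by simp
  then show ?thesis by (simp add: power2_eq_square algebra_simps)
qed

lemma L2_integrable_bound:
  fixes f :: "'a::euclidean_space \<Rightarrow> 'b::euclidean_space" and g :: "'a \<Rightarrow> 'c::euclidean_space"
    and h :: "'a \<Rightarrow> 'd::euclidean_space"
  assumes "f \<in> L2 U" "g \<in> L2 U" "h \<in> borel_measurable (lebesgue_on U)"
    and "\<And>x. norm (h x) \<le> norm (f x) * norm (g x)"
  shows "integrable (lebesgue_on U) h"
proof (rule Bochner_Integration.integrable_bound)
  show "integrable (lebesgue_on U) (\<lambda>x. (norm (f x))\<^sup>2 + (norm (g x))\<^sup>2)"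
    using L2_D[OF assms(1)] L2_D[OF assms(2)] by simp
  show "AE x in lebesgue_on U. norm (h x) \<le> norm ((norm (f x))\<^sup>2 + (norm (g x))\<^sup>2)"
    using assms(4) norm_mult_le_squares order_trans by fastforce
qed (rule assms(3))

lemma L2_integrable_scaleR:
  fixes f :: "'a::euclidean_space \<Rightarrow> real" and g :: "'a \<Rightarrow> 'c::euclidean_space"
  assumes "f \<in> L2 U" "g \<in> L2 U"
  shows "integrable (lebesgue_on U) (\<lambda>x. f x *\<^sub>R g x)"
  by (rule L2_integrable_bound[OF assms]) (use L2_D(1)[OF assms(1)] L2_D(1)[OF assms(2)] in auto)

lemma L2_integrable_mult:
  fixes f g :: "'a::euclidean_space \<Rightarrow> real"
  assumes "f \<in> L2 U" "g \<in> L2 U"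
  shows "integrable (lebesgue_on U) (\<lambda>x. f x * g x)"
  using L2_integrable_scaleR[OF assms] by simp

lemma L2_integrable_inner:
  fixes f g :: "'a::euclidean_space \<Rightarrow> 'c::euclidean_space"
  assumes "f \<in> L2 U" "g \<in> L2 U"
  shows "integrable (lebesgue_on U) (\<lambda>x. f x \<bullet> g x)"
  by (rule L2_integrable_bound[OF assms])
     (use L2_D(1)[OF assms(1)] L2_D(1)[OF assms(2)] Cauchy_Schwarz_ineq2 in auto)

lemma L2_scaleR:
  fixes f :: "'a::euclidean_space \<Rightarrow> 'c::euclidean_space"
  assumes "f \<in> L2 U" shows "(\<lambda>x. c *\<^sub>R f x) \<in> L2 U"
  using L2_D[OF assms] by (auto simp: L2_def power_mult_distrib)

lemma L2_add:
  fixes f g :: "'a::euclidean_space \<Rightarrow> 'c::euclidean_space"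
  assumes "f \<in> L2 U" "g \<in> L2 U" shows "(\<lambda>x. f x + g x) \<in> L2 U"
proof -
  have [measurable]: "f \<in> borel_measurable (lebesgue_on U)" "g \<in> borel_measurable (lebesgue_on U)"
    using assms L2_D by auto
  have "integrable (lebesgue_on U) (\<lambda>x. (norm (f x))\<^sup>2 + (norm (g x))\<^sup>2 + 2 * (f x \<bullet> g x))"
    using L2_D[OF assms(1)] L2_D[OF assms(2)] L2_integrable_inner[OF assms] by simp
  then have "integrable (lebesgue_on U) (\<lambda>x. (norm (f x + g x))\<^sup>2)"
    by (simp add: power2_norm_eq_inner inner_add_left inner_add_right inner_commute algebra_simps)
  then show ?thesis by (auto simp: L2_def)
qed

lemma L2_diff:
  fixes f g :: "'a::euclidean_space \<Rightarrow> 'c::euclidean_space"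
  assumes "f \<in> L2 U" "g \<in> L2 U" shows "(\<lambda>x. f x - g x) \<in> L2 U"
  using L2_add[OF assms(1) L2_scaleR[OF assms(2), of "-1"]] by simp

lemma L2_sum:
  fixes f :: "'i \<Rightarrow> 'a::euclidean_space \<Rightarrow> 'c::euclidean_space"
  assumes "finite I" "\<And>i. i \<in> I \<Longrightarrow> f i \<in> L2 U" shows "(\<lambda>x. \<Sum>i\<in>I. f i x) \<in> L2 U"
  using assms by (induction I rule: finite_induct) (auto simp: L2_def intro!: L2_add[unfolded
      L2_def, simplified])

lemma L2_sum_scaleR:
  fixes f :: "'i \<Rightarrow> 'a::euclidean_space \<Rightarrow> 'c::euclidean_space"
  assumes "finite I" "\<And>i. i \<in> I \<Longrightarrow> f i \<in> L2 U" shows "(\<lambda>x. \<Sum>i\<in>I. c i *\<^sub>R f i x) \<in> L2 U"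
  using L2_sum[of I "\<lambda>i x. c i *\<^sub>R f i x"] assms by (simp add: L2_scaleR)

lemma integrable_lebesgue_on_iff:
  fixes f :: "'a::euclidean_space \<Rightarrow> 'b::euclidean_space"
  assumes "U \<in> sets lebesgue"
  shows "integrable (lebesgue_on U) f \<longleftrightarrow> integrable lebesgue (\<lambda>x. indicator U x *\<^sub>R f x)"
  by (rule integrable_restrict_space) (use assms in simp)

lemma integral_lebesgue_on_eq:
  fixes f :: "'a::euclidean_space \<Rightarrow> 'b::euclidean_space"
  assumes "U \<in> sets lebesgue"
  shows "(LINT x|lebesgue_on U. f x) = (LINT x|lebesgue. indicator U x *\<^sub>R f x)"
  by (rule integral_restrict_space) (use assms in simp)

lemma integrable_lebesgue_on_subset:
  fixes f :: "'a::euclidean_space \<Rightarrow> 'b::euclidean_space"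
  assumes "integrable (lebesgue_on U) f" "U \<in> sets lebesgue" "W \<in> sets lebesgue" "W \<subseteq> U"
  shows "integrable (lebesgue_on W) f"
proof -
  have "integrable lebesgue (\<lambda>x. indicator U x *\<^sub>R f x)"
    using assms integrable_lebesgue_on_iff by blast
  then have "integrable lebesgue (\<lambda>x. indicator W x *\<^sub>R (indicator U x *\<^sub>R f x))"
    by (rule integrable_mult_indicator[OF assms(3)])
  also have "(\<lambda>x. indicator W x *\<^sub>R (indicator U x *\<^sub>R f x)) = (\<lambda>x. indicator W x *\<^sub>R f x)"
    using assms(4) by (intro ext) (auto simp: indicator_def)
  finally show ?thesis using assms integrable_lebesgue_on_iff by blast
qed

lemma L2_subset:
  fixes f :: "'a::euclidean_space \<Rightarrow> 'b::euclidean_space"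
  assumes "f \<in> L2 U" "U \<in> sets lebesgue" "W \<in> sets lebesgue" "W \<subseteq> U"
  shows "f \<in> L2 W"
proof -
  have "f \<in> borel_measurable (lebesgue_on W)"
    using measurable_restrict_mono[OF L2_D(1)[OF assms(1)] assms(4)] .
  moreover have "integrable (lebesgue_on W) (\<lambda>x. (norm (f x))\<^sup>2)"
    using integrable_lebesgue_on_subset[OF L2_D(2)[OF assms(1)] assms(2-4)] .
  ultimately show ?thesis by (simp add: L2_def)
qed

lemma test_function_mono: "test_function W \<phi> \<Longrightarrow> W \<subseteq> U \<Longrightarrow> test_function U \<phi>"
  by (auto simp: test_function_def)

lemma has_derivative_grad:
  fixes f :: "'a::euclidean_space \<Rightarrow> real"
  assumes "f differentiable (at x)"
  shows "(f has_derivative (\<lambda>h. grad f x \<bullet> h)) (at x)"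
proof -
  have D: "(f has_derivative frechet_derivative f (at x)) (at x)"
    using assms frechet_derivative_works by blast
  then interpret D: bounded_linear "frechet_derivative f (at x)" by (rule has_derivative_bounded_linear)
  have "frechet_derivative f (at x) h = grad f x \<bullet> h" for h
  proof -
    have "frechet_derivative f (at x) h = frechet_derivative f (at x) (\<Sum>b\<in>Basis. (h \<bullet> b) *\<^sub>R b)"
      by (simp add: euclidean_representation)
    also have "\<dots> = (\<Sum>b\<in>Basis. (h \<bullet> b) * frechet_derivative f (at x) b)"
      by (simp add: D.sum D.scaleR)
    finally show ?thesis
      unfolding grad_def inner_sum_left by (simp add: inner_commute mult.commute)
  qed
  then show ?thesis using D by (metis (no_types, lifting) ext)
qed

lemma grad_eqI:
  fixes f :: "'a::euclidean_space \<Rightarrow> real"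
  assumes "(f has_derivative (\<lambda>h. g \<bullet> h)) (at x)" shows "grad f x = g"
  using frechet_derivative_at[OF assms]
  by (simp add: grad_def) (metis (no_types, lifting) euclidean_representation sum.cong)

lemma test_function_derivative:
  assumes "test_function U \<phi>"
  shows "(\<phi> has_derivative (\<lambda>h. grad \<phi> x \<bullet> h)) (at x)" "continuous_on UNIV (grad \<phi>)"
    "continuous_on UNIV \<phi>"
proof -
  have C: "Ck (Suc 0) \<phi>" using assms by (auto simp: test_function_def)
  show "(\<phi> has_derivative (\<lambda>h. grad \<phi> x \<bullet> h)) (at x)"
    by (rule has_derivative_grad) (use C in auto)
  show "continuous_on UNIV (grad \<phi>)"
    unfolding grad_def[abs_def] using C by (intro continuous_intros) auto
  show "continuous_on UNIV \<phi>" using assms by (metis Ck.simps(1) test_function_def)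
qed

lemma grad_zero_outside_support:
  assumes "x \<notin> closure {x. \<phi> x \<noteq> 0}"
  shows "grad \<phi> x = 0"
proof (rule grad_eqI)
  have "((\<lambda>_. 0 :: real) has_derivative (\<lambda>h. 0 \<bullet> h)) (at x)" by simp
  then show "(\<phi> has_derivative (\<lambda>h. 0 \<bullet> h)) (at x)"
    by (rule has_derivative_transform_within_open[of _ _ _ _ "- closure {x. \<phi> x \<noteq> 0}"])
       (use assms closure_subset[of "{x. \<phi> x \<noteq> 0}"] in auto)
qed

lemma continuous_compact_support_L2:
  fixes f :: "'a::euclidean_space \<Rightarrow> 'b::euclidean_space"
  assumes "continuous_on UNIV f" "compact K" "\<And>x. x \<notin> K \<Longrightarrow> f x = 0" "U \<in> sets lebesgue"
  shows "f \<in> L2 U"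
proof -
  have [measurable]: "f \<in> borel_measurable borel" using assms(1) by (rule
      borel_measurable_continuous_onI)
  have "continuous_on K (\<lambda>x. (norm (f x))\<^sup>2)"
    by (intro continuous_intros continuous_on_subset[OF assms(1)]) auto
  then have "integrable lborel (\<lambda>x. indicator K x *\<^sub>R (norm (f x))\<^sup>2)"
    using borel_integrable_compact[OF assms(2), of "\<lambda>x. (norm (f x))\<^sup>2"] by (simp add:
        set_integrable_def)
  also have "(\<lambda>x. indicator K x *\<^sub>R (norm (f x))\<^sup>2) = (\<lambda>x. (norm (f x))\<^sup>2)"
    using assms(3) by (intro ext) (auto simp: indicator_def)
  finally have "integrable lebesgue (\<lambda>x. (norm (f x))\<^sup>2)"
    by (subst integrable_completion) auto
  moreover have "f \<in> borel_measurable lebesgue"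
    by (rule measurable_completion) simp
  ultimately have "f \<in> L2 UNIV" by (simp add: L2_def lebesgue_on_UNIV_eq)
  then show ?thesis by (rule L2_subset) (use assms in auto)
qed

lemma test_function_L2:
  assumes "test_function U \<phi>" "W \<in> sets lebesgue"
  shows "\<phi> \<in> L2 W" "grad \<phi> \<in> L2 W"
proof -
  let ?K = "closure {x. \<phi> x \<noteq> 0}"
  have K: "compact ?K" using assms by (simp add: test_function_def)
  show "\<phi> \<in> L2 W"
    by (rule continuous_compact_support_L2[OF test_function_derivative(3)[OF assms(1)] K _ assms(2)])
       (use closure_subset[of "{x. \<phi> x \<noteq> 0}"] in auto)
  show "grad \<phi> \<in> L2 W"
    by (rule continuous_compact_support_L2[OF test_function_derivative(2)[OF assms(1)] K _ assms(2)])
       (rule grad_zero_outside_support)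
qed

lemma integral_lebesgue_on_mono_support:
  fixes f :: "'a::euclidean_space \<Rightarrow> 'b::euclidean_space"
  assumes "W \<subseteq> U" "W \<in> sets lebesgue" "U \<in> sets lebesgue" "\<And>x. x \<notin> W \<Longrightarrow> f x = 0"
  shows "(LINT x|lebesgue_on U. f x) = (LINT x|lebesgue_on W. f x)"
  unfolding integral_lebesgue_on_eq[OF assms(2)] integral_lebesgue_on_eq[OF assms(3)]
  by (intro Bochner_Integration.integral_cong refl) (use assms(1,4) in \<open>auto simp: indicator_def\<close>)

text \<open>Brings the weak gradient on the domain down to a single simplex: a test function on the
  smaller set is one on the larger set, and it vanishes with its gradient outside the smaller
  one.\<close>

lemma weak_gradient_subset:
  assumes "weak_gradient U f g" "open U" "open W" "W \<subseteq> U"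
  shows "weak_gradient W f g"
  unfolding weak_gradient_def
proof (intro allI impI)
  fix \<phi> assume \<phi>: "test_function W \<phi>"
  then have sub: "closure {x. \<phi> x \<noteq> 0} \<subseteq> W" by (simp add: test_function_def)
  have z: "\<phi> x = 0" "grad \<phi> x = 0" if "x \<notin> W" for x
    using that sub closure_subset[of "{x. \<phi> x \<noteq> 0}"] grad_zero_outside_support[of x \<phi>] by auto
  have sets: "W \<in> sets lebesgue" "U \<in> sets lebesgue"
    using assms(2,3) by auto
  have "(LINT x|lebesgue_on U. f x *\<^sub>R grad \<phi> x) = - (LINT x|lebesgue_on U. \<phi> x *\<^sub>R g x)"
    using assms(1) test_function_mono[OF \<phi> assms(4)] by (simp add: weak_gradient_def)
  then show "(LINT x|lebesgue_on W. f x *\<^sub>R grad \<phi> x) = - (LINT x|lebesgue_on W. \<phi> x *\<^sub>R g x)"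
    using integral_lebesgue_on_mono_support[OF assms(4) sets, of "\<lambda>x. f x *\<^sub>R grad \<phi> x"]
      integral_lebesgue_on_mono_support[OF assms(4) sets, of "\<lambda>x. \<phi> x *\<^sub>R g x"] z by simp
qed

lemma weak_gradient_linear:
  fixes f :: "'i \<Rightarrow> 'a::euclidean_space \<Rightarrow> real"
  assumes "finite I" "U \<in> sets lebesgue" "\<And>i. i \<in> I \<Longrightarrow> f i \<in> L2 U" "\<And>i. i \<in> I \<Longrightarrow> g i \<in> L2 U"
    and "\<And>i. i \<in> I \<Longrightarrow> weak_gradient U (f i) (g i)"
  shows "weak_gradient U (\<lambda>x. \<Sum>i\<in>I. c i * f i x) (\<lambda>x. \<Sum>i\<in>I. c i *\<^sub>R g i x)"
  unfolding weak_gradient_def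
proof (intro allI impI)
  fix \<phi> assume \<phi>: "test_function U \<phi>"
  note L = test_function_L2[OF \<phi> assms(2)]
  have i1: "integrable (lebesgue_on U) (\<lambda>x. f i x *\<^sub>R grad \<phi> x)" if "i \<in> I" for i
    using assms(3)[OF that] L(2) by (rule L2_integrable_scaleR)
  have i2: "integrable (lebesgue_on U) (\<lambda>x. \<phi> x *\<^sub>R g i x)" if "i \<in> I" for i
    using L(1) assms(4)[OF that] by (rule L2_integrable_scaleR)
  have "(LINT x|lebesgue_on U. (\<Sum>i\<in>I. c i * f i x) *\<^sub>R grad \<phi> x)
      = (LINT x|lebesgue_on U. (\<Sum>i\<in>I. c i *\<^sub>R (f i x *\<^sub>R grad \<phi> x)))"
    by (simp add: scaleR_sum_left)
  also have "\<dots> = (\<Sum>i\<in>I. c i *\<^sub>R (LINT x|lebesgue_on U. f i x *\<^sub>R grad \<phi> x))"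
    by (subst Bochner_Integration.integral_sum) (use i1 in \<open>auto simp del: scaleR_scaleR\<close>)
  also have "\<dots> = - (\<Sum>i\<in>I. c i *\<^sub>R (LINT x|lebesgue_on U. \<phi> x *\<^sub>R g i x))"
    using assms(5) \<phi> by (simp add: weak_gradient_def sum_negf)
  also have "(\<Sum>i\<in>I. c i *\<^sub>R (LINT x|lebesgue_on U. \<phi> x *\<^sub>R g i x))
      = (LINT x|lebesgue_on U. (\<Sum>i\<in>I. c i *\<^sub>R (\<phi> x *\<^sub>R g i x)))"
    by (subst Bochner_Integration.integral_sum) (use i2 in \<open>auto simp del: scaleR_scaleR\<close>)
  also have "\<dots> = (LINT x|lebesgue_on U. \<phi> x *\<^sub>R (\<Sum>i\<in>I. c i *\<^sub>R g i x))"
    by (simp add: scaleR_sum_right mult.commute)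
  finally show "(LINT x|lebesgue_on U. (\<Sum>i\<in>I. c i * f i x) *\<^sub>R grad \<phi> x)
     = - (LINT x|lebesgue_on U. \<phi> x *\<^sub>R (\<Sum>i\<in>I. c i *\<^sub>R g i x))" .
qed

section \<open>Uniqueness of weak gradients\<close>

lemma sigma_finite_lebesgue: "sigma_finite_measure (lebesgue :: 'a::euclidean_space measure)"
proof
  obtain A :: "'a set set" where A: "countable A" "A \<subseteq> sets lborel" "\<Union>A = space lborel"
      "\<forall>a\<in>A. emeasure lborel a \<noteq> \<infinity>"
    using sigma_finite_measure.sigma_finite_countable[OF sigma_finite_lborel] by blast
  show "\<exists>A::'a set set. countable A \<and> A \<subseteq> sets lebesgue \<and> \<Union> A = space lebesgue
      \<and> (\<forall>a\<in>A. emeasure lebesgue a \<noteq> \<infinity>)"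
    using A by (intro exI[of _ A]) (auto simp: subset_iff)
qed

text \<open>Open boxes are stable under intersection and generate the Borel sets, so vanishing
  integrals extend to Borel sets by a Dynkin argument, in which the total integral handles
  complements. Lebesgue sets differ from Borel sets by null sets only.\<close>

lemma integral_box_zero_imp_AE_zero:
  fixes H :: "'a::euclidean_space \<Rightarrow> 'b::euclidean_space"
  assumes H: "integrable lebesgue H" and "(LINT x|lebesgue. H x) = 0"
    and box: "\<And>a b. (LINT x|lebesgue. indicator (box a b) x *\<^sub>R H x) = 0"
  shows "AE x in lebesgue. H x = 0"
proof (rule sigma_finite_measure.density_zero[OF sigma_finite_lebesgue H])
  have HI: "set_integrable lebesgue A H" if "A \<in> sets lebesgue" for A
    unfolding set_integrable_def by (rule integrable_mult_indicator[OF that H])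
  have B: "set_lebesgue_integral lebesgue A H = 0" if "A \<in> sets borel" for A
  proof -
    let ?E = "range (\<lambda>(a, b). box a b :: 'a set)"
    have E: "sigma_sets UNIV ?E = sets borel" unfolding borel_eq_box by (rule
        sets_measure_of[symmetric]) simp
    have "Int_stable ?E" by (auto simp: Int_stable_def box_Int_box)
    moreover have "?E \<subseteq> Pow UNIV" by auto
    moreover have "A \<in> sigma_sets UNIV ?E"
      using that unfolding borel_eq_box by simp
    ultimately show ?thesis
    proof (induction rule: sigma_sets_induct_disjoint)
      case (basic A)
      then show ?case using box by (auto simp: set_lebesgue_integral_def)
    next
      case empty
      show ?case by (simp add: set_lebesgue_integral_def)
    next
      case (compl A)
      have A: "A \<in> sets lebesgue"
        using compl(1)
        unfolding E by (rule sets_completionI_sets[of _ lborel, simplified])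
      have A': "UNIV - A \<in> sets lebesgue" using sets.compl_sets[OF A] by simp
      have "set_lebesgue_integral lebesgue (A \<union> (UNIV - A)) H
          = set_lebesgue_integral lebesgue A H + set_lebesgue_integral lebesgue (UNIV - A) H"
        by (rule set_integral_Un) (use A A' HI in auto)
      then show ?case using compl assms(2) by (simp add: set_lebesgue_integral_def)
    next
      case (union A)
      have A: "A i \<in> sets lebesgue" for i
        using union(2) unfolding E by (auto intro: sets_completionI_sets[of _ lborel, simplified])
      have "set_lebesgue_integral lebesgue (\<Union>i. A i) H = (\<Sum>i. set_lebesgue_integral lebesgue (A i) H)"
      proof (rule lebesgue_integral_countable_add[OF A])
        show "i \<noteq> j \<Longrightarrow> A i \<inter> A j = {}" for i j using union(1) by (auto simp: disjoint_family_on_def)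
        show "set_integrable lebesgue (\<Union>i. A i) H" by (rule HI) (use A in auto)
      qed
      then show ?case using union by simp
    qed
  qed
  fix A :: "'a set" assume "A \<in> sets lebesgue"
  then obtain C N where CN: "fsigma C" "N \<in> null_sets lebesgue" "C \<union> N = A" "disjnt C N"
    by (rule lebesgue_set_almost_fsigma)
  have C: "C \<in> sets borel"
    using CN(1) by (auto elim!: fsigma.cases simp: borel_closed)
  have "(LINT x|lebesgue. indicator A x *\<^sub>R H x) = (LINT x|lebesgue. indicator C x *\<^sub>R H x)"
  proof (rule integral_cong_AE)
    have [measurable]: "H \<in> borel_measurable lebesgue" using H by auto
    have [measurable]: "A \<in> sets lebesgue" "C \<in> sets lebesgue" using \<open>A \<in> sets lebesgue\<close> C by auto
    show "(\<lambda>x. indicat_real A x *\<^sub>R H x) \<in> borel_measurable lebesgue" by measurable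
    show "(\<lambda>x. indicat_real C x *\<^sub>R H x) \<in> borel_measurable lebesgue" by measurable
    have "AE x in lebesgue. x \<notin> N"
      using CN(2) by (rule AE_not_in)
    then show "AE x in lebesgue. indicat_real A x *\<^sub>R H x = indicat_real C x *\<^sub>R H x"
      by eventually_elim (use CN(3) in \<open>auto simp: indicator_def\<close>)
  qed
  then show "set_lebesgue_integral lebesgue A H = 0" using B[OF C] by (simp add:
      set_lebesgue_integral_def)
qed

text \<open>The fundamental lemma of the calculus of variations. Bumps converge boundedly to
  indicators of boxes, each box inside \<open>U\<close> is treated separately, and countably many of
  them cover \<open>U\<close>.\<close>

lemma AE_zero_if_orthogonal_to_test_functions:
  fixes h :: "'a::euclidean_space \<Rightarrow> 'b::euclidean_space"
  assumes U: "open U" and h: "h \<in> L2 U"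
    and orth: "\<And>\<phi>. test_function U \<phi> \<Longrightarrow> (LINT x|lebesgue_on U. \<phi> x *\<^sub>R h x) = 0"
  shows "AE x in lebesgue_on U. h x = 0"
proof -
  have Us: "U \<in> sets lebesgue" using U by auto
  have box: "(LINT x|lebesgue. indicator (box a b) x *\<^sub>R h x) = 0" if "cbox a b \<subseteq> U" for a b
  proof -
    have ind: "(indicator (cbox a b) :: 'a \<Rightarrow> real) \<in> L2 U"
    proof -
      have "integrable lebesgue (indicator (cbox a b) :: 'a \<Rightarrow> real)"
        by (rule integrable_real_indicator) (use emeasure_bounded_finite[OF bounded_cbox, of a b]
            in simp_all)
      then have "integrable lebesgue (\<lambda>x. (norm (indicator (cbox a b) x :: real))\<^sup>2)"
        by (rule Bochner_Integration.integrable_cong[THEN iffD1, rotated -1]) (auto simp: indicator_def)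
      moreover have "(indicator (cbox a b) :: 'a \<Rightarrow> real) \<in> borel_measurable lebesgue"
        by (rule borel_measurable_indicator) simp
      ultimately have "(indicator (cbox a b) :: 'a \<Rightarrow> real) \<in> L2 UNIV"
        by (simp add: L2_def lebesgue_on_UNIV_eq)
      then show ?thesis by (rule L2_subset) (use Us in auto)
    qed
    have t: "test_function U (box_bump a b k)" for k by (rule test_function_box_bump[OF that])
    have "(\<lambda>k. LINT x|lebesgue_on U. box_bump a b k x *\<^sub>R h x)
        \<longlonglongrightarrow> (LINT x|lebesgue_on U. indicator (box a b) x *\<^sub>R h x)"
    proof (rule integral_dominated_convergence)
      show "integrable (lebesgue_on U) (\<lambda>x. norm (indicat_real (cbox a b) x *\<^sub>R h x))"
        by (rule integrable_norm[OF L2_integrable_scaleR[OF ind h]])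
      have hm: "h \<in> borel_measurable (lebesgue_on U)" using L2_D(1)[OF h] .
      have "indicat_real (box a b) \<in> borel_measurable (lebesgue_on U)"
        by (intro measurable_restrict_space1 borel_measurable_indicator) simp
      then show "(\<lambda>x. indicat_real (box a b) x *\<^sub>R h x) \<in> borel_measurable (lebesgue_on U)"
        using hm by simp
      show "(\<lambda>x. box_bump a b k x *\<^sub>R h x) \<in> borel_measurable (lebesgue_on U)" for k
        using hm L2_D(1)[OF test_function_L2(1)[OF t Us]] by simp
      show "AE x in lebesgue_on U. (\<lambda>k. box_bump a b k x *\<^sub>R h x) \<longlonglongrightarrow> indicator (box a b) x *\<^sub>R h x"
        by (intro AE_I2 tendsto_intros box_bump_tendsto)
      show "AE x in lebesgue_on U. norm (box_bump a b k x *\<^sub>R h x)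
          \<le> norm (indicat_real (cbox a b) x *\<^sub>R h x)" for k
      proof (rule AE_I2)
        fix x
        have "\<bar>box_bump a b k x\<bar> \<le> indicat_real (cbox a b) x"
          using box_bump_bounds[of a b k x] box_bump_nonzero[of a b k x] box_subset_cbox[of a b]
          by (cases "x \<in> cbox a b") auto
        then show "norm (box_bump a b k x *\<^sub>R h x) \<le> norm (indicat_real (cbox a b) x *\<^sub>R h x)"
          by (simp add: mult_right_mono)
      qed
    qed
    then have "(LINT x|lebesgue_on U. indicator (box a b) x *\<^sub>R h x) = 0"
      using LIMSEQ_unique[of "\<lambda>_. 0 :: 'b"] by (simp add: orth[OF t])
    moreover have "box a b \<subseteq> U" using that box_subset_cbox[of a b] by blast
    then have "(LINT x|lebesgue_on U. indicator (box a b) x *\<^sub>R h x)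
        = (LINT x|lebesgue. indicator (box a b) x *\<^sub>R h x)"
      unfolding integral_lebesgue_on_eq[OF Us]
      by (intro Bochner_Integration.integral_cong refl) (auto simp: indicator_def)
    ultimately show ?thesis by simp
  qed
  have AEbox: "AE x in lebesgue. x \<in> cbox a b \<longrightarrow> h x = 0" if ab: "cbox a b \<subseteq> U" for a b
  proof -
    have i: "integrable lebesgue (\<lambda>x. indicator (box a b) x *\<^sub>R h x)"
    proof -
      have "h \<in> L2 (box a b)"
        by (rule L2_subset[OF h Us]) (use ab box_subset_cbox[of a b] in auto)
      moreover have "(\<lambda>_. 1 :: real) \<in> L2 (box a b)"
        using emeasure_bounded_finite[OF bounded_box, of a b]
        by (auto simp: L2_def integrable_iff_bounded emeasure_restrict_space)
      ultimately have "integrable (lebesgue_on (box a b)) (\<lambda>x. 1 *\<^sub>R h x)"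
        using L2_integrable_scaleR by blast
      then show ?thesis using integrable_lebesgue_on_iff[of "box a b" h] by simp
    qed
    have "AE x in lebesgue. indicat_real (box a b) x *\<^sub>R h x = 0"
    proof (rule integral_box_zero_imp_AE_zero[OF i box[OF ab]])
      fix c d
      \<comment> \<open>Testing on another box amounts to testing on its intersection with the first
        one, which is again a box and, if nonempty, has its closure in \<open>U\<close>.\<close>
      define c' where "c' = (\<Sum>i\<in>Basis. max (c \<bullet> i) (a \<bullet> i) *\<^sub>R i)"
      define d' where "d' = (\<Sum>i\<in>Basis. min (d \<bullet> i) (b \<bullet> i) *\<^sub>R i)"
      have eq: "box c d \<inter> box a b = box c' d'" unfolding c'_def d'_def by (rule box_Int_box)
      have "(LINT x|lebesgue. indicator (box c' d') x *\<^sub>R h x) = 0"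
      proof (cases "box c' d' = {}")
        case False
        then have "cbox c' d' = closure (box c' d')" by (simp add: closure_box)
        also have "\<dots> \<subseteq> closure (box a b)" by (rule closure_mono) (use eq in auto)
        also have "\<dots> \<subseteq> cbox a b" by (rule closure_minimal) (auto simp: box_subset_cbox)
        finally show ?thesis using box ab by blast
      qed simp
      then show "(LINT x|lebesgue. indicat_real (box c d) x *\<^sub>R indicat_real (box a b) x *\<^sub>R h x) = 0"
        by (simp add: eq[symmetric] indicator_inter_arith)
    qed
    moreover have "AE x in lebesgue. x \<notin> cbox a b - box a b"
      using negligible_frontier_interval[of a b] by (intro AE_not_in) (simp add:
          negligible_iff_null_sets)
    ultimately show ?thesis by eventually_elim (auto simp: indicator_def)
  qed
  obtain \<D> where \<D>: "countable \<D>" "\<D> \<subseteq> Pow U" "\<And>X. X \<in> \<D> \<Longrightarrow> \<exists>a b. X = cbox a b" "\<Union>\<D> = U"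
    using open_countable_Union_open_cbox[OF U] by blast
  have "AE x in lebesgue. \<forall>X\<in>\<D>. x \<in> X \<longrightarrow> h x = 0"
    unfolding AE_ball_countable[OF \<D>(1)] using \<D>(2,3) AEbox by (metis PowD subsetD)
  then have "AE x in lebesgue. x \<in> U \<longrightarrow> h x = 0"
    by eventually_elim (use \<D>(4) in blast)
  then show ?thesis using Us by (simp add: AE_restrict_space_iff)
qed

lemma weak_gradient_unique:
  assumes "open U" "g \<in> L2 U" "g' \<in> L2 U" "weak_gradient U f g" "weak_gradient U f g'"
  shows "AE x in lebesgue_on U. g x = g' x"
proof -
  have Us: "U \<in> sets lebesgue" using assms(1) by auto
  have "AE x in lebesgue_on U. g x - g' x = 0"
  proof (rule AE_zero_if_orthogonal_to_test_functions[OF assms(1) L2_diff[OF assms(2,3)]])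
    fix \<phi> assume \<phi>: "test_function U \<phi>"
    note L = test_function_L2(1)[OF \<phi> Us]
    have "(LINT x|lebesgue_on U. f x *\<^sub>R grad \<phi> x) = - (LINT x|lebesgue_on U. \<phi> x *\<^sub>R g x)"
      using assms(4) \<phi> unfolding weak_gradient_def by blast
    moreover have "(LINT x|lebesgue_on U. f x *\<^sub>R grad \<phi> x) = - (LINT x|lebesgue_on U. \<phi> x *\<^sub>R g' x)"
      using assms(5) \<phi> unfolding weak_gradient_def by blast
    ultimately have "(LINT x|lebesgue_on U. \<phi> x *\<^sub>R g x) = (LINT x|lebesgue_on U. \<phi> x *\<^sub>R g' x)"
      by (simp only: neg_equal_iff_equal)
    then show "(LINT x|lebesgue_on U. \<phi> x *\<^sub>R (g x - g' x)) = 0"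
      using L2_integrable_scaleR[OF L assms(2)] L2_integrable_scaleR[OF L assms(3)]
      by (simp add: scaleR_diff_right)
  qed
  then show ?thesis by eventually_elim simp
qed

text \<open>By translation invariance every difference quotient of \<open>F\<close> has integral
  zero. The quotients are dominated by the Lipschitz constant on a fixed ball and converge to the
  partial derivatives.\<close>

lemma integral_gradient_compact_support:
  fixes F :: "'a::euclidean_space \<Rightarrow> real" and G :: "'a \<Rightarrow> 'a"
  assumes F: "\<And>x. (F has_derivative (\<lambda>h. G x \<bullet> h)) (at x)" and G: "continuous_on UNIV G"
    and K: "compact K" "\<And>x. x \<notin> K \<Longrightarrow> F x = 0"
  shows "integrable lborel G" "(LINT x|lborel. G x) = 0"
proof -
  have cF: "continuous_on UNIV F"
    by (rule has_derivative_continuous_on[OF has_derivative_at_withinI[OF F]])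
  have [measurable]: "F \<in> borel_measurable borel" "G \<in> borel_measurable borel"
    using cF G by (auto intro: borel_measurable_continuous_onI)
  have "closure {x. F x \<noteq> 0} \<subseteq> K"
    by (rule closure_minimal) (use K compact_imp_closed in auto)
  then have G0: "G x = 0" if "x \<notin> K" for x
    using grad_zero_outside_support[of x F] grad_eqI[OF F[of x]] that by auto
  have int0: "integrable lborel f" if "continuous_on UNIV f" "\<And>x. x \<notin> K \<Longrightarrow> f x
      = 0" for f :: "'a \<Rightarrow> 'b::euclidean_space"
  proof -
    have "integrable lborel (\<lambda>x. indicator K x *\<^sub>R f x)"
      using borel_integrable_compact[OF K(1), of f] continuous_on_subset[OF that(1)]
      by (auto simp: set_integrable_def)
    also have "(\<lambda>x. indicator K x *\<^sub>R f x) = f" using that(2) by (intro ext) (auto simp: indicator_def)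
    finally show ?thesis .
  qed
  show iG: "integrable lborel G" by (rule int0[OF G G0])
  have iF: "integrable lborel F" by (rule int0[OF cF K(2)])
  obtain R where "\<forall>x\<in>K. norm x \<le> R" using compact_imp_bounded[OF K(1)] unfolding bounded_iff by auto
  then have R: "K \<subseteq> cball 0 R" by auto
  have "bounded (G ` K)"
    by (intro compact_imp_bounded compact_continuous_image continuous_on_subset[OF G] K) auto
  then obtain M where M: "\<forall>x\<in>K. norm (G x) \<le> M" by (auto simp: bounded_iff)
  define M' where "M' = max M 0"
  have M': "norm (G x) \<le> M'" for x using M G0[of x] by (cases "x \<in> K") (auto simp: M'_def)
  have M0: "0 \<le> M'" by (simp add: M'_def)
  have lip: "\<bar>F x - F y\<bar> \<le> M' * norm (x - y)" for x y
  proof -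
    have "norm (F x - F y) \<le> M' * norm (x - y)"
    proof (rule differentiable_bound[OF convex_UNIV])
      show "(F has_derivative (\<lambda>h. G z \<bullet> h)) (at z within UNIV)" for z using F by simp
      show "onorm (\<lambda>h. G z \<bullet> h) \<le> M'" for z
      proof (rule onorm_bound[OF M0])
        show "norm (G z \<bullet> h) \<le> M' * norm h" for h
          using mult_right_mono[OF M' norm_ge_zero[of h], of z] Cauchy_Schwarz_ineq2[of "G z" h] by simp
      qed
    qed auto
    then show ?thesis by simp
  qed
  have comp: "(LINT x|lborel. G x \<bullet> b) = 0" if b: "b \<in> Basis" for b
  proof -
    define s where "s j = inverse (real (Suc j))" for j
    have s: "0 < s j" "s j \<le> 1" for j by (auto simp: s_def inverse_le_1_iff)
    have ne: "s j \<noteq> 0" for j using s(1)[of j] by simp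
    have "s \<longlonglongrightarrow> 0" unfolding s_def[abs_def] by (rule LIMSEQ_inverse_real_of_nat)
    then have s0: "filterlim s (at 0) sequentially"
      by (simp add: filterlim_at ne)
    define q where "q j x = (F (s j *\<^sub>R b + x) - F x) / s j" for j x
    have "(\<lambda>j. LINT x|lborel. q j x) \<longlonglongrightarrow> (LINT x|lborel. G x \<bullet> b)"
    proof (rule integral_dominated_convergence)
      \<comment> \<open>Steps have length at most 1, so all translates of the support stay in the
        ball of radius \<open>R + 1\<close>.\<close>
      show "integrable lborel (\<lambda>x. indicator (cball 0 (R + 1)) x *\<^sub>R M')"
        using borel_integrable_compact[OF compact_cball, of 0 "R + 1" "\<lambda>_. M'"] by (simp add:
            set_integrable_def)
      show "AE x in lborel. (\<lambda>j. q j x) \<longlonglongrightarrow> G x \<bullet> b"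
      proof (rule AE_I2)
        fix x
        have "((\<lambda>t. t *\<^sub>R b + x) has_derivative (\<lambda>t. t *\<^sub>R b)) (at 0)"
          by (auto intro!: derivative_eq_intros)
        from has_derivative_compose[OF this, of F "\<lambda>h. G x \<bullet> h"] F[of x]
        have "((\<lambda>t. F (t *\<^sub>R b + x)) has_derivative (\<lambda>t. G x \<bullet> (t *\<^sub>R b))) (at 0)"
          by simp
        then have "((\<lambda>t. F (t *\<^sub>R b + x)) has_real_derivative (G x \<bullet> b)) (at 0)"
          unfolding has_field_derivative_def by (rule has_derivative_eq_rhs) auto
        then have "((\<lambda>t. (F (t *\<^sub>R b + x) - F x) / t) \<longlongrightarrow> G x \<bullet> b) (at 0)"
          by (simp add: has_field_derivative_iff)
        from filterlim_compose[OF this s0] show "(\<lambda>j. q j x) \<longlonglongrightarrow> G x \<bullet> b"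
          by (simp add: q_def)
      qed
      show "AE x in lborel. norm (q j x) \<le> indicator (cball 0 (R + 1)) x *\<^sub>R M'" for j
      proof (rule AE_I2)
        fix x :: 'a
        show "norm (q j x) \<le> indicator (cball 0 (R + 1)) x *\<^sub>R M'"
        proof (cases "x \<in> cball 0 (R + 1)")
          case True
          have "\<bar>F (s j *\<^sub>R b + x) - F x\<bar> \<le> M' * s j"
            using lip[of "s j *\<^sub>R b + x" x] s(1)[of j] b by simp
          then show ?thesis using True s(1)[of j] by (simp add: q_def divide_simps)
        next
          case False
          have "norm x - norm (s j *\<^sub>R b) \<le> norm (s j *\<^sub>R b + x)"
            using norm_triangle_ineq4[of "s j *\<^sub>R b + x" "s j *\<^sub>R b"] by simp
          then have "norm (s j *\<^sub>R b + x) > R" "norm x > R"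
            using False s[of j] b by auto
          then have "s j *\<^sub>R b + x \<notin> cball 0 R" "x \<notin> cball 0 R" by simp_all
          then have "F (s j *\<^sub>R b + x) = 0" "F x = 0"
            using R K(2) by blast+
          then show ?thesis using M0 by (simp add: q_def)
        qed
      qed
    qed (auto simp: q_def)
    moreover have "(LINT x|lborel. q j x) = 0" for j
    proof -
      have tr: "(LINT x|lborel. F (s j *\<^sub>R b + x)) = (LINT x|lborel. F x)"
        by (subst (2) lborel_distr_plus[symmetric, of "s j *\<^sub>R b"]) (simp add: integral_distr)
      have "integrable (distr lborel borel ((+) (s j *\<^sub>R b))) F" using iF by (simp add:
          lborel_distr_plus)
      then have "integrable lborel (\<lambda>x. F (s j *\<^sub>R b + x))"
        by (simp add: integrable_distr_eq)
      then show ?thesis using iF tr by (simp add: q_def)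
    qed
    ultimately show ?thesis using LIMSEQ_unique[of "\<lambda>_. 0 :: real"] by simp
  qed
  show "(LINT x|lborel. G x) = 0"
  proof (rule euclidean_eqI)
    fix b :: 'a assume "b \<in> Basis"
    then show "(LINT x|lborel. G x) \<bullet> b = 0 \<bullet> b"
      using comp iG by simp
  qed
qed

lemma integral_lebesgue_on_eq_lborel:
  fixes h :: "'a::euclidean_space \<Rightarrow> 'b::euclidean_space"
  assumes "continuous_on UNIV h" "U \<in> sets lebesgue" "\<And>x. x \<notin> U \<Longrightarrow> h x = 0"
  shows "(LINT x|lebesgue_on U. h x) = (LINT x|lborel. h x)"
proof -
  have "(\<lambda>x. indicator U x *\<^sub>R h x) = h" using assms(3) by (intro ext) (auto simp: indicator_def)
  then have "(LINT x|lebesgue_on U. h x) = (LINT x|lebesgue. h x)"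
    by (simp add: integral_lebesgue_on_eq[OF assms(2)])
  also have "\<dots> = (LINT x|lborel. h x)"
    by (rule integral_completion) (use assms(1) borel_measurable_continuous_onI in simp)
  finally show ?thesis .
qed

text \<open>The product of \<open>f\<close> with a test function has compact support, so its
  gradient integrates to zero; the product rule then gives the weak identity. It serves for the
  polynomials of the discrete space.\<close>

lemma weak_gradient_classical:
  fixes f :: "'a::euclidean_space \<Rightarrow> real"
  assumes f: "\<And>x. (f has_derivative (\<lambda>h. G x \<bullet> h)) (at x)" and G: "continuous_on UNIV G" and U: "open U"
  shows "weak_gradient U f G"
  unfolding weak_gradient_def
proof (intro allI impI)
  fix \<phi> assume \<phi>: "test_function U \<phi>"
  define K where "K = closure {x. \<phi> x \<noteq> 0}"
  have sub: "K \<subseteq> U" and K: "compact K" using \<phi> by (auto simp: test_function_def K_def)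
  have z: "\<phi> x = 0" "grad \<phi> x = 0" if "x \<notin> K" for x
    using that[unfolded K_def] closure_subset[of "{x. \<phi> x \<noteq> 0}"] grad_zero_outside_support[of x \<phi>]
        by auto
  note d = test_function_derivative[OF \<phi>]
  have cf: "continuous_on UNIV f"
    by (rule has_derivative_continuous_on[OF has_derivative_at_withinI[OF f]])
  have Us: "U \<in> sets lebesgue" using U by auto
  have der: "((\<lambda>x. f x * \<phi> x) has_derivative (\<lambda>h. (f x *\<^sub>R grad \<phi> x + \<phi> x *\<^sub>R G x) \<bullet> h)) (at x)" for x
    by (rule has_derivative_eq_rhs[OF has_derivative_mult[OF f d(1)]]) (auto simp: inner_add_left)
  have c1: "continuous_on UNIV (\<lambda>x. f x *\<^sub>R grad \<phi> x)" and c2: "continuous_on UNIV (\<lambda>x. \<phi> x *\<^sub>R G x)"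
    by (intro continuous_intros cf d G)+
  have i: "integrable lborel h" if "continuous_on UNIV h" "\<And>x. x \<notin> K \<Longrightarrow> h x = 0" for h :: "'a \<Rightarrow> 'a"
  proof -
    have "integrable lborel (\<lambda>x. indicator K x *\<^sub>R h x)"
      using borel_integrable_compact[OF K, of h] continuous_on_subset[OF that(1)]
      by (auto simp: set_integrable_def)
    also have "(\<lambda>x. indicator K x *\<^sub>R h x) = h" using that(2) by (intro ext) (auto simp: indicator_def)
    finally show ?thesis .
  qed
  have "(LINT x|lborel. f x *\<^sub>R grad \<phi> x + \<phi> x *\<^sub>R G x) = 0"
    by (rule integral_gradient_compact_support(2)[OF der continuous_on_add[OF c1 c2] K]) (simp add: z(1))
  moreover have "integrable lborel (\<lambda>x. f x *\<^sub>R grad \<phi> x)" by (rule i[OF c1]) (simp add: z(2))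
  moreover have "integrable lborel (\<lambda>x. \<phi> x *\<^sub>R G x)" by (rule i[OF c2]) (simp add: z(1))
  ultimately have "(LINT x|lborel. f x *\<^sub>R grad \<phi> x) + (LINT x|lborel. \<phi> x *\<^sub>R G x) = 0"
    by simp
  moreover have "(LINT x|lebesgue_on U. f x *\<^sub>R grad \<phi> x) = (LINT x|lborel. f x *\<^sub>R grad \<phi> x)"
    by (rule integral_lebesgue_on_eq_lborel[OF c1 Us]) (use z sub in auto)
  moreover have "(LINT x|lebesgue_on U. \<phi> x *\<^sub>R G x) = (LINT x|lborel. \<phi> x *\<^sub>R G x)"
    by (rule integral_lebesgue_on_eq_lborel[OF c2 Us]) (use z sub in auto)
  ultimately show "(LINT x|lebesgue_on U. f x *\<^sub>R grad \<phi> x) = - (LINT x|lebesgue_on U. \<phi> x *\<^sub>R G x)"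
    by (simp add: eq_neg_iff_add_eq_0)
qed

section \<open>Linear algebra of eigenfunctions\<close>

text \<open>Gaussian elimination, one equation at a time. It is used twice: to choose the
  combination of exact eigenfunctions, and to expand a discrete function in discrete
  eigenfunctions.\<close>

lemma homogeneous_system_nontrivial:
  fixes A :: "'j \<Rightarrow> 'i \<Rightarrow> real"
  assumes "finite J" "finite I" "card J < card I"
  shows "\<exists>c. (\<exists>i\<in>I. c i \<noteq> 0) \<and> (\<forall>j\<in>J. (\<Sum>i\<in>I. A j i * c i) = 0)"
  using assms
proof (induction J arbitrary: I A rule: finite_induct)
  case empty
  then obtain i where "i \<in> I" by fastforce
  then show ?case by (intro exI[of _ "\<lambda>_. 1"]) auto
next
  case (insert j J)
  show ?case
  proof (cases "\<forall>i\<in>I. A j i = 0")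
    case True
    from insert.IH[of I A] insert.prems insert.hyps obtain c
      where c: "\<exists>i\<in>I. c i \<noteq> 0" "\<forall>j\<in>J. (\<Sum>i\<in>I. A j i * c i) = 0" by auto
    then show ?thesis using True by (intro exI[of _ c]) auto
  next
    case False
    then obtain p where p: "p \<in> I" "A j p \<noteq> 0" by blast
    let ?I = "I - {p}"
    have "card J < card ?I" using insert.prems insert.hyps p by simp
    \<comment> \<open>The unknown \<open>p\<close> is solved from equation \<open>j\<close> and
      substituted into the other equations.\<close>
    from insert.IH[OF _ this, of "\<lambda>j' i. A j' i - A j' p * A j i / A j p"] insert.prems
    obtain c where c: "\<exists>i\<in>?I. c i \<noteq> 0"
      "\<forall>j'\<in>J. (\<Sum>i\<in>?I. (A j' i - A j' p * A j i / A j p) * c i) = 0" by auto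
    define d where "d = c(p := - (\<Sum>i\<in>?I. A j i * c i) / A j p)"
    have eq: "(\<Sum>i\<in>I. A j' i * d i) = A j' p * d p + (\<Sum>i\<in>?I. A j' i * c i)" for j'
    proof -
      have "(\<Sum>i\<in>I. A j' i * d i) = A j' p * d p + (\<Sum>i\<in>?I. A j' i * d i)"
        by (rule sum.remove[OF insert.prems(1) p(1)])
      also have "(\<Sum>i\<in>?I. A j' i * d i) = (\<Sum>i\<in>?I. A j' i * c i)"
        by (intro sum.cong) (auto simp: d_def)
      finally show ?thesis .
    qed
    show ?thesis
    proof (intro exI[of _ d] conjI ballI)
      show "\<exists>i\<in>I. d i \<noteq> 0" using c(1) by (auto simp: d_def)
      fix j' assume "j' \<in> insert j J"
      then consider "j' = j" | "j' \<in> J" by blast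
      then show "(\<Sum>i\<in>I. A j' i * d i) = 0"
      proof cases
        case 1
        then show ?thesis using p by (simp add: eq) (simp add: d_def)
      next
        case 2
        have "(\<Sum>i\<in>?I. (A j' i - A j' p * A j i / A j p) * c i)
            = (\<Sum>i\<in>?I. A j' i * c i) - A j' p * (\<Sum>i\<in>?I. A j i * c i) / A j p"
          by (simp add: left_diff_distrib sum_subtractf sum_distrib_left sum_divide_distrib mult.assoc)
        then show ?thesis using c(2) 2 by (simp add: eq) (simp add: d_def)
      qed
    qed
  qed
qed

section \<open>Inner products of combinations and families of eigenfunctions\<close>

lemma L2_inner_commute: "L2_inner \<Omega> f g = L2_inner \<Omega> g f"
  by (simp add: L2_inner_def mult.commute)

lemma L2_inner_sum_left:
  assumes "finite K" "\<And>i. i \<in> K \<Longrightarrow> f i \<in> L2 \<Omega>" "g \<in> L2 \<Omega>"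
  shows "L2_inner \<Omega> (\<lambda>x. \<Sum>i\<in>K. c i * f i x) g = (\<Sum>i\<in>K. c i * L2_inner \<Omega> (f i) g)"
proof -
  have i: "integrable (lebesgue_on \<Omega>) (\<lambda>x. f i x * g x)" if "i \<in> K" for i
    using L2_integrable_mult[OF assms(2)[OF that] assms(3)] .
  have "L2_inner \<Omega> (\<lambda>x. \<Sum>i\<in>K. c i * f i x) g = (LINT x|lebesgue_on \<Omega>. (\<Sum>i\<in>K. c i * (f i x * g x)))"
    unfolding L2_inner_def by (simp add: sum_distrib_right mult.assoc)
  also have "\<dots> = (\<Sum>i\<in>K. c i * L2_inner \<Omega> (f i) g)"
    unfolding L2_inner_def by (subst Bochner_Integration.integral_sum) (simp_all add: i)
  finally show ?thesis .
qed

lemma L2_linear_combination: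
  fixes f :: "'i \<Rightarrow> 'a::euclidean_space \<Rightarrow> real"
  assumes "finite K" "\<And>i. i \<in> K \<Longrightarrow> f i \<in> L2 \<Omega>"
  shows "(\<lambda>x. \<Sum>i\<in>K. c i * f i x) \<in> L2 \<Omega>"
  using L2_sum_scaleR[OF assms] by simp

lemma L2_inner_sum_sum:
  assumes "finite K" "\<And>i. i \<in> K \<Longrightarrow> f i \<in> L2 \<Omega>"
  shows "L2_inner \<Omega> (\<lambda>x. \<Sum>i\<in>K. c i * f i x) (\<lambda>x. \<Sum>i\<in>K. d i * f i x)
       = (\<Sum>i\<in>K. \<Sum>j\<in>K. c i * d j * L2_inner \<Omega> (f i) (f j))"
proof -
  have "L2_inner \<Omega> (\<lambda>x. \<Sum>i\<in>K. c i * f i x) (\<lambda>x. \<Sum>i\<in>K. d i * f i x)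
      = (\<Sum>i\<in>K. c i * L2_inner \<Omega> (f i) (\<lambda>x. \<Sum>i\<in>K. d i * f i x))"
    using assms by (intro L2_inner_sum_left L2_linear_combination)
  also have "\<dots> = (\<Sum>i\<in>K. c i * (\<Sum>j\<in>K. d j * L2_inner \<Omega> (f j) (f i)))"
  proof (intro sum.cong refl arg_cong2[where f="(*)"])
    fix i assume "i \<in> K"
    then show "L2_inner \<Omega> (f i) (\<lambda>x. \<Sum>i\<in>K. d i * f i x) = (\<Sum>j\<in>K. d j * L2_inner \<Omega> (f j) (f i))"
      unfolding L2_inner_commute[of \<Omega> "f i"] using assms by (intro L2_inner_sum_left) auto
  qed
  also have "\<dots> = (\<Sum>i\<in>K. \<Sum>j\<in>K. c i * d j * L2_inner \<Omega> (f i) (f j))"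
    unfolding sum_distrib_left
    by (intro sum.cong refl) (simp only: mult.assoc L2_inner_commute[of \<Omega> "f _" "f _"])
  finally show ?thesis .
qed

lemma L2_inner_self_nonneg: "0 \<le> L2_inner \<Omega> f f"
  unfolding L2_inner_def by (intro Bochner_Integration.integral_nonneg) simp

lemma L2_inner_self_eq_0:
  assumes "f \<in> L2 \<Omega>" "L2_inner \<Omega> f f = 0" shows "AE x in lebesgue_on \<Omega>. f x = 0"
proof -
  have "AE x in lebesgue_on \<Omega>. f x * f x = 0"
    using assms(2) integral_nonneg_eq_0_iff_AE[OF L2_integrable_mult[OF assms(1) assms(1)]]
    by (simp add: L2_inner_def)
  then show ?thesis by eventually_elim simp
qed

lemma L2_inner_AE_zero:
  assumes "AE x in lebesgue_on \<Omega>. f x = 0" "f \<in> L2 \<Omega>" "g \<in> L2 \<Omega>" shows "L2_inner \<Omega> f g = 0"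
proof -
  have "L2_inner \<Omega> f g = (LINT x|lebesgue_on \<Omega>. 0)" unfolding L2_inner_def
    by (rule integral_cong_AE) (use L2_D(1)[OF assms(2)] L2_D(1)[OF assms(3)] assms(1) in auto)
  then show ?thesis by simp
qed

text \<open>Multiplicity is counted by indices: for each eigenvalue, a bijection between its indices
  and a basis of its eigenspace assigns an eigenfunction to every index. Independence is obtained
  within each eigenspace only.\<close>

lemma enumerates_eigenvalues_basis:
  assumes "enumerates_eigenvalues \<Omega> X a I ev"
  obtains w where "\<And>i. i \<in> I \<Longrightarrow> w i \<in> X"
    "\<And>i v. i \<in> I \<Longrightarrow> v \<in> X \<Longrightarrow> a (w i) v = ev i * L2_inner \<Omega> (w i) v"
    "\<And>\<mu> c. AE x in lebesgue_on \<Omega>. (\<Sum>i | i \<in> I \<and> ev i = \<mu>. c i * w i x) = 0 \<Longrightarrow> \<forall>i\<in>I. ev i = \<mu> \<longrightarrow> c i = 0"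
proof -
  let ?I = "\<lambda>\<mu>. {i \<in> I. ev i = \<mu>}" and ?X = "eigenspace X a (L2_inner \<Omega>)"
  define Q where "Q \<mu> e h \<longleftrightarrow> bij_betw h (?I \<mu>) {..<card (?I \<mu>)} \<and> (\<forall>i<card (?I \<mu>). e i \<in> ?X \<mu>) \<and>
        (\<forall>c. (AE x in lebesgue_on \<Omega>. (\<Sum>i<card (?I \<mu>). c i * e i x) = 0) \<longrightarrow> (\<forall>i<card (?I \<mu>). c i = 0))"
    for \<mu> and e :: "nat \<Rightarrow> 'a \<Rightarrow> real" and h :: "nat \<Rightarrow> nat"
  have "\<exists>e h. 0 < \<mu> \<longrightarrow> Q \<mu> e h" for \<mu>
  proof (cases "\<mu> > 0")
    case True
    then have fin: "finite (?I \<mu>)" and dim: "has_dim_ae \<Omega> (?X \<mu>) (card (?I \<mu>))"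
      using assms by (auto simp: enumerates_eigenvalues_def)
    obtain h where "bij_betw h (?I \<mu>) {..<card (?I \<mu>)}"
      using ex_bij_betw_finite_nat[OF fin] by (auto simp: atLeast0LessThan)
    then show ?thesis using dim unfolding has_dim_ae_def Q_def by blast
  qed auto
  then obtain e h where eh: "\<And>\<mu>. 0 < \<mu> \<Longrightarrow> Q \<mu> (e \<mu>) (h \<mu>)" by metis
  have eh1: "bij_betw (h \<mu>) (?I \<mu>) {..<card (?I \<mu>)}" if "0 < \<mu>" for \<mu>
    using eh[OF that] unfolding Q_def by blast
  have eh2: "e \<mu> i \<in> ?X \<mu>" if "0 < \<mu>" "i < card (?I \<mu>)" for \<mu> i
    using eh[OF that(1)] that(2) unfolding Q_def by blast
  have eh3: "\<forall>i<card (?I \<mu>). c i = 0"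
    if "0 < \<mu>" "AE x in lebesgue_on \<Omega>. (\<Sum>i<card (?I \<mu>). c i * e \<mu> i x) = 0" for \<mu> c
    using eh[OF that(1)] that(2) unfolding Q_def by blast
  have pos: "0 < ev i" if "i \<in> I" for i using assms that by (auto simp: enumerates_eigenvalues_def)
  define w where "w i = e (ev i) (h (ev i) i)" for i
  have wX: "w i \<in> ?X (ev i)" if "i \<in> I" for i
    unfolding w_def using eh1[OF pos[OF that]] that
    by (intro eh2 pos) (auto simp: bij_betw_def)
  show ?thesis
  proof
    show "w i \<in> X" if "i \<in> I" for i using wX[OF that] by (simp add: eigenspace_def)
    show "a (w i) v = ev i * L2_inner \<Omega> (w i) v" if "i \<in> I" "v \<in> X" for i v
      using wX[OF that(1)] that(2) by (simp add: eigenspace_def)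
    fix \<mu> c assume AE: "AE x in lebesgue_on \<Omega>. (\<Sum>i | i \<in> I \<and> ev i = \<mu>. c i * w i x) = 0"
    show "\<forall>i\<in>I. ev i = \<mu> \<longrightarrow> c i = 0"
    proof (intro ballI impI)
      fix i assume i: "i \<in> I" "ev i = \<mu>"
      then have \<mu>: "0 < \<mu>" using pos by blast
      note bij = eh1[OF \<mu>]
      let ?g = "inv_into (?I \<mu>) (h \<mu>)"
      have "(\<Sum>i | i \<in> I \<and> ev i = \<mu>. c i * w i x) = (\<Sum>i<card (?I \<mu>). c (?g i) * e \<mu> i x)" for x
      proof -
        have "(\<Sum>i | i \<in> I \<and> ev i = \<mu>. c i * w i x) = (\<Sum>i\<in>?I \<mu>. c (?g (h \<mu> i)) * e \<mu> (h \<mu> i) x)"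
          using bij by (intro sum.cong) (auto simp: w_def bij_betw_def inv_into_f_f)
        also have "\<dots> = (\<Sum>i<card (?I \<mu>). c (?g i) * e \<mu> i x)"
          by (rule sum.reindex_bij_betw[OF bij])
        finally show ?thesis .
      qed
      then have "\<forall>i<card (?I \<mu>). c (?g i) = 0" using eh3[OF \<mu>] AE by simp
      moreover have "h \<mu> i < card (?I \<mu>)" using bij i by (auto simp: bij_betw_def)
      moreover have "?g (h \<mu> i) = i" using bij i by (auto simp: bij_betw_def inv_into_f_f)
      ultimately show "c i = 0" by metis
    qed
  qed
qed

text \<open>Covers the exact and the discrete problem at once. Eigenfunctions of one eigenvalue are
  merely independent and are never orthonormalised, so the quadratic forms below are treated in
  blocks.\<close>

locale eigen_system =
  fixes \<Omega> :: "'a::euclidean_space set" and X :: "('a \<Rightarrow> real) set" and a :: "('a \<Rightarrow> real) \<Rightarrow> ('a \<Rightarrow>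
      real) \<Rightarrow> real"
    and I :: "nat set" and ev :: "nat \<Rightarrow> real" and w :: "nat \<Rightarrow> 'a \<Rightarrow> real"
  assumes X_L2: "X \<subseteq> L2 \<Omega>"
    and sym: "\<And>u v. u \<in> X \<Longrightarrow> v \<in> X \<Longrightarrow> a u v = a v u"
    and wX: "\<And>i. i \<in> I \<Longrightarrow> w i \<in> X"
    and eig: "\<And>i v. i \<in> I \<Longrightarrow> v \<in> X \<Longrightarrow> a (w i) v = ev i * L2_inner \<Omega> (w i) v"
    and indep: "\<And>\<mu> c. AE x in lebesgue_on \<Omega>. (\<Sum>i | i \<in> I \<and> ev i = \<mu>. c i * w i x) = 0 \<Longrightarrow> \<forall>i\<in>I. ev i
        = \<mu> \<longrightarrow> c i = 0"
    and fin: "\<And>\<mu>. finite {i \<in> I. ev i = \<mu>}"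
begin

lemma wL2: "i \<in> I \<Longrightarrow> w i \<in> L2 \<Omega>" using wX X_L2 by blast

lemma orthogonal:
  assumes "i \<in> I" "j \<in> I" "ev i \<noteq> ev j" shows "L2_inner \<Omega> (w i) (w j) = 0"
proof -
  have "ev i * L2_inner \<Omega> (w i) (w j) = a (w i) (w j)"
    by (rule eig[OF assms(1) wX[OF assms(2)], symmetric])
  also have "\<dots> = a (w j) (w i)" by (rule sym[OF wX[OF assms(1)] wX[OF assms(2)]])
  also have "\<dots> = ev j * L2_inner \<Omega> (w j) (w i)" by (rule eig[OF assms(2) wX[OF assms(1)]])
  also have "L2_inner \<Omega> (w j) (w i) = L2_inner \<Omega> (w i) (w j)" by (rule L2_inner_commute)
  finally show ?thesis using assms(3) by simp
qed

text \<open>The Gram matrix is block diagonal and the weight is constant on each block, so the form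
  is the squared norm of the combination whose coefficients are rescaled by the square root of the
  weight. This yields spectral inequalities without diagonalising the blocks.\<close>

lemma weighted_form_nonneg:
  assumes K: "finite K" "K \<subseteq> I" and \<kappa>: "\<And>i. i \<in> K \<Longrightarrow> 0 \<le> \<kappa> (ev i)"
  shows "0 \<le> (\<Sum>i\<in>K. \<Sum>j\<in>K. c i * c j * \<kappa> (ev i) * L2_inner \<Omega> (w i) (w j))"
proof -
  let ?d = "\<lambda>i. sqrt (\<kappa> (ev i)) * c i"
  have "(\<Sum>i\<in>K. \<Sum>j\<in>K. c i * c j * \<kappa> (ev i) * L2_inner \<Omega> (w i) (w j))
      = (\<Sum>i\<in>K. \<Sum>j\<in>K. ?d i * ?d j * L2_inner \<Omega> (w i) (w j))"
  proof (intro sum.cong refl)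
    fix i j assume ij: "i \<in> K" "j \<in> K"
    show "c i * c j * \<kappa> (ev i) * L2_inner \<Omega> (w i) (w j) = ?d i * ?d j * L2_inner \<Omega> (w i) (w j)"
    proof (cases "ev i = ev j")
      case True
      have "sqrt (\<kappa> (ev j)) * sqrt (\<kappa> (ev j)) = \<kappa> (ev j)" using \<kappa>[OF ij(2)] by simp
      then show ?thesis using True by (simp add: algebra_simps)
    next
      case False
      then show ?thesis using orthogonal[of i j] ij K(2) by auto
    qed
  qed
  also have "\<dots> = L2_inner \<Omega> (\<lambda>x. \<Sum>i\<in>K. ?d i * w i x) (\<lambda>x. \<Sum>i\<in>K. ?d i * w i x)"
    by (rule L2_inner_sum_sum[symmetric]) (use K wL2 in auto)
  finally show ?thesis by (simp add: L2_inner_self_nonneg)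
qed

text \<open>Pairing the vanishing combination with its own component in one eigenspace leaves, by
  orthogonality, the squared norm of that component. Independence inside the eigenspace
  finishes.\<close>

lemma independent:
  assumes K: "finite K" "K \<subseteq> I" and AE: "AE x in lebesgue_on \<Omega>. (\<Sum>i\<in>K. c i * w i x) = 0"
    and i: "i \<in> K"
  shows "c i = 0"
proof -
  let ?\<mu> = "ev i"
  \<comment> \<open>\<open>indep\<close> speaks of all indices of the eigenvalue, so the
    coefficients are extended by zero outside \<open>K\<close>.\<close>
  let ?d = "\<lambda>j. if j \<in> K then c j else 0"
  let ?J = "{j \<in> I. ev j = ?\<mu>}"
  let ?f = "\<lambda>x. \<Sum>j\<in>?J. ?d j * w j x"
  have fJ: "?f = (\<lambda>x. \<Sum>j\<in>K. (if ev j = ?\<mu> then c j else 0) * w j x)"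
  proof
    fix x
    have "?f x = (\<Sum>j\<in>?J \<inter> K. c j * w j x)"
      using fin by (intro sum.mono_neutral_cong_right) auto
    also have "\<dots> = (\<Sum>j\<in>K. (if ev j = ?\<mu> then c j else 0) * w j x)"
      using K by (intro sum.mono_neutral_cong_left) auto
    finally show "?f x = (\<Sum>j\<in>K. (if ev j = ?\<mu> then c j else 0) * w j x)" .
  qed
  have fL2: "?f \<in> L2 \<Omega>" by (rule L2_linear_combination) (use fin wL2 in auto)
  have gL2: "(\<lambda>x. \<Sum>j\<in>K. c j * w j x) \<in> L2 \<Omega>" by (rule L2_linear_combination) (use K wL2 in auto)
  have "L2_inner \<Omega> ?f ?f = (\<Sum>i\<in>K. \<Sum>j\<in>K. (if ev i = ?\<mu> then c i else 0) * (if ev j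
      = ?\<mu> then c j else 0) * L2_inner \<Omega> (w i) (w j))"
    unfolding fJ by (rule L2_inner_sum_sum) (use K wL2 in auto)
  also have "\<dots> = (\<Sum>i\<in>K. \<Sum>j\<in>K. (if ev i = ?\<mu> then c i else 0) * c j * L2_inner \<Omega> (w i) (w j))"
    by (intro sum.cong refl) (use K orthogonal in force)
  also have "\<dots> = L2_inner \<Omega> ?f (\<lambda>x. \<Sum>j\<in>K. c j * w j x)"
    unfolding fJ by (rule L2_inner_sum_sum[symmetric]) (use K wL2 in auto)
  also have "\<dots> = 0"
    using L2_inner_AE_zero[OF AE gL2 fL2] by (simp add: L2_inner_commute)
  finally have "AE x in lebesgue_on \<Omega>. ?f x = 0" using L2_inner_self_eq_0[OF fL2] by simp
  then have "\<forall>j\<in>I. ev j = ?\<mu> \<longrightarrow> ?d j = 0" by (rule indep)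
  then show ?thesis using i K(2) by auto
qed

end

section \<open>The mesh and the enriched Crouzeix-Raviart space\<close>

text \<open>A Lipschitz domain lies on one side of its boundary: directly below a boundary point
  there are points outside the closure. This puts the open simplices inside the domain, which would
  fail for a slit domain.\<close>

lemma interior_closure_subset_lipschitz:
  fixes \<Omega> :: "'a::euclidean_space set"
  assumes "open \<Omega>" "lipschitz_boundary \<Omega>"
  shows "interior (closure \<Omega>) \<subseteq> \<Omega>"
proof (rule ccontr)
  assume "\<not> ?thesis"
  then obtain y where y: "y \<in> interior (closure \<Omega>)" "y \<notin> \<Omega>" by blast
  then have "y \<in> frontier \<Omega>"
    using assms(1) interior_subset by (auto simp: frontier_def interior_open)
  then obtain r e L and g :: "'a \<Rightarrow> real" where r: "0 < r" and e: "norm e = 1"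
    and lip: "L-lipschitz_on {w. w \<bullet> e = 0} g"
    and eq: "\<Omega> \<inter> ball y r = {x \<in> ball y r. g (x - (x \<bullet> e) *\<^sub>R e) < x \<bullet> e}"
    using assms(2) unfolding lipschitz_boundary_def by blast
  obtain d where d: "d > 0" "ball y d \<subseteq> closure \<Omega>"
    using y(1) unfolding mem_interior by blast
  define s where "s = min d r / 2"
  have s: "s > 0" "s < d" "s < r" using d r by (auto simp: s_def min_def)
  have ee: "e \<bullet> e = 1" using e by (simp add: dot_square_norm)
  \<comment> \<open>\<open>w\<close> is \<open>y\<close> moved straight down: its projection, and
    with it the height of the graph, is unchanged, so \<open>w\<close> lies strictly below the
    graph.\<close>
  define w where "w = y - s *\<^sub>R e"
  have we: "w \<bullet> e = y \<bullet> e - s" by (simp add: w_def inner_diff_left ee)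
  have proj: "w - (w \<bullet> e) *\<^sub>R e = y - (y \<bullet> e) *\<^sub>R e"
    unfolding we by (simp add: w_def algebra_simps)
  have "y \<in> ball y r" using r by simp
  then have "y \<notin> {x \<in> ball y r. g (x - (x \<bullet> e) *\<^sub>R e) < x \<bullet> e}"
    unfolding eq[symmetric] using y(2) by blast
  then have "g (y - (y \<bullet> e) *\<^sub>R e) \<ge> y \<bullet> e" using r by simp
  then have lt: "w \<bullet> e < g (w - (w \<bullet> e) *\<^sub>R e)" using proj we s by simp
  have dw: "dist y w = s" using s e by (simp add: w_def dist_norm)
  \<comment> \<open>\<open>f\<close> is the height of the graph above a point. Inside the ball its
    positive set is open and misses the domain, yet it contains \<open>w\<close>, a point of the
    closure.\<close>
  define f where "f x = g (x - (x \<bullet> e) *\<^sub>R e) - x \<bullet> e" for x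
  have "continuous_on UNIV f"
    unfolding f_def
  proof (intro continuous_intros continuous_on_compose2[OF lipschitz_on_continuous_on[OF lip]])
    show "(\<lambda>x. x - (x \<bullet> e) *\<^sub>R e) ` UNIV \<subseteq> {w. w \<bullet> e = 0}"
      by (auto simp: inner_diff_left ee)
  qed
  then have "open (f -` {0<..})" by (intro open_vimage) auto
  then have "open (f -` {0<..} \<inter> ball y r)" by auto
  moreover have "w \<in> f -` {0<..} \<inter> ball y r" using lt dw s by (simp add: f_def)
  moreover have "w \<in> closure \<Omega>" using d(2) dw s by (auto simp: subset_iff)
  ultimately have "\<Omega> \<inter> (f -` {0<..} \<inter> ball y r) \<noteq> {}"
    using open_Int_closure_eq_empty[of "f -` {0<..} \<inter> ball y r" \<Omega>] by blast
  then obtain x where x: "x \<in> \<Omega> \<inter> ball y r" "x \<in> f -` {0<..}" by blast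
  then have "g (x - (x \<bullet> e) *\<^sub>R e) < x \<bullet> e" unfolding eq by simp
  then show False using x(2) by (simp add: f_def)
qed

section \<open>Mesh geometry and splitting of integrals\<close>

lemma integrable_AE_eq:
  fixes f g :: "'a::euclidean_space \<Rightarrow> 'b::euclidean_space"
  assumes "integrable lebesgue f" "negligible N" "\<And>x. x \<notin> N \<Longrightarrow> f x = g x"
  shows "integrable lebesgue g" "(LINT x|lebesgue. g x) = (LINT x|lebesgue. f x)"
proof -
  have "f absolutely_integrable_on UNIV" using assms(1) by (simp add: set_integrable_def)
  then have "g absolutely_integrable_on UNIV"
    by (rule absolutely_integrable_spike[OF _ assms(2)]) (use assms(3) in auto)
  then show g: "integrable lebesgue g" by (simp add: set_integrable_def)
  have "AE x in lebesgue. x \<notin> N" using assms(2) by (intro AE_not_in) (simp add: negligible_iff_null_sets)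
  then have "AE x in lebesgue. g x = f x" by eventually_elim (use assms(3) in auto)
  then show "(LINT x|lebesgue. g x) = (LINT x|lebesgue. f x)"
    using g assms(1) by (intro integral_cong_AE) auto
qed

locale mesh =
  fixes \<Omega> :: "'a::euclidean_space set" and \<T> :: "'a set set"
  assumes domain: "polyhedral_lipschitz_domain \<Omega>" and mesh: "triangulation_of \<T> \<Omega>"
begin

lemma finite_mesh: "finite \<T>" using mesh by (auto simp: triangulation_of_def triangulation_def)
lemma open_domain: "open \<Omega>" using domain by (auto simp: polyhedral_lipschitz_domain_def)
lemma domain_sets [simp]: "\<Omega> \<in> sets lebesgue" using open_domain by auto
lemma interior_sets [simp]: "interior T \<in> sets lebesgue" by auto

lemma simplex_mesh:
  assumes "T \<in> \<T>" shows "full_simplex (vertices T) T"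
proof -
  have "int DIM('a) simplex T" using assms mesh by (auto simp: triangulation_of_def)
  then obtain C where C: "\<not> affine_dependent C" "int (card C) = int DIM('a) + 1" "T = convex hull C"
    unfolding simplex_def by blast
  then interpret full_simplex C T by unfold_locales auto
  show ?thesis unfolding vertices_T by unfold_locales
qed

lemma interior_in_domain:
  assumes "T \<in> \<T>" shows "interior T \<subseteq> \<Omega>"
proof -
  have "interior T \<subseteq> interior (closure \<Omega>)"
    using assms mesh by (intro interior_mono) (auto simp: triangulation_of_def)
  then show ?thesis
    using interior_closure_subset_lipschitz[OF open_domain] domain
    by (auto simp: polyhedral_lipschitz_domain_def)
qed

text \<open>Simplices of a triangulation meet in a common face, and a face that meets the interior
  is the whole simplex. Applied to both simplices, this forces equality.\<close>

lemma interior_disjoint: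
  assumes T: "T \<in> \<T>" "T' \<in> \<T>" "T \<noteq> T'" shows "interior T \<inter> T' = {}"
proof (rule ccontr)
  assume ne: "interior T \<inter> T' \<noteq> {}"
  have f: "(T \<inter> T') face_of T" "(T' \<inter> T) face_of T'"
    using mesh T by (auto simp: triangulation_of_def triangulation_def)
  have "T \<inter> T' \<inter> interior T \<noteq> {}" using ne interior_subset by blast
  then have "T \<inter> T' = T" using face_of_disjoint_interior[OF f(1)] by blast
  then have sub: "T \<subseteq> T'" by blast
  then have "interior T \<subseteq> interior T'" by (rule interior_mono)
  moreover have "interior T \<noteq> {}" using full_simplex.interior_T[OF simplex_mesh[OF T(1)]] .
  ultimately have "T' \<inter> T \<inter> interior T' \<noteq> {}" using sub interior_subset by blast
  then have "T' \<inter> T = T'" using face_of_disjoint_interior[OF f(2)] by blast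
  then show False using sub T(3) by blast
qed

lemma skeleton_negligible: "negligible (\<Omega> - (\<Union>T\<in>\<T>. interior T))"
proof (rule negligible_subset)
  show "negligible (\<Union>T\<in>\<T>. frontier T)"
    using finite_mesh full_simplex.convex_T[OF simplex_mesh]
    by (intro negligible_Union) (auto intro: negligible_convex_frontier)
  have "\<Omega> \<subseteq> \<Union>\<T>" using mesh closure_subset by (auto simp: triangulation_of_def)
  show "\<Omega> - (\<Union>T\<in>\<T>. interior T) \<subseteq> (\<Union>T\<in>\<T>. frontier T)"
  proof
    fix x assume x: "x \<in> \<Omega> - (\<Union>T\<in>\<T>. interior T)"
    then obtain T where "T \<in> \<T>" "x \<in> T" using \<open>\<Omega> \<subseteq> \<Union>\<T>\<close> by blast
    then show "x \<in> (\<Union>T\<in>\<T>. frontier T)"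
      using x closure_subset[of T] by (auto simp: frontier_def)
  qed
qed

lemma sum_interior_indicator:
  fixes f :: "'a set \<Rightarrow> 'b::real_vector"
  assumes "T \<in> \<T>" "x \<in> interior T"
  shows "(\<Sum>S\<in>\<T>. indicat_real (interior S) x *\<^sub>R f S) = f T"
proof -
  have "(\<Sum>S\<in>\<T>. indicat_real (interior S) x *\<^sub>R f S) = (\<Sum>S\<in>{T}. f S)"
  proof (rule sum.mono_neutral_cong_right)
    show "\<forall>S\<in>\<T> - {T}. indicat_real (interior S) x *\<^sub>R f S = 0"
      using interior_disjoint[OF assms(1)] assms(2) interior_subset by (auto simp: indicator_def)
  qed (use assms finite_mesh in auto)
  then show ?thesis by simp
qed

lemma integral_split:
  fixes f :: "'a \<Rightarrow> 'b::euclidean_space"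
  assumes "\<And>T. T \<in> \<T> \<Longrightarrow> integrable (lebesgue_on (interior T)) f"
  shows "integrable (lebesgue_on \<Omega>) f"
    "(LINT x|lebesgue_on \<Omega>. f x) = (\<Sum>T\<in>\<T>. (LINT x|lebesgue_on (interior T). f x))"
proof -
  let ?f = "\<lambda>x. \<Sum>T\<in>\<T>. indicat_real (interior T) x *\<^sub>R f x"
  have i: "integrable lebesgue (\<lambda>x. indicat_real (interior T) x *\<^sub>R f x)" if "T \<in> \<T>" for T
    using assms[OF that] integrable_lebesgue_on_iff[OF interior_sets] by blast
  then have i1: "integrable lebesgue ?f" by simp
  have eq: "?f x = indicat_real \<Omega> x *\<^sub>R f x" if "x \<notin> \<Omega> - (\<Union>T\<in>\<T>. interior T)" for x
  proof (cases "\<exists>T\<in>\<T>. x \<in> interior T")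
    case True
    then obtain T where T: "T \<in> \<T>" "x \<in> interior T" by blast
    then have "x \<in> \<Omega>" using interior_in_domain by blast
    then show ?thesis using sum_interior_indicator[OF T] by simp
  next
    case False
    then show ?thesis using that by (simp add: indicator_def)
  qed
  note * = integrable_AE_eq[OF i1 skeleton_negligible eq]
  show "integrable (lebesgue_on \<Omega>) f"
    using *(1) integrable_lebesgue_on_iff[OF domain_sets] by blast
  show "(LINT x|lebesgue_on \<Omega>. f x) = (\<Sum>T\<in>\<T>. (LINT x|lebesgue_on (interior T). f x))"
    using *(2) i by (simp add: integral_lebesgue_on_eq)
qed

lemma AE_split:
  assumes "AE x in lebesgue_on \<Omega>. P x" "T \<in> \<T>"
  shows "AE x in lebesgue_on (interior T). P x"
proof -
  have "AE x in lebesgue. x \<in> \<Omega> \<longrightarrow> P x" using assms(1) by (simp add: AE_restrict_space_iff)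
  then have "AE x in lebesgue. x \<in> interior T \<longrightarrow> P x"
    by eventually_elim (use interior_in_domain[OF assms(2)] in blast)
  then show ?thesis by (simp add: AE_restrict_space_iff)
qed

lemma L2_interior: "f \<in> L2 \<Omega> \<Longrightarrow> T \<in> \<T> \<Longrightarrow> f \<in> L2 (interior T)"
  by (rule L2_subset[OF _ domain_sets interior_sets interior_in_domain])

end

lemma (in full_simplex) interior_integral:
  fixes f :: "'a \<Rightarrow> 'b::euclidean_space"
  assumes "continuous_on UNIV f"
  shows "integrable (lebesgue_on (interior T)) f"
    "(LINT x|lebesgue_on (interior T). f x) = (LINT x|lebesgue_on T. f x)"
proof -
  have Ts: "T \<in> sets lebesgue" using compact_T by (simp add: lmeasurable_compact fmeasurableD)
  have "integrable lebesgue (\<lambda>x. indicat_real T x *\<^sub>R f x)"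
    using integrable_T[OF assms] integrable_lebesgue_on_iff[OF Ts] by blast
  note * = integrable_AE_eq[OF this negligible_convex_frontier[OF convex_T],
     of "\<lambda>x. indicat_real (interior T) x *\<^sub>R f x"]
  have eq: "indicat_real T x *\<^sub>R f x = indicat_real (interior T) x *\<^sub>R f x" if "x \<notin> frontier T" for x
    using that closure_subset[of T] interior_subset[of T] by (auto simp: frontier_def indicator_def)
  have iT: "interior T \<in> sets lebesgue" by auto
  show "integrable (lebesgue_on (interior T)) f"
    using *(1)[OF eq] integrable_lebesgue_on_iff[OF iT] by blast
  show "(LINT x|lebesgue_on (interior T). f x) = (LINT x|lebesgue_on T. f x)"
    using *(2)[OF eq] by (simp add: integral_lebesgue_on_eq[OF iT] integral_lebesgue_on_eq[OF Ts])
qed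

section \<open>Affine and quadratic functions on a simplex\<close>

lemma monomial_degree_le_1:
  fixes \<alpha> :: "'a::euclidean_space \<Rightarrow> nat"
  assumes "(\<Sum>b\<in>Basis. \<alpha> b) \<le> 1"
  shows "\<exists>a c. \<forall>x. (\<Prod>b\<in>Basis. (x \<bullet> b) ^ \<alpha> b) = a \<bullet> x + (c::real)"
proof (cases "\<forall>b\<in>Basis. \<alpha> b = 0")
  case True
  then show ?thesis by (intro exI[of _ 0] exI[of _ 1]) simp
next
  case False
  then obtain b where b: "b \<in> Basis" "\<alpha> b \<noteq> 0" by blast
  have s: "(\<Sum>b\<in>Basis. \<alpha> b) = \<alpha> b + (\<Sum>i\<in>Basis - {b}. \<alpha> i)"
    by (rule sum.remove) (use b in auto)
  have one: "\<alpha> b = 1" and "(\<Sum>i\<in>Basis - {b}. \<alpha> i) = 0"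
    using assms b(2) unfolding s by linarith+
  then have zero: "\<forall>i\<in>Basis - {b}. \<alpha> i = 0" by (simp add: sum_eq_0_iff)
  have "(\<Prod>i\<in>Basis. (x \<bullet> i) ^ \<alpha> i) = b \<bullet> x + 0" for x :: 'a
  proof -
    have "(\<Prod>i\<in>Basis. (x \<bullet> i) ^ \<alpha> i) = (x \<bullet> b) ^ \<alpha> b * (\<Prod>i\<in>Basis - {b}. (x \<bullet> i) ^ \<alpha> i)"
      by (rule prod.remove) (use b in auto)
    also have "(\<Prod>i\<in>Basis - {b}. (x \<bullet> i) ^ \<alpha> i) = 1" using zero by (intro prod.neutral) auto
    finally show ?thesis using one by (simp add: inner_commute)
  qed
  then show ?thesis by blast
qed

lemma poly_total_degree_le_1_iff:
  "poly_total_degree_le 1 p \<longleftrightarrow> (\<exists>a c. \<forall>x. p x = a \<bullet> x + c)"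
proof
  assume "poly_total_degree_le 1 p"
  then obtain A k where A: "finite A" "\<forall>\<alpha>\<in>A. (\<Sum>b\<in>Basis. \<alpha> b) \<le> 1"
    and p: "\<forall>x. p x = (\<Sum>\<alpha>\<in>A. k \<alpha> * (\<Prod>b\<in>Basis. (x \<bullet> b) ^ \<alpha> b))"
    unfolding poly_total_degree_le_def by blast
  have "\<forall>\<alpha>\<in>A. \<exists>a c. \<forall>x. (\<Prod>b\<in>Basis. (x \<bullet> b) ^ \<alpha> b) = a \<bullet> x + (c::real)"
    using A(2) monomial_degree_le_1 by blast
  then obtain a c where ac: "\<forall>\<alpha>\<in>A. \<forall>x. (\<Prod>b\<in>Basis. (x \<bullet> b) ^ \<alpha> b) = a \<alpha> \<bullet> x + (c \<alpha>::real)" by metis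
  have "p x = (\<Sum>\<alpha>\<in>A. k \<alpha> *\<^sub>R a \<alpha>) \<bullet> x + (\<Sum>\<alpha>\<in>A. k \<alpha> * c \<alpha>)" for x
  proof -
    have "p x = (\<Sum>\<alpha>\<in>A. k \<alpha> * (a \<alpha> \<bullet> x + c \<alpha>))" using p ac by simp
    then show ?thesis by (simp add: inner_sum_left distrib_left sum.distrib)
  qed
  then show "\<exists>a c. \<forall>x. p x = a \<bullet> x + c" by blast
next
  assume "\<exists>a c. \<forall>x. p x = a \<bullet> x + c"
  then obtain a c where p: "\<forall>x. p x = a \<bullet> x + c" by blast
  define \<alpha> where "\<alpha> b = (\<lambda>i. if i = b then 1 else 0 :: nat)" for b :: 'a
  let ?z = "\<lambda>_ :: 'a. 0 :: nat"
  \<comment> \<open>Coefficients are indexed by exponents, so the one belonging to direction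
    \<open>b\<close> is recovered by a sum over directions with a single surviving term.\<close>
  let ?k = "\<lambda>\<beta>. if \<beta> = ?z then c else (\<Sum>b\<in>Basis. if \<beta> = \<alpha> b then a \<bullet> b else 0)"
  have inj: "inj_on \<alpha> Basis" by (rule inj_onI) (metis \<alpha>_def zero_neq_one)
  have ne: "\<alpha> b \<noteq> ?z" for b by (metis \<alpha>_def zero_neq_one)
  have mon: "(\<Prod>i\<in>Basis. (x \<bullet> i) ^ \<alpha> b i) = x \<bullet> b" if "b \<in> Basis" for x b :: 'a
  proof -
    have "(\<Prod>i\<in>Basis. (x \<bullet> i) ^ \<alpha> b i) = (\<Prod>i\<in>Basis. if i = b then x \<bullet> b else 1)"
      by (intro prod.cong) (auto simp: \<alpha>_def)
    then show ?thesis using that by simp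
  qed
  have kk: "?k (\<alpha> b) = a \<bullet> b" if "b \<in> Basis" for b
  proof -
    have "?k (\<alpha> b) = (\<Sum>i\<in>Basis. if \<alpha> b = \<alpha> i then a \<bullet> i else 0)" using ne by simp
    also have "\<dots> = (\<Sum>i\<in>Basis. if b = i then a \<bullet> i else 0)"
      using inj that by (intro sum.cong) (auto simp: inj_on_def)
    finally show ?thesis using that by simp
  qed
  have "p x = (\<Sum>\<beta>\<in>insert ?z (\<alpha> ` Basis). ?k \<beta> * (\<Prod>b\<in>Basis. (x \<bullet> b) ^ \<beta> b))" for x
  proof -
    have "(\<Sum>\<beta>\<in>insert ?z (\<alpha> ` Basis). ?k \<beta> * (\<Prod>b\<in>Basis. (x \<bullet> b) ^ \<beta> b))
        = c + (\<Sum>\<beta>\<in>\<alpha> ` Basis. ?k \<beta> * (\<Prod>b\<in>Basis. (x \<bullet> b) ^ \<beta> b))"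
      using ne[symmetric] by (subst sum.insert) auto
    also have "(\<Sum>\<beta>\<in>\<alpha> ` Basis. ?k \<beta> * (\<Prod>b\<in>Basis. (x \<bullet> b) ^ \<beta> b)) = (\<Sum>b\<in>Basis. (a \<bullet> b) * (x \<bullet> b))"
      unfolding sum.reindex[OF inj] o_def
      by (intro sum.cong refl arg_cong2[where f="(*)"] kk mon)
    finally show ?thesis using p euclidean_inner[of a x] by simp
  qed
  moreover have "(\<Sum>b\<in>Basis. \<alpha> i b) \<le> 1" for i
    by (simp add: \<alpha>_def)
  ultimately show "poly_total_degree_le 1 p"
    unfolding poly_total_degree_le_def
    by (intro exI[of _ "insert ?z (\<alpha> ` Basis)"] exI[of _ ?k]) auto
qed

lemma poly_total_degree_le_0: "poly_total_degree_le 0 p \<Longrightarrow> \<exists>c. \<forall>x. p x = c"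
proof -
  assume "poly_total_degree_le 0 p"
  then obtain A k where A: "\<forall>\<alpha>\<in>A. (\<Sum>b\<in>Basis. \<alpha> b) = 0"
    and p: "\<forall>x. p x = (\<Sum>\<alpha>\<in>A. k \<alpha> * (\<Prod>b\<in>Basis. (x \<bullet> b) ^ \<alpha> b))"
    unfolding poly_total_degree_le_def by auto
  have "p x = (\<Sum>\<alpha>\<in>A. k \<alpha>)" for x
    unfolding p[rule_format] using A by (intro sum.cong) auto
  then show ?thesis by blast
qed

lemma L2_cong:
  assumes "\<And>x. x \<in> U \<Longrightarrow> f x = g x" "f \<in> L2 U" shows "g \<in> L2 U"
proof -
  have "g \<in> borel_measurable (lebesgue_on U)"
    using L2_D(1)[OF assms(2)] assms(1) measurable_cong[of "lebesgue_on U" f g borel] by simp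
  moreover have "integrable (lebesgue_on U) (\<lambda>x. (norm (g x))\<^sup>2)"
    using L2_D(2)[OF assms(2)] assms(1)
      Bochner_Integration.integrable_cong[of "lebesgue_on U" "lebesgue_on U" "\<lambda>x. (norm (f x))\<^sup>2"
          "\<lambda>x. (norm (g x))\<^sup>2"]
    by simp
  ultimately show ?thesis by (simp add: L2_def)
qed

lemma weak_gradient_cong:
  assumes "\<And>x. x \<in> U \<Longrightarrow> f x = f' x" "\<And>x. x \<in> U \<Longrightarrow> g x = g' x" "weak_gradient U f g"
  shows "weak_gradient U f' g'"
proof -
  have "(LINT x|lebesgue_on U. f x *\<^sub>R h x) = (LINT x|lebesgue_on U. f' x *\<^sub>R h x)" for h :: "'a \<Rightarrow> 'a"
    by (intro Bochner_Integration.integral_cong) (auto simp: assms)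
  moreover have "(LINT x|lebesgue_on U. h x *\<^sub>R g x) = (LINT x|lebesgue_on U. h x *\<^sub>R g' x)" for h
      :: "'a \<Rightarrow> real"
    by (intro Bochner_Integration.integral_cong) (auto simp: assms)
  ultimately show ?thesis using assms(3) by (simp add: weak_gradient_def)
qed

text \<open>The local shape of every discrete function. The quadratic part is isotropic, so
  gradients lie in the span of the constant fields and the field \<open>x\<close>; this is why only
  two moments of the gradient error have to vanish.\<close>

definition quad :: "'a::euclidean_space \<Rightarrow> real \<Rightarrow> real \<Rightarrow> 'a \<Rightarrow> real" where
  "quad a c \<beta> x = c + a \<bullet> x + \<beta> * (x \<bullet> x)"

lemma quad_has_derivative: "(quad a c \<beta> has_derivative (\<lambda>h. (a + (2 * \<beta>) *\<^sub>R x) \<bullet> h)) (at x)"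
  unfolding quad_def[abs_def]
  by (auto intro!: derivative_eq_intros simp: inner_add_left inner_commute algebra_simps)

lemma continuous_quad: "continuous_on S (quad a c \<beta>)"
  unfolding quad_def[abs_def] by (intro continuous_intros)

lemma has_derivative_if_quad:
  assumes "open U" "\<And>x. x \<in> U \<Longrightarrow> w x = quad a c \<beta> x" "x \<in> U"
  shows "(w has_derivative (\<lambda>h. grad w x \<bullet> h)) (at x)" "grad w x = a + (2 * \<beta>) *\<^sub>R x"
proof -
  have "(w has_derivative (\<lambda>h. (a + (2 * \<beta>) *\<^sub>R x) \<bullet> h)) (at x)"
    by (rule has_derivative_transform_within_open[OF quad_has_derivative assms(1,3)]) (simp add:
        assms(2))
  then show "grad w x = a + (2 * \<beta>) *\<^sub>R x" by (rule grad_eqI)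
  with \<open>(w has_derivative (\<lambda>h. (a + (2 * \<beta>) *\<^sub>R x) \<bullet> h)) (at x)\<close>
  show "(w has_derivative (\<lambda>h. grad w x \<bullet> h)) (at x)" by simp
qed

context full_simplex
begin

lemma continuous_L2:
  fixes f :: "'a \<Rightarrow> 'b::euclidean_space"
  assumes "continuous_on UNIV f" shows "f \<in> L2 (interior T)"
proof -
  have "integrable (lebesgue_on (interior T)) f"
    by (rule interior_integral(1)[OF assms])
  moreover have "integrable (lebesgue_on (interior T)) (\<lambda>x. (norm (f x))\<^sup>2)"
    by (rule interior_integral(1)) (intro continuous_intros assms)
  ultimately show ?thesis by (auto simp: L2_def)
qed

lemma quad_L2:
  assumes "\<And>x. x \<in> interior T \<Longrightarrow> w x = quad a c \<beta> x"
  shows "w \<in> L2 (interior T)" "grad w \<in> L2 (interior T)" "weak_gradient (interior T) w (grad w)"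
proof -
  have o: "open (interior T)" by simp
  have ca: "continuous_on UNIV (\<lambda>x. a + (2 * \<beta>) *\<^sub>R x)" by (intro continuous_intros)
  note g = has_derivative_if_quad(2)[OF o assms]
  show "w \<in> L2 (interior T)"
    by (rule L2_cong[OF _ continuous_L2[OF continuous_quad]]) (simp add: assms)
  show "grad w \<in> L2 (interior T)"
    by (rule L2_cong[OF _ continuous_L2[OF ca]]) (simp add: g)
  show "weak_gradient (interior T) w (grad w)"
    by (rule weak_gradient_cong[OF _ _ weak_gradient_classical[OF quad_has_derivative ca o]])
       (simp_all add: assms g)
qed

lemma trace_from_affine:
  assumes "\<And>x. x \<in> interior T \<Longrightarrow> v x = a \<bullet> x + c" "z \<in> T"
  shows "trace_from T v z = a \<bullet> z + c"
proof -
  have "z \<in> closure (interior T)"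
    using convex_closure_interior[OF convex_T interior_T] assms(2) closure_subset by blast
  then have "z islimpt interior T"
    using interior_limit_point[of z T] islimpt_Un
    by (metis closure_def Un_iff mem_Collect_eq open_interior interior_limit_point interior_interior)
  \<comment> \<open>The filter must be nontrivial for \<open>Lim\<close> to be the limit and not an
    arbitrary value.\<close>
  then have nt: "at z within interior T \<noteq> bot" by (simp add: trivial_limit_within)
  have "((\<lambda>x. a \<bullet> x + c) \<longlongrightarrow> a \<bullet> z + c) (at z within interior T)"
    by (intro tendsto_intros)
  then have "(v \<longlongrightarrow> a \<bullet> z + c) (at z within interior T)"
    by (rule Lim_transform_eventually) (simp add: eventually_at_filter assms(1))
  then show ?thesis unfolding trace_from_def by (rule tendsto_Lim[OF nt])
qed

lemma facet_obtain:
  assumes "F facet_of T" obtains P where "P \<in> C" "F = convex hull (C - {P})"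
  using assms unfolding T facet_of_convex_hull_affine_independent[OF indep] by blast

lemma mid_facet_in: "P \<in> C \<Longrightarrow> mid (convex hull (C - {P})) \<in> convex hull (C - {P})"
proof -
  assume P: "P \<in> C"
  have "mid (convex hull (C - {P})) = (\<Sum>Q\<in>C - {P}. (1 / real (card (C - {P}))) *\<^sub>R Q)"
    unfolding mid_def vertices_facet[OF P] by (rule scaleR_sum_right)
  also have "\<dots> \<in> convex hull (C - {P})"
    by (rule convex_sum) (use finite_C facet_ne[OF P] hull_subset in \<open>auto simp: card_gt_0_iff
        intro: hull_inc\<close>)
  finally show ?thesis .
qed

lemma facet_sub: "convex hull (C - {P}) \<subseteq> T" unfolding T by (rule hull_mono) auto

text \<open>Hence, with n the dimension, \<open>1 - n * bary C Q x\<close> takes the value 1 at the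
  barycenter of the facet opposite to \<open>Q\<close> and 0 at the barycenters of the other facets:
  it is the local Crouzeix-Raviart basis function.\<close>

lemma bary_mid_facet:
  assumes "P \<in> C" "Q \<in> C"
  shows "bary C Q (mid (convex hull (C - {P}))) = (if Q = P then 0 else 1 / real DIM('a))"
proof (cases "Q = P")
  case True
  then show ?thesis using bary_facet_eq_0[OF indep assms(1) mid_facet_in[OF assms(1)]] by simp
next
  case False
  have n: "card (C - {P}) = DIM('a)" using assms(1) card_C finite_C by simp
  have "bary C Q (mid (convex hull (C - {P}))) = (\<Sum>R\<in>C - {P}. bary C Q R) / real DIM('a)"
    using n by (simp add: bary_def mid_def vertices_facet[OF assms(1)] inner_sum_right sum.distrib
        add_divide_distrib)
  also have "(\<Sum>R\<in>C - {P}. bary C Q R) = (\<Sum>R\<in>C - {P}. if R = Q then 1 else 0)"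
    by (intro sum.cong) (auto simp: bary_vertex[OF indep assms(2)])
  also have "\<dots> = 1" using assms(2) False finite_C by simp
  finally show ?thesis using False by simp
qed

end

section \<open>Discrete functions by local coefficients\<close>

context mesh
begin

text \<open>On each simplex the function is affine, so the one-sided limits in the jump conditions
  become evaluations, and the conditions become linear equations in the coefficients. The right-hand
  side admits \<open>T' = T\<close>, where the equation is trivial.\<close>

lemma CR0_iff:
  "v \<in> CR0 \<Omega> \<T> \<longleftrightarrow> (\<exists>a c. (\<forall>T\<in>\<T>. \<forall>x\<in>interior T. v x = a T \<bullet> x + c T) \<and>
     (\<forall>T\<in>\<T>. \<forall>F. F facet_of T \<longrightarrow>
        (if F \<subseteq> frontier \<Omega> then a T \<bullet> mid F + c T = 0
         else \<forall>T'\<in>\<T>. F facet_of T' \<longrightarrow> a T \<bullet> mid F + c T = a T' \<bullet> mid F + c T')))"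
proof -
  have jump: "(\<forall>F\<in>faces \<T>. jump_vanishes \<Omega> \<T> v F (mid F)) \<longleftrightarrow>
     (\<forall>T\<in>\<T>. \<forall>F. F facet_of T \<longrightarrow>
        (if F \<subseteq> frontier \<Omega> then a T \<bullet> mid F + c T = 0
         else \<forall>T'\<in>\<T>. F facet_of T' \<longrightarrow> a T \<bullet> mid F + c T = a T' \<bullet> mid F + c T'))"
    if v: "\<forall>T\<in>\<T>. \<forall>x\<in>interior T. v x = a T \<bullet> x + c T" for a c
  proof -
    have tr: "trace_from T v (mid F) = a T \<bullet> mid F + c T" if tm: "T \<in> \<T>" and F: "F facet_of T" for T F
    proof -
      interpret full_simplex "vertices T" T by (rule simplex_mesh[OF tm])
      obtain P where "P \<in> vertices T" "F = convex hull (vertices T - {P})" by (rule facet_obtain[OF F])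
      then have "mid F \<in> T" using mid_facet_in facet_sub by blast
      then show ?thesis using v tm by (intro trace_from_affine) blast+
    qed
    have "(\<forall>F\<in>faces \<T>. jump_vanishes \<Omega> \<T> v F (mid F)) \<longleftrightarrow>
       (\<forall>T\<in>\<T>. \<forall>F. F facet_of T \<longrightarrow> jump_vanishes \<Omega> \<T> v F (mid F))"
      unfolding faces_def by blast
    also have "\<dots> \<longleftrightarrow> (\<forall>T\<in>\<T>. \<forall>F. F facet_of T \<longrightarrow>
        (if F \<subseteq> frontier \<Omega> then trace_from T v (mid F) = 0
         else \<forall>T'\<in>\<T>. F facet_of T' \<longrightarrow> trace_from T v (mid F) = trace_from T' v (mid F)))"
      unfolding jump_vanishes_def by (auto split: if_splits) metis
    also have "\<dots> \<longleftrightarrow> (\<forall>T\<in>\<T>. \<forall>F. F facet_of T \<longrightarrow>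
        (if F \<subseteq> frontier \<Omega> then a T \<bullet> mid F + c T = 0
         else \<forall>T'\<in>\<T>. F facet_of T' \<longrightarrow> a T \<bullet> mid F + c T = a T' \<bullet> mid F + c T'))"
      using tr by (intro ball_cong refl all_cong imp_cong if_cong) auto
    finally show ?thesis .
  qed
  have pw: "v \<in> pw_poly 1 \<T> \<longleftrightarrow> (\<exists>a c. \<forall>T\<in>\<T>. \<forall>x\<in>interior T. v x = a T \<bullet> x + c T)"
  proof
    assume "v \<in> pw_poly 1 \<T>"
    then have "\<forall>T\<in>\<T>. \<exists>a c. \<forall>x\<in>interior T. v x = a \<bullet> x + c"
      unfolding pw_poly_def poly_total_degree_le_1_iff mem_Collect_eq by metis
    then show "\<exists>a c. \<forall>T\<in>\<T>. \<forall>x\<in>interior T. v x = a T \<bullet> x + c T" by metis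
  next
    assume "\<exists>a c. \<forall>T\<in>\<T>. \<forall>x\<in>interior T. v x = a T \<bullet> x + c T"
    then obtain a c where ac: "\<forall>T\<in>\<T>. \<forall>x\<in>interior T. v x = a T \<bullet> x + c T" by blast
    show "v \<in> pw_poly 1 \<T>"
      unfolding pw_poly_def poly_total_degree_le_1_iff mem_Collect_eq
    proof
      fix T assume "T \<in> \<T>"
      then show "\<exists>p. (\<exists>a c. \<forall>x. p x = a \<bullet> x + c) \<and> (\<forall>x\<in>interior T. v x = p x)"
        using ac by (intro exI[of _ "\<lambda>x. a T \<bullet> x + c T"]) auto
    qed
  qed
  show ?thesis (is "_ \<longleftrightarrow> ?R")
  proof
    assume "v \<in> CR0 \<Omega> \<T>"
    then have 1: "v \<in> pw_poly 1 \<T>" and 2: "\<forall>F\<in>faces \<T>. jump_vanishes \<Omega> \<T> v F (mid F)"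
      unfolding CR0_def by simp_all
    obtain a c where ac: "\<forall>T\<in>\<T>. \<forall>x\<in>interior T. v x = a T \<bullet> x + c T"
      using 1 unfolding pw by blast
    show ?R
      by (rule exI[of _ a], rule exI[of _ c], rule conjI[OF ac], rule iffD1[OF jump[OF ac] 2])
  next
    assume ?R
    then obtain a c where ac: "\<forall>T\<in>\<T>. \<forall>x\<in>interior T. v x = a T \<bullet> x + c T" and
      m: "(\<forall>T\<in>\<T>. \<forall>F. F facet_of T \<longrightarrow>
        (if F \<subseteq> frontier \<Omega> then a T \<bullet> mid F + c T = 0
         else \<forall>T'\<in>\<T>. F facet_of T' \<longrightarrow> a T \<bullet> mid F + c T = a T' \<bullet> mid F + c T'))"
      by (elim exE conjE)
    have "v \<in> pw_poly 1 \<T>" unfolding pw using ac by blast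
    then show "v \<in> CR0 \<Omega> \<T>" unfolding CR0_def using iffD2[OF jump[OF ac] m] by simp
  qed
qed

lemma CR0_linear_combination:
  assumes "finite K" "\<And>j. j \<in> K \<Longrightarrow> v j \<in> CR0 \<Omega> \<T>"
  shows "(\<lambda>x. \<Sum>j\<in>K. d j * v j x) \<in> CR0 \<Omega> \<T>"
proof -
  define Q where "Q j a c \<longleftrightarrow> (\<forall>T\<in>\<T>. \<forall>x\<in>interior T. v j x = a T \<bullet> x + c T) \<and>
     (\<forall>T\<in>\<T>. \<forall>F. F facet_of T \<longrightarrow>
        (if F \<subseteq> frontier \<Omega> then a T \<bullet> mid F + c T = 0
         else \<forall>T'\<in>\<T>. F facet_of T' \<longrightarrow> a T \<bullet> mid F + c T = a T' \<bullet> mid F + c T'))"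
    for j and a :: "'a set \<Rightarrow> 'a" and c :: "'a set \<Rightarrow> real"
  have "\<forall>j\<in>K. \<exists>a c. Q j a c"
    using assms(2) unfolding CR0_iff Q_def by blast
  then obtain a c where Q: "\<forall>j\<in>K. Q j (a j) (c j)" by metis
  have ac: "v j x = a j T \<bullet> x + c j T" if "j \<in> K" "T \<in> \<T>" "x \<in> interior T" for j T x
    using Q that unfolding Q_def by blast
  have m: "a j T \<bullet> mid F + c j T = 0" if "j \<in> K" "T \<in> \<T>" "F facet_of T" "F \<subseteq> frontier \<Omega>" for j T F
    using Q that unfolding Q_def by meson
  have m': "a j T \<bullet> mid F + c j T = a j T' \<bullet> mid F + c j T'"
    if "j \<in> K" "T \<in> \<T>" "F facet_of T" "\<not> F \<subseteq> frontier \<Omega>" "T' \<in> \<T>" "F facet_of T'" for j T T' F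
    using Q that unfolding Q_def by meson
  define A where "A T = (\<Sum>j\<in>K. d j *\<^sub>R a j T)" for T
  define C where "C T = (\<Sum>j\<in>K. d j * c j T)" for T
  have AC: "A T \<bullet> x + C T = (\<Sum>j\<in>K. d j * (a j T \<bullet> x + c j T))" for T x
    by (simp add: A_def C_def inner_sum_left distrib_left sum.distrib)
  show ?thesis unfolding CR0_iff
  proof (intro exI[of _ A] exI[of _ C] conjI ballI allI impI)
    show "(\<Sum>j\<in>K. d j * v j x) = A T \<bullet> x + C T" if "T \<in> \<T>" "x \<in> interior T" for T x
      unfolding AC using ac that by (intro sum.cong) auto
    fix T F assume T: "T \<in> \<T>" "F facet_of T"
    show "if F \<subseteq> frontier \<Omega> then A T \<bullet> mid F + C T = 0
         else \<forall>T'\<in>\<T>. F facet_of T' \<longrightarrow> A T \<bullet> mid F + C T = A T' \<bullet> mid F + C T'"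
    proof (cases "F \<subseteq> frontier \<Omega>")
      case True
      then show ?thesis unfolding AC using m[OF _ T True] by simp
    next
      case False
      have "A T \<bullet> mid F + C T = A T' \<bullet> mid F + C T'" if "T' \<in> \<T>" "F facet_of T'" for T'
        unfolding AC by (intro sum.cong refl) (simp add: m'[OF _ T False that])
      then show ?thesis using False by simp
    qed
  qed
qed

lemma eCR0_linear_combination:
  assumes "finite K" "\<And>j. j \<in> K \<Longrightarrow> w j \<in> eCR0 \<Omega> \<T>"
  shows "(\<lambda>x. \<Sum>j\<in>K. d j * w j x) \<in> eCR0 \<Omega> \<T>"
proof -
  have "\<forall>j\<in>K. \<exists>v \<gamma>. v \<in> CR0 \<Omega> \<T> \<and> w j = (\<lambda>x. v x + (\<Sum>T\<in>\<T>. \<gamma> T * bubble T x))"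
    using assms(2) unfolding eCR0_def bubble_space_def by blast
  then obtain v \<gamma> where v: "\<And>j. j \<in> K \<Longrightarrow> v j \<in> CR0 \<Omega> \<T>"
    and w: "\<And>j. j \<in> K \<Longrightarrow> w j = (\<lambda>x. v j x + (\<Sum>T\<in>\<T>. \<gamma> j T * bubble T x))" by metis
  have "(\<Sum>j\<in>K. d j * w j x) = (\<Sum>j\<in>K. d j * v j x) + (\<Sum>T\<in>\<T>. (\<Sum>j\<in>K. d j * \<gamma> j T) * bubble T x)" for x
  proof -
    have "(\<Sum>j\<in>K. d j * w j x) = (\<Sum>j\<in>K. d j * v j x) + (\<Sum>j\<in>K. \<Sum>T\<in>\<T>. d j * \<gamma> j T * bubble T x)"
      by (simp add: w distrib_left sum.distrib sum_distrib_left mult.assoc)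
    also have "(\<Sum>j\<in>K. \<Sum>T\<in>\<T>. d j * \<gamma> j T * bubble T x) = (\<Sum>T\<in>\<T>. (\<Sum>j\<in>K. d j * \<gamma> j T) * bubble T x)"
      by (subst sum.swap) (simp add: sum_distrib_right)
    finally show ?thesis .
  qed
  then show ?thesis
    unfolding eCR0_def bubble_space_def using CR0_linear_combination[OF assms(1) v]
    by (intro CollectI exI[of _ "\<lambda>x. \<Sum>j\<in>K. d j * v j x"] exI[of _ "\<lambda>x. \<Sum>T\<in>\<T>. (\<Sum>j\<in>K. d j * \<gamma> j T) *
        bubble T x"]) auto
qed

lemma bubble_sum_interior:
  assumes tm: "T \<in> \<T>" and x: "x \<in> interior T"
  shows "(\<Sum>S\<in>\<T>. \<gamma> S * bubble S x) = \<gamma> T * full_simplex.bubble_poly T x"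
proof -
  interpret full_simplex "vertices T" T by (rule simplex_mesh[OF tm])
  have "(\<Sum>S\<in>\<T>. \<gamma> S * bubble S x) = (\<Sum>S\<in>{T}. \<gamma> S * bubble S x)"
  proof (rule sum.mono_neutral_right)
    show "\<forall>S\<in>\<T> - {T}. \<gamma> S * bubble S x = 0"
    proof
      fix S assume "S \<in> \<T> - {T}"
      then have "x \<notin> S" using interior_disjoint[OF tm, of S] x by auto
      then show "\<gamma> S * bubble S x = 0" by (simp add: bubble_def Let_def)
    qed
  qed (use tm finite_mesh in auto)
  moreover have "x \<in> T" using x interior_subset by blast
  ultimately show ?thesis by (simp add: bubble_eq)
qed

text \<open>Expanding the square in the bubble about the origin moves \<open>mid T\<close> into the
  linear and constant coefficients.\<close>

lemma eCR0_local:
  assumes "w \<in> eCR0 \<Omega> \<T>" "T \<in> \<T>"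
  obtains a c \<beta> where "\<And>x. x \<in> interior T \<Longrightarrow> w x = quad a c \<beta> x"
proof -
  interpret full_simplex "vertices T" T by (rule simplex_mesh[OF assms(2)])
  obtain v \<gamma> where v: "v \<in> CR0 \<Omega> \<T>" and w: "w = (\<lambda>x. v x + (\<Sum>T\<in>\<T>. \<gamma> T * bubble T x))"
    using assms(1) unfolding eCR0_def bubble_space_def by blast
  obtain a c where ac: "\<And>x. x \<in> interior T \<Longrightarrow> v x = a \<bullet> x + c"
    using v assms(2) unfolding CR0_iff by metis
  let ?k = "\<gamma> T * bubble_coeff"
  have "w x = quad (a + (2 * ?k) *\<^sub>R mid T) (c + \<gamma> T * ((real DIM('a) + 2) / 2) - ?k * (mid T \<bullet>
      mid T)) (- ?k) x"
    if "x \<in> interior T" for x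
    by (simp add: w ac[OF that] bubble_sum_interior[OF assms(2) that] bubble_poly_def quad_def
        power2_norm_eq_inner inner_diff_left inner_diff_right inner_add_left inner_commute algebra_simps)
  then show ?thesis using that by blast
qed

lemma eCR0_L2_local:
  assumes "w \<in> eCR0 \<Omega> \<T>" "T \<in> \<T>"
  shows "w \<in> L2 (interior T)" "grad w \<in> L2 (interior T)" "weak_gradient (interior T) w (grad w)"
  using eCR0_local[OF assms] full_simplex.quad_L2[OF simplex_mesh[OF assms(2)]] by metis+

lemma eCR0_L2: "eCR0 \<Omega> \<T> \<subseteq> L2 \<Omega>"
proof
  fix w assume w: "w \<in> eCR0 \<Omega> \<T>"
  have one: "(\<lambda>_. 1 :: real) \<in> L2 (interior T)" if "T \<in> \<T>" for T
    by (rule full_simplex.continuous_L2[OF simplex_mesh[OF that]]) simp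
  have "integrable (lebesgue_on (interior T)) w" if "T \<in> \<T>" for T
    using L2_integrable_mult[OF one[OF that] eCR0_L2_local(1)[OF w that]] by simp
  then have "w \<in> borel_measurable (lebesgue_on \<Omega>)" using integral_split(1)[of w] by auto
  moreover have "integrable (lebesgue_on \<Omega>) (\<lambda>x. (norm (w x))\<^sup>2)"
    by (rule integral_split(1)) (use L2_D(2)[OF eCR0_L2_local(1)[OF w]] in auto)
  ultimately show "w \<in> L2 \<Omega>" by (simp add: L2_def)
qed

end

section \<open>Interpolation without traces\<close>

lemma L2_norm_square: "(L2_norm U f)\<^sup>2 = (LINT x|lebesgue_on U. (norm (f x))\<^sup>2)"
  unfolding L2_norm_def by (rule real_sqrt_pow2) (intro Bochner_Integration.integral_nonneg; simp)

lemma L2_norm_nonneg: "0 \<le> L2_norm U f"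
  unfolding L2_norm_def by (intro real_sqrt_ge_zero Bochner_Integration.integral_nonneg) simp

lemma quadratic_nonneg_discriminant:
  fixes A B C :: real
  assumes "\<And>t. 0 \<le> A - 2 * t * B + t\<^sup>2 * C" "0 \<le> C"
  shows "B\<^sup>2 \<le> A * C"
proof (cases "C = 0")
  case True
  have "B = 0"
  proof (rule ccontr)
    assume "B \<noteq> 0"
    \<comment> \<open>For \<open>C = 0\<close> the expression is linear in \<open>t\<close>, and at
      this \<open>t\<close> it equals -1.\<close>
    then show False using assms(1)[of "(A + 1) / (2 * B)"] True by simp
  qed
  then show ?thesis using True by simp
next
  case False
  then have C: "C > 0" using assms(2) by simp
  have "0 \<le> A - 2 * (B / C) * B + (B / C)\<^sup>2 * C" by (rule assms(1))
  also have "\<dots> = A - B\<^sup>2 / C" using C by (simp add: power2_eq_square divide_simps)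
  finally show ?thesis using C by (simp add: divide_simps mult.commute)
qed

lemma L2_Cauchy_Schwarz:
  fixes f g :: "'a::euclidean_space \<Rightarrow> 'b::euclidean_space"
  assumes f: "f \<in> L2 U" and g: "g \<in> L2 U"
  shows "\<bar>LINT x|lebesgue_on U. f x \<bullet> g x\<bar> \<le> L2_norm U f * L2_norm U g"
proof -
  let ?A = "LINT x|lebesgue_on U. (norm (f x))\<^sup>2" and ?B = "LINT x|lebesgue_on U. f x \<bullet> g x"
    and ?C = "LINT x|lebesgue_on U. (norm (g x))\<^sup>2"
  note i = L2_D(2)[OF f] L2_D(2)[OF g] L2_integrable_inner[OF f g]
  have "?B\<^sup>2 \<le> ?A * ?C"
  proof (rule quadratic_nonneg_discriminant)
    fix t :: real
    have "0 \<le> (LINT x|lebesgue_on U. (norm (f x - t *\<^sub>R g x))\<^sup>2)"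
      by (intro Bochner_Integration.integral_nonneg) simp
    also have "(\<lambda>x. (norm (f x - t *\<^sub>R g x))\<^sup>2) = (\<lambda>x. (norm (f x))\<^sup>2 - 2 * t * (f x \<bullet> g x) + t\<^sup>2
        * (norm (g x))\<^sup>2)"
      by (simp only: power2_norm_eq_inner) (simp add: inner_diff_left inner_diff_right
          inner_commute power2_eq_square algebra_simps)
    also have "(LINT x|lebesgue_on U. (norm (f x))\<^sup>2 - 2 * t * (f x \<bullet> g x) + t\<^sup>2 * (norm (g x))\<^sup>2)
        = ?A - 2 * t * ?B + t\<^sup>2 * ?C"
      using i by simp
    finally show "0 \<le> ?A - 2 * t * ?B + t\<^sup>2 * ?C" .
  qed (intro Bochner_Integration.integral_nonneg, simp)
  also have "\<dots> = (L2_norm U f * L2_norm U g)\<^sup>2"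
    by (simp add: power_mult_distrib L2_norm_square)
  finally have "\<bar>?B\<bar>\<^sup>2 \<le> (L2_norm U f * L2_norm U g)\<^sup>2" by simp
  then show ?thesis
    by (rule power2_le_imp_le) (simp add: L2_norm_nonneg)
qed

lemma L2_norm_subset:
  fixes f :: "'a::euclidean_space \<Rightarrow> 'b::euclidean_space"
  assumes "f \<in> L2 U" "U \<in> sets lebesgue" "W \<in> sets lebesgue" "W \<subseteq> U"
  shows "L2_norm W f \<le> L2_norm U f"
proof -
  have iU: "integrable lebesgue (\<lambda>x. indicat_real U x *\<^sub>R (norm (f x))\<^sup>2)"
    by (rule iffD1[OF integrable_lebesgue_on_iff[OF assms(2)] L2_D(2)[OF assms(1)]])
  have iW: "integrable lebesgue (\<lambda>x. indicat_real W x *\<^sub>R (norm (f x))\<^sup>2)"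
    by (rule iffD1[OF integrable_lebesgue_on_iff[OF assms(3)] L2_D(2)[OF L2_subset[OF assms]]])
  have "(LINT x|lebesgue_on W. (norm (f x))\<^sup>2) \<le> (LINT x|lebesgue_on U. (norm (f x))\<^sup>2)"
    unfolding integral_lebesgue_on_eq[OF assms(2)] integral_lebesgue_on_eq[OF assms(3)]
    by (rule integral_mono[OF iW iU]) (use assms(4) in \<open>auto simp: indicator_def\<close>)
  then show ?thesis unfolding L2_norm_def by (rule real_sqrt_le_mono)
qed

lemma L2_integral_tendsto:
  fixes f :: "'a::euclidean_space \<Rightarrow> 'b::euclidean_space"
  assumes "f \<in> L2 U" "\<And>j. F j \<in> L2 U" "U \<in> sets lebesgue" "W \<in> sets lebesgue" "W \<subseteq> U" "h \<in> L2 W"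
    and lim: "(\<lambda>j. L2_norm U (\<lambda>x. f x - F j x)) \<longlonglongrightarrow> 0"
  shows "(\<lambda>j. LINT x|lebesgue_on W. F j x \<bullet> h x) \<longlonglongrightarrow> (LINT x|lebesgue_on W. f x \<bullet> h x)"
proof -
  have L: "f \<in> L2 W" "F j \<in> L2 W" for j using assms L2_subset by blast+
  have "norm ((LINT x|lebesgue_on W. F j x \<bullet> h x) - (LINT x|lebesgue_on W. f x \<bullet> h x))
      \<le> L2_norm U (\<lambda>x. f x - F j x) * L2_norm W h" for j
  proof -
    have "(LINT x|lebesgue_on W. f x \<bullet> h x) - (LINT x|lebesgue_on W. F j x \<bullet> h x)
        = (LINT x|lebesgue_on W. (f x - F j x) \<bullet> h x)"
      using L2_integrable_inner[OF L(1) assms(6)] L2_integrable_inner[OF L(2) assms(6)]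
      by (simp add: inner_diff_left)
    then have "norm ((LINT x|lebesgue_on W. F j x \<bullet> h x) - (LINT x|lebesgue_on W. f x \<bullet> h x))
        = \<bar>LINT x|lebesgue_on W. (f x - F j x) \<bullet> h x\<bar>"
      by simp
    also have "\<dots> \<le> L2_norm W (\<lambda>x. f x - F j x) * L2_norm W h"
      by (rule L2_Cauchy_Schwarz[OF L2_diff[OF L] assms(6)])
    also have "\<dots> \<le> L2_norm U (\<lambda>x. f x - F j x) * L2_norm W h"
      by (intro mult_right_mono L2_norm_nonneg L2_norm_subset[OF L2_diff[OF assms(1,2)] assms(3-5)])
    finally show ?thesis .
  qed
  then have "(\<lambda>j. (LINT x|lebesgue_on W. F j x \<bullet> h x) - (LINT x|lebesgue_on W. f x \<bullet> h x)) \<longlonglongrightarrow> 0"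
    by (intro Lim_null_comparison[OF _ tendsto_mult_left_zero[OF lim]] eventuallyI)
  then show ?thesis by (rule LIM_zero_cancel)
qed

section \<open>Sobolev functions and their facet means\<close>

lemma H10_D:
  assumes "u \<in> H10 \<Omega>"
  shows "u \<in> L2 \<Omega>" "wgrad \<Omega> u \<in> L2 \<Omega>" "weak_gradient \<Omega> u (wgrad \<Omega> u)"
proof -
  have u: "u \<in> H1 \<Omega>" using assms by (simp add: H10_def)
  then show "u \<in> L2 \<Omega>" by (simp add: H1_def)
  have "\<exists>g. g \<in> L2 \<Omega> \<and> weak_gradient \<Omega> u g" using u by (auto simp: H1_def)
  from someI_ex[OF this] have "wgrad \<Omega> u \<in> L2 \<Omega> \<and> weak_gradient \<Omega> u (wgrad \<Omega> u)"
    unfolding wgrad_def .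
  then show "wgrad \<Omega> u \<in> L2 \<Omega>" "weak_gradient \<Omega> u (wgrad \<Omega> u)" by auto
qed

text \<open>\<open>face_functional\<close> divided by n times the volume. The integral runs over the
  interior, the set on which Sobolev functions and their gradients are known to be square
  integrable.\<close>

definition face_mean :: "'a::euclidean_space set \<Rightarrow> 'a \<Rightarrow> ('a \<Rightarrow> real) \<Rightarrow> ('a \<Rightarrow> 'a) \<Rightarrow> real" where
  "face_mean T P u g =
     (LINT x|lebesgue_on (interior T). real DIM('a) * u x + g x \<bullet> (x - P)) / (real DIM('a) *
         measure lebesgue T)"

lemma (in full_simplex) interior_hull: "interior (convex hull C) \<noteq> {}"
  using interior_T unfolding T .

lemma (in full_simplex) face_mean_continuous:
  assumes "continuous_on UNIV f" "continuous_on UNIV g"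
  shows "face_mean T P f g = face_functional P f g / (real DIM('a) * vol)"
  unfolding face_mean_def face_functional_def
  by (subst interior_integral(2)) (auto intro!: continuous_intros assms)

lemma (in full_simplex) face_mean_integrable:
  fixes u :: "'a \<Rightarrow> real" and g :: "'a \<Rightarrow> 'a"
  assumes "u \<in> L2 (interior T)" "g \<in> L2 (interior T)"
  shows "integrable (lebesgue_on (interior T)) u" "integrable (lebesgue_on (interior T)) g"
     "integrable (lebesgue_on (interior T)) (\<lambda>x. g x \<bullet> x)"
     "integrable (lebesgue_on (interior T)) (\<lambda>x. g x \<bullet> (x - P))"
proof -
  have L: "(\<lambda>_. 1 :: real) \<in> L2 (interior T)" "(\<lambda>x. x) \<in> L2 (interior T)" "(\<lambda>x. x - P) \<in> L2 (interior T)"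
    by (rule continuous_L2; intro continuous_intros)+
  show "integrable (lebesgue_on (interior T)) u" using L2_integrable_mult[OF L(1) assms(1)] by simp
  show "integrable (lebesgue_on (interior T)) g" using L2_integrable_scaleR[OF L(1) assms(2)] by simp
  show "integrable (lebesgue_on (interior T)) (\<lambda>x. g x \<bullet> x)"
     "integrable (lebesgue_on (interior T)) (\<lambda>x. g x \<bullet> (x - P))"
    using L2_integrable_inner[OF assms(2)] L by auto
qed

context mesh
begin

text \<open>The part of a vanishing trace that interpolation needs: facet means are zero on the
  boundary and agree between neighbours. It consists of linear conditions continuous in the L2 norms
  of \<open>u\<close> and \<open>g\<close>, so it survives limits.\<close>

definition matched :: "('a \<Rightarrow> real) \<Rightarrow> ('a \<Rightarrow> 'a) \<Rightarrow> bool" where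
  "matched u g \<longleftrightarrow>
    (\<forall>T\<in>\<T>. \<forall>P\<in>vertices T. convex hull (vertices T - {P}) \<subseteq> frontier \<Omega> \<longrightarrow> face_mean T P u g = 0) \<and>
    (\<forall>T\<in>\<T>. \<forall>T'\<in>\<T>. \<forall>P\<in>vertices T. \<forall>P'\<in>vertices T'.
       convex hull (vertices T - {P}) = convex hull (vertices T' - {P'}) \<longrightarrow> face_mean T P u g
           = face_mean T' P' u g)"

lemma test_function_matched:
  assumes \<phi>: "test_function \<Omega> \<phi>" shows "matched \<phi> (grad \<phi>)"
  unfolding matched_def
proof (intro conjI ballI impI)
  note d = test_function_derivative[OF \<phi>]
  fix T P assume tm: "T \<in> \<T>" and P: "P \<in> vertices T"
  interpret S: full_simplex "vertices T" T by (rule simplex_mesh[OF tm])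
  {
    assume F: "convex hull (vertices T - {P}) \<subseteq> frontier \<Omega>"
    have "S.face_functional P \<phi> (grad \<phi>) = 0"
    proof (rule S.face_functional_eq_0[OF P d(1) d(2)])
      fix x assume "x \<in> convex hull (vertices T - {P})"
      then have "x \<notin> \<Omega>" using F open_domain by (auto simp: frontier_def interior_open)
      then show "\<phi> x = 0" using \<phi> closure_subset[of "{x. \<phi> x \<noteq> 0}"] by (auto simp: test_function_def)
    qed
    then show "face_mean T P \<phi> (grad \<phi>) = 0" by (simp add: S.face_mean_continuous[OF d(3,2)])
  next
    fix T' P' assume tm': "T' \<in> \<T>" and P': "P' \<in> vertices T'"
      and eq: "convex hull (vertices T - {P}) = convex hull (vertices T' - {P'})"
    interpret S': full_simplex "vertices T'" T' by (rule simplex_mesh[OF tm'])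
    \<comment> \<open>A facet determines its vertices as its extreme points, so equal facets have
      equal vertex sets.\<close>
    have vv: "vertices T - {P} = vertices T' - {P'}"
      using arg_cong[OF eq, of vertices] unfolding S.vertices_facet[OF P] S'.vertices_facet[OF P'] .
    have e: "S.face_functional P \<phi> (grad \<phi>) / S.vol = S'.face_functional P' \<phi> (grad \<phi>) / S'.vol"
      by (rule face_functional_match[OF S.full_simplex_axioms S'.full_simplex_axioms P P' vv d(1) d(2)])
    show "face_mean T P \<phi> (grad \<phi>) = face_mean T' P' \<phi> (grad \<phi>)"
      unfolding S.face_mean_continuous[OF d(3,2)] S'.face_mean_continuous[OF d(3,2)]
        mult.commute[of "real DIM('a)"] divide_divide_eq_left[symmetric] e ..
  }
qed

lemma H10_matched:
  assumes u: "u \<in> H10 \<Omega>" shows "matched u (wgrad \<Omega> u)"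
proof -
  note L = H10_D[OF u]
  obtain \<phi> where \<phi>: "\<And>j::nat. test_function \<Omega> (\<phi> j)" and
     lim: "(\<lambda>j. sqrt ((L2_norm \<Omega> (\<lambda>x. u x - \<phi> j x))\<^sup>2
              + (L2_norm \<Omega> (\<lambda>x. wgrad \<Omega> u x - grad (\<phi> j) x))\<^sup>2)) \<longlonglongrightarrow> 0"
    using u unfolding H10_def by blast
  have lim1: "(\<lambda>j. L2_norm \<Omega> (\<lambda>x. u x - \<phi> j x)) \<longlonglongrightarrow> 0"
    by (rule Lim_null_comparison[OF _ lim]) (auto simp: L2_norm_nonneg intro!: eventuallyI real_le_rsqrt)
  have lim2: "(\<lambda>j. L2_norm \<Omega> (\<lambda>x. wgrad \<Omega> u x - grad (\<phi> j) x)) \<longlonglongrightarrow> 0"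
    by (rule Lim_null_comparison[OF _ lim]) (auto simp: L2_norm_nonneg intro!: eventuallyI real_le_rsqrt)
  have conv: "(\<lambda>j. face_mean T P (\<phi> j) (grad (\<phi> j))) \<longlonglongrightarrow> face_mean T P u (wgrad \<Omega> u)" if tm: "T \<in> \<T>"
      for T P
  proof -
    interpret S: full_simplex "vertices T" T by (rule simplex_mesh[OF tm])
    have Lp: "(\<lambda>_. 1 :: real) \<in> L2 (interior T)" "(\<lambda>x. x - P) \<in> L2 (interior T)"
      by (rule S.continuous_L2; intro continuous_intros)+
    note s = domain_sets interior_sets interior_in_domain[OF tm]
    \<comment> \<open>Both integrals become inner products with a fixed function, the constant 1 or
      \<open>x - P\<close>; in this form L2 convergence applies.\<close>
    have split: "face_mean T P f g = (real DIM('a) * (LINT x|lebesgue_on (interior T). f x \<bullet> 1)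
        + (LINT x|lebesgue_on (interior T). g x \<bullet> (x - P))) / (real DIM('a) * S.vol)"
      if "f \<in> L2 \<Omega>" "g \<in> L2 \<Omega>" for f g
      using S.face_mean_integrable[OF L2_interior[OF that(1) tm] L2_interior[OF that(2) tm]]
      by (simp add: face_mean_def)
    have "S.vol \<noteq> 0" using S.vol_pos by simp
    then show ?thesis
      unfolding split[OF L(1,2)] split[OF test_function_L2(1)[OF \<phi> domain_sets]
          test_function_L2(2)[OF \<phi> domain_sets]]
      by (intro tendsto_intros L2_integral_tendsto[OF L(1) test_function_L2(1)[OF \<phi> domain_sets] s
          Lp(1) lim1]
          L2_integral_tendsto[OF L(2) test_function_L2(2)[OF \<phi> domain_sets] s Lp(2) lim2]) auto
  qed
  have m: "matched (\<phi> j) (grad (\<phi> j))" for j by (rule test_function_matched[OF \<phi>])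
  show ?thesis
    unfolding matched_def
  proof (intro conjI ballI impI)
    fix T P assume T: "T \<in> \<T>" "P \<in> vertices T"
    { assume F: "convex hull (vertices T - {P}) \<subseteq> frontier \<Omega>"
      have "face_mean T P (\<phi> j) (grad (\<phi> j)) = 0" for j using m[of j] T F unfolding matched_def by blast
      then show "face_mean T P u (wgrad \<Omega> u) = 0" using LIMSEQ_unique[OF conv[OF T(1), of P]] by simp
    next
      fix T' P' assume T': "T' \<in> \<T>" "P' \<in> vertices T'"
        and eq: "convex hull (vertices T - {P}) = convex hull (vertices T' - {P'})"
      have "face_mean T P (\<phi> j) (grad (\<phi> j)) = face_mean T' P' (\<phi> j) (grad (\<phi> j))" for j
        using m[of j] T T' eq unfolding matched_def by blast
      then show "face_mean T P u (wgrad \<Omega> u) = face_mean T' P' u (wgrad \<Omega> u)"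
        using LIMSEQ_unique[OF conv[OF T(1), of P]] conv[OF T'(1), of P'] by simp
    }
  qed
qed

text \<open>The affine part takes the facet means as values at the facet barycenters, and
  \<open>matched\<close> makes it a Crouzeix-Raviart function. Bubbles then correct the volume means
  without disturbing the facet means.\<close>

lemma interpolation:
  assumes u: "u \<in> L2 \<Omega>" and g: "g \<in> L2 \<Omega>" and m: "matched u g"
  obtains w where "w \<in> eCR0 \<Omega> \<T>"
    "\<And>T. T \<in> \<T> \<Longrightarrow> (LINT x|lebesgue_on (interior T). u x - w x) = 0"
    "\<And>T. T \<in> \<T> \<Longrightarrow> (LINT x|lebesgue_on (interior T). g x - grad w x) = 0"
    "\<And>T. T \<in> \<T> \<Longrightarrow> (LINT x|lebesgue_on (interior T). (g x - grad w x) \<bullet> x) = 0"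
proof -
  let ?n = "real DIM('a)"
  \<comment> \<open>The facet means are the coefficients of the basis functions
    \<open>1 - n * bary\<close>, split here into gradient and constant.\<close>
  define a where "a T = - ?n *\<^sub>R (\<Sum>Q\<in>vertices T. face_mean T Q u g *\<^sub>R bary_grad (vertices T) Q)" for T
  define c where "c T = (\<Sum>Q\<in>vertices T. face_mean T Q u g * (1 - ?n * bary_const (vertices T) Q))" for T
  have p: "a T \<bullet> x + c T = (\<Sum>Q\<in>vertices T. face_mean T Q u g * (1 - ?n * bary (vertices T) Q x))" for T x
    by (simp add: a_def c_def bary_def inner_sum_left sum_distrib_left sum_subtractf sum.distrib
        algebra_simps)
  have pmid: "a T \<bullet> mid (convex hull (vertices T - {P})) + c T = face_mean T P u g"
    if tm: "T \<in> \<T>" and P: "P \<in> vertices T" for T P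
  proof -
    interpret S: full_simplex "vertices T" T by (rule simplex_mesh[OF tm])
    have "a T \<bullet> mid (convex hull (vertices T - {P})) + c T = (\<Sum>Q\<in>vertices T. if Q
        = P then face_mean T Q u g else 0)"
      unfolding p using P by (intro sum.cong) (auto simp: S.bary_mid_facet)
    then show ?thesis using P S.finite_C by simp
  qed
  define v where "v x = (\<Sum>T\<in>\<T>. indicat_real (interior T) x *\<^sub>R (a T \<bullet> x + c T))" for x
  have vT: "v x = a T \<bullet> x + c T" if "T \<in> \<T>" "x \<in> interior T" for T x
    unfolding v_def by (rule sum_interior_indicator[OF that])
  have vCR: "v \<in> CR0 \<Omega> \<T>"
    unfolding CR0_iff
  proof (intro exI[of _ a] exI[of _ c] conjI ballI allI impI)
    show "v x = a T \<bullet> x + c T" if "T \<in> \<T>" "x \<in> interior T" for T x by (rule vT[OF that])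
    fix T F assume tm: "T \<in> \<T>" and F: "F facet_of T"
    obtain P where P: "P \<in> vertices T" "F = convex hull (vertices T - {P})"
      by (rule full_simplex.facet_obtain[OF simplex_mesh[OF tm] F])
    show "if F \<subseteq> frontier \<Omega> then a T \<bullet> mid F + c T = 0
         else \<forall>T'\<in>\<T>. F facet_of T' \<longrightarrow> a T \<bullet> mid F + c T = a T' \<bullet> mid F + c T'"
    proof (cases "F \<subseteq> frontier \<Omega>")
      case True
      have "a T \<bullet> mid F + c T = face_mean T P u g" unfolding P(2) by (rule pmid[OF tm P(1)])
      also have "\<dots> = 0" using m tm P True unfolding matched_def by blast
      finally show ?thesis using True by simp
    next
      case False
      have "a T \<bullet> mid F + c T = a T' \<bullet> mid F + c T'" if tm': "T' \<in> \<T>" and F': "F facet_of T'" for T'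
      proof -
        obtain P' where P': "P' \<in> vertices T'" "F = convex hull (vertices T' - {P'})"
          by (rule full_simplex.facet_obtain[OF simplex_mesh[OF tm'] F'])
        have "a T \<bullet> mid F + c T = face_mean T P u g" unfolding P(2) by (rule pmid[OF tm P(1)])
        also have "\<dots> = face_mean T' P' u g"
          using m tm P tm' P' unfolding matched_def by metis
        also have "\<dots> = a T' \<bullet> mid F + c T'" unfolding P'(2) by (rule pmid[OF tm' P'(1), symmetric])
        finally show ?thesis .
      qed
      then show ?thesis using False by simp
    qed
  qed
  \<comment> \<open>The bubble has mean 1, so its coefficient is the missing volume mean.\<close>
  define \<gamma> where "\<gamma> T = ((LINT x|lebesgue_on (interior T). u x) - (LINT x|lebesgue_on (interior
      T). a T \<bullet> x + c T)) / measure lebesgue T" for T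
  define w where "w x = v x + (\<Sum>T\<in>\<T>. \<gamma> T * bubble T x)" for x
  have wCR: "w \<in> eCR0 \<Omega> \<T>"
    unfolding eCR0_def bubble_space_def w_def[abs_def] using vCR
    by (intro CollectI exI[of _ v] exI[of _ "\<lambda>x. \<Sum>T\<in>\<T>. \<gamma> T * bubble T x"]) auto
  have main: "(LINT x|lebesgue_on (interior T). u x - w x) = 0 \<and>
     (LINT x|lebesgue_on (interior T). g x - grad w x) = 0 \<and>
     (LINT x|lebesgue_on (interior T). (g x - grad w x) \<bullet> x) = 0" if tm: "T \<in> \<T>" for T
  proof -
    interpret S: full_simplex "vertices T" T by (rule simplex_mesh[OF tm])
    let ?M = "lebesgue_on (interior T)"
    let ?G = "\<lambda>x. a T + \<gamma> T *\<^sub>R ((- 2 * S.bubble_coeff) *\<^sub>R (x - mid T))"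
    let ?f = "\<lambda>x. (a T \<bullet> x + c T) + \<gamma> T * S.bubble_poly x"
    have wT: "w x = ?f x" if "x \<in> interior T" for x
      unfolding w_def vT[OF tm that] bubble_sum_interior[OF tm that] ..
    have gw: "grad w x = ?G x" if "x \<in> interior T" for x
    proof (rule grad_eqI)
      have "(?f has_derivative (\<lambda>h. ?G x \<bullet> h)) (at x)"
        unfolding S.bubble_poly_def power2_norm_eq_inner
        by (auto intro!: derivative_eq_intros simp: inner_add_left inner_diff_left
            inner_diff_right inner_commute algebra_simps)
      then show "(w has_derivative (\<lambda>h. ?G x \<bullet> h)) (at x)"
        by (rule has_derivative_transform_within_open[OF _ open_interior that]) (simp add: wT)
    qed
    have wL: "w \<in> L2 (interior T)" "grad w \<in> L2 (interior T)" using eCR0_L2_local[OF wCR tm] by auto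
    have L: "(\<lambda>x. u x - w x) \<in> L2 (interior T)" "(\<lambda>x. g x - grad w x) \<in> L2 (interior T)"
      using L2_interior[OF u tm] L2_interior[OF g tm] wL by (auto intro: L2_diff)
    note iu = S.face_mean_integrable[OF L2_interior[OF u tm] L2_interior[OF g tm]]
    note iw = S.face_mean_integrable[OF wL]
    note iuw = S.face_mean_integrable[OF L]
    have cp: "continuous_on UNIV (\<lambda>x. a T \<bullet> x + c T)" by (intro continuous_intros)
    have cb: "continuous_on UNIV (\<lambda>x. \<gamma> T * S.bubble_poly x)" by (intro continuous_intros
        S.continuous_bubble)
    have cf: "continuous_on UNIV ?f" by (intro continuous_intros S.continuous_bubble)
    have cG: "continuous_on UNIV ?G" by (intro continuous_intros)
    have "(LINT x|?M. w x) = (LINT x|?M. ?f x)"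
      by (intro Bochner_Integration.integral_cong) (auto simp: wT)
    also have "\<dots> = (LINT x|?M. a T \<bullet> x + c T) + (LINT x|?M. \<gamma> T * S.bubble_poly x)"
      by (rule Bochner_Integration.integral_add[OF S.interior_integral(1)[OF cp]
          S.interior_integral(1)[OF cb]])
    also have "(LINT x|?M. \<gamma> T * S.bubble_poly x) = \<gamma> T * S.vol"
      by (simp add: S.interior_integral(2)[OF S.continuous_bubble] S.E_bubble)
    also have "\<dots> = (LINT x|?M. u x) - (LINT x|?M. a T \<bullet> x + c T)"
      using S.vol_pos by (simp add: \<gamma>_def)
    finally have "(LINT x|?M. w x) = (LINT x|?M. u x)" by simp
    then have i0: "(LINT x|?M. u x - w x) = 0" using iu(1) iw(1) by simp
    have fm: "face_mean T P w (grad w) = face_mean T P u g" if P: "P \<in> vertices T" for P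
    proof -
      have "face_mean T P w (grad w) = face_mean T P ?f ?G"
        unfolding face_mean_def by (intro arg_cong2[where f="(/)"]
            Bochner_Integration.integral_cong) (auto simp: wT gw)
      also have "\<dots> = S.face_functional P ?f ?G / (?n * S.vol)"
        by (rule S.face_mean_continuous[OF cf cG])
      also have "S.face_functional P ?f ?G = S.face_functional P (\<lambda>x. a T \<bullet> x + c T) (\<lambda>x. a T)
         + \<gamma> T * S.face_functional P S.bubble_poly (\<lambda>x. (- 2 * S.bubble_coeff) *\<^sub>R (x - mid T))"
        unfolding S.face_functional_def Bochner_Integration.integral_mult_right_zero[symmetric]
        by (subst Bochner_Integration.integral_add[symmetric])
           (auto intro!: S.integrable_T continuous_intros S.continuous_bubble
               Bochner_Integration.integral_cong
             simp: inner_add_left algebra_simps)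
      also have "\<dots> = ?n * S.vol * face_mean T P u g"
        by (simp only: S.face_functional_affine[OF P] S.face_functional_bubble pmid[OF tm P])
      finally show ?thesis using S.vol_pos by simp
    qed
    have i1: "(LINT x|?M. (g x - grad w x) \<bullet> (x - P)) = 0" if P: "P \<in> vertices T" for P
    proof -
      have "(LINT x|?M. ?n * u x + g x \<bullet> (x - P)) = (LINT x|?M. ?n * w x + grad w x \<bullet> (x - P))"
        using fm[OF P] S.vol_pos by (simp add: face_mean_def)
      then have "?n * (LINT x|?M. u x - w x) + (LINT x|?M. (g x - grad w x) \<bullet> (x - P)) = 0"
        using iu iw by (simp add: inner_diff_left right_diff_distrib)
      then show ?thesis using i0 by simp
    qed
    let ?y = "LINT x|?M. g x - grad w x" and ?s = "LINT x|?M. (g x - grad w x) \<bullet> x"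
    \<comment> \<open>The function taking \<open>P\<close> to \<open>?y \<bullet> P - ?s\<close> is
      affine and vanishes at all vertices, so \<open>?y\<close> and \<open>?s\<close> vanish
      separately.\<close>
    have ys: "?y \<bullet> P + 0 = 0 \<bullet> P + ?s" if P: "P \<in> vertices T" for P
    proof -
      have "(LINT x|?M. (g x - grad w x) \<bullet> (x - P)) = ?s - ?y \<bullet> P"
        using iuw by (simp add: inner_diff_right)
      then show ?thesis using i1[OF P] by simp
    qed
    have "?y = 0" by (rule affine_function_eqI(1)[OF S.interior_hull ys])
    moreover have "?s = 0" by (rule affine_function_eqI(2)[OF S.interior_hull ys, symmetric])
    ultimately show ?thesis using i0 by (intro conjI)
  qed
  show ?thesis using that[OF wCR] main by blast
qed

end

section \<open>The lower bound\<close>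

text \<open>\<open>poincare_constant\<close> refers to the chosen \<open>wgrad\<close> on the
  simplex. By uniqueness almost everywhere the estimate holds for any weak gradient, in particular
  for the restriction of the global one and for the classical gradient of a discrete
  function.\<close>

lemma poincare_constant_weak_gradient:
  fixes T :: "'a::euclidean_space set"
  assumes P: "poincare_constant C T" and C: "0 \<le> C * diameter T"
    and f: "f \<in> L2 (interior T)" and G: "G \<in> L2 (interior T)" and wg: "weak_gradient (interior T) f G"
  shows "(LINT x|lebesgue_on (interior T). (f x - (LINT y|lebesgue_on (interior T). f y) / measure
      lebesgue T)\<^sup>2)
     \<le> (C * diameter T)\<^sup>2 * (LINT x|lebesgue_on (interior T). (norm (G x))\<^sup>2)"
proof -
  let ?U = "interior T" and ?w = "wgrad (interior T) f"
  let ?m = "(LINT y|lebesgue_on (interior T). f y) / measure lebesgue T"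
  have "\<exists>g. g \<in> L2 ?U \<and> weak_gradient ?U f g" using G wg by blast
  from someI_ex[OF this] have w: "?w \<in> L2 ?U" "weak_gradient ?U f ?w"
    unfolding wgrad_def by simp_all
  have "AE x in lebesgue_on ?U. ?w x = G x"
    by (rule weak_gradient_unique[OF open_interior w(1) G w(2) wg])
  then have "(LINT x|lebesgue_on ?U. (norm (?w x))\<^sup>2) = (LINT x|lebesgue_on ?U. (norm (G x))\<^sup>2)"
    using L2_D(1)[OF w(1)] L2_D(1)[OF G] by (intro integral_cong_AE) auto
  then have n: "L2_norm ?U ?w = L2_norm ?U G" by (simp add: L2_norm_def)
  have "f \<in> H1 ?U" using f G wg by (auto simp: H1_def)
  then have "L2_norm ?U (\<lambda>x. f x - ?m) \<le> C * diameter T * L2_norm ?U ?w"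
    using P unfolding poincare_constant_def by blast
  then have "(L2_norm ?U (\<lambda>x. f x - ?m))\<^sup>2 \<le> (C * diameter T * L2_norm ?U G)\<^sup>2"
    unfolding n by (rule power_mono[OF _ L2_norm_nonneg])
  then show ?thesis by (simp add: L2_norm_square power_mult_distrib)
qed

context full_simplex
begin

lemma measure_interior_T [simp]: "measure (lebesgue_on (interior T)) (interior T) = vol"
proof -
  have "measure (lebesgue_on (interior T)) (interior T) = measure lebesgue (interior T)"
    by (simp add: measure_restrict_space)
  also have "\<dots> = vol"
    by (rule measure_interior[OF compact_imp_bounded[OF compact_T] negligible_convex_frontier[OF
        convex_T]])
  finally show ?thesis .
qed

text \<open>With \<open>m\<close> the common mean of \<open>u\<close> and \<open>w\<close>,
  \<open>M\<close> is the squared norm of \<open>m\<close>, \<open>N\<close> and \<open>R\<close>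
  are those of \<open>u - m\<close> and \<open>w - m\<close>, and \<beta> is that of
  \<open>g - G\<close>. The Poincare inequality is applied to \<open>u\<close>, \<open>w\<close> and
  \<open>u - w\<close>.\<close>

lemma local_estimate:
  fixes u w :: "'a \<Rightarrow> real" and g G :: "'a \<Rightarrow> 'a"
  assumes P: "poincare_constant Cp T" and Cp: "Cp > 0"
    and L: "u \<in> L2 (interior T)" "w \<in> L2 (interior T)" "g \<in> L2 (interior T)" "G \<in> L2 (interior T)"
    and wg: "weak_gradient (interior T) u g" "weak_gradient (interior T) w G"
    and mean: "(LINT x|lebesgue_on (interior T). u x - w x) = 0"
    and orth: "(LINT x|lebesgue_on (interior T). (g x - G x) \<bullet> G x) = 0"
  shows "\<exists>M N R \<beta>. 0 \<le> M \<and> 0 \<le> N \<and> 0 \<le> R \<and> 0 \<le> \<beta> \<and>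
     (LINT x|lebesgue_on (interior T). u x * u x) = M + N \<and>
     (LINT x|lebesgue_on (interior T). w x * w x) = M + R \<and>
     (LINT x|lebesgue_on (interior T). g x \<bullet> g x) = (LINT x|lebesgue_on (interior T). G x \<bullet> G x) + \<beta> \<and>
     N \<le> (Cp * diameter T)\<^sup>2 * ((LINT x|lebesgue_on (interior T). G x \<bullet> G x) + \<beta>) \<and>
     R \<le> (Cp * diameter T)\<^sup>2 * (LINT x|lebesgue_on (interior T). G x \<bullet> G x) \<and>
     (\<forall>\<theta>. 0 < \<theta> \<longrightarrow> \<theta> \<le> 1 \<longrightarrow> N - R \<le> \<theta> * N + (1 / \<theta> - 1) * ((Cp * diameter T)\<^sup>2 * \<beta>))"
proof -
  let ?I = "\<lambda>f :: 'a \<Rightarrow> real. LINT x|lebesgue_on (interior T). f x"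
  let ?K = "(Cp * diameter T)\<^sup>2"
  define m where "m = ?I u / vol"
  have C0: "0 \<le> Cp * diameter T" using Cp diameter_ge_0[OF compact_imp_bounded[OF compact_T]] by simp
  note iu = face_mean_integrable(1)[OF L(1,3)] and iw = face_mean_integrable(1)[OF L(2,4)]
  have Iu: "?I u = m * vol" using vol_pos by (simp add: m_def)
  have Iw: "?I w = m * vol" using mean iu iw Iu by simp
  have c: "(\<lambda>_. m) \<in> L2 (interior T)" by (rule continuous_L2) simp
  have ic: "integrable (lebesgue_on (interior T)) (\<lambda>x. k :: real)" for k
    by (rule interior_integral(1)) simp
  have sq: "?I (\<lambda>x. f x * f x) = vol * m\<^sup>2 + ?I (\<lambda>x. (f x - m)\<^sup>2)"
    if "f \<in> L2 (interior T)" "?I f = m * vol" "integrable (lebesgue_on (interior T)) f" for f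
  proof -
    have i2: "integrable (lebesgue_on (interior T)) (\<lambda>x. f x * f x)" by (rule
        L2_integrable_mult[OF that(1,1)])
    have "(\<lambda>x. (f x - m)\<^sup>2) = (\<lambda>x. f x * f x - 2 * m * f x + m\<^sup>2)"
      by (simp add: power2_eq_square algebra_simps)
    then have "?I (\<lambda>x. (f x - m)\<^sup>2) = ?I (\<lambda>x. f x * f x) - 2 * m * ?I f + vol * m\<^sup>2"
      using i2 that(3) ic by simp
    then show ?thesis using that(2) by (simp add: power2_eq_square)
  qed
  define M where "M = vol * m\<^sup>2"
  define N where "N = ?I (\<lambda>x. (u x - m)\<^sup>2)"
  define R where "R = ?I (\<lambda>x. (w x - m)\<^sup>2)"
  define W where "W = ?I (\<lambda>x. (u x - w x)\<^sup>2)"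
  define \<beta> where "\<beta> = ?I (\<lambda>x. (g x - G x) \<bullet> (g x - G x))"
  let ?\<alpha> = "?I (\<lambda>x. G x \<bullet> G x)"
  have gg: "?I (\<lambda>x. g x \<bullet> g x) = ?\<alpha> + \<beta>"
  proof -
    have i: "integrable (lebesgue_on (interior T)) (\<lambda>x. (g x - G x) \<bullet> (g x - G x))"
      "integrable (lebesgue_on (interior T)) (\<lambda>x. (g x - G x) \<bullet> G x)"
      "integrable (lebesgue_on (interior T)) (\<lambda>x. G x \<bullet> G x)"
      by (intro L2_integrable_inner L2_diff L)+
    have "(\<lambda>x. g x \<bullet> g x) = (\<lambda>x. (g x - G x) \<bullet> (g x - G x) + 2 * ((g x - G x) \<bullet> G x) + G x \<bullet> G x)"
      by (simp add: inner_diff_left inner_diff_right inner_commute)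
    then have "?I (\<lambda>x. g x \<bullet> g x) = \<beta> + 2 * ?I (\<lambda>x. (g x - G x) \<bullet> G x) + ?\<alpha>"
      using i by (simp only: \<beta>_def) simp
    then show ?thesis using orth by simp
  qed
  have N: "N \<le> ?K * (?\<alpha> + \<beta>)"
    using poincare_constant_weak_gradient[OF P C0 L(1) L(3) wg(1)] gg
    by (simp add: N_def m_def power2_norm_eq_inner)
  have R: "R \<le> ?K * ?\<alpha>"
    using poincare_constant_weak_gradient[OF P C0 L(2) L(4) wg(2)] Iw vol_pos
    by (simp add: R_def power2_norm_eq_inner)
  \<comment> \<open>The difference is presented to \<open>weak_gradient_linear\<close> as a
    combination indexed by the two truth values.\<close>
  have wgd: "weak_gradient (interior T) (\<lambda>x. u x - w x) (\<lambda>x. g x - G x)"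
  proof -
    have "weak_gradient (interior T) (\<lambda>x. \<Sum>i\<in>{True, False}. (if i then 1 else -1) * (if i then u
        else w) x)
        (\<lambda>x. \<Sum>i\<in>{True, False}. (if i then 1 else -1) *\<^sub>R (if i then g else G) x)"
      by (rule weak_gradient_linear) (use L wg in auto)
    then show ?thesis by simp
  qed
  have W: "W \<le> ?K * \<beta>"
    using poincare_constant_weak_gradient[OF P C0 L2_diff[OF L(1,2)] L2_diff[OF L(3,4)] wgd]
    unfolding mean by (simp add: W_def \<beta>_def power2_norm_eq_inner)
  have NR: "N - R \<le> \<theta> * N + (1 / \<theta> - 1) * (?K * \<beta>)" if \<theta>: "0 < \<theta>" "\<theta> \<le> 1" for \<theta>
  proof -
    have L': "(\<lambda>x. u x - m) \<in> L2 (interior T)" "(\<lambda>x. w x - m) \<in> L2 (interior T)" "(\<lambda>x. u x - w x)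
        \<in> L2 (interior T)"
      by (intro L2_diff L c)+
    note i = L2_D(2)[OF L'(1), simplified] L2_D(2)[OF L'(2), simplified] L2_D(2)[OF L'(3), simplified]
    \<comment> \<open>Completing the square, with \<open>a = u - m\<close> and
      \<open>b = u - w\<close>, so that \<open>a - b = w - m\<close>. The parameter \<theta> trades
      the fluctuation of \<open>u\<close> against the interpolation error.\<close>
    have pt: "a\<^sup>2 - (a - b)\<^sup>2 \<le> \<theta> * a\<^sup>2 + (1 / \<theta> - 1) * b\<^sup>2" for a b :: real
    proof -
      have "0 \<le> \<theta> * (a - b / \<theta>)\<^sup>2" using \<theta> by simp
      also have "\<dots> = \<theta> * a\<^sup>2 + (1 / \<theta> - 1) * b\<^sup>2 - (a\<^sup>2 - (a - b)\<^sup>2)"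
        using \<theta> by (simp add: power2_eq_square divide_simps) (simp add: algebra_simps)
      finally show ?thesis by simp
    qed
    have "?I (\<lambda>x. (u x - m)\<^sup>2 - (w x - m)\<^sup>2) \<le> ?I (\<lambda>x. \<theta> * (u x - m)\<^sup>2 + (1 / \<theta> - 1) * (u x - w x)\<^sup>2)"
    proof (rule integral_mono)
      show "(u x - m)\<^sup>2 - (w x - m)\<^sup>2 \<le> \<theta> * (u x - m)\<^sup>2 + (1 / \<theta> - 1) * (u x - w x)\<^sup>2" for x
        using pt[of "u x - m" "u x - w x"] by simp
    qed (use i in auto)
    then have "N - R \<le> \<theta> * N + (1 / \<theta> - 1) * W"
      using i by (simp add: N_def R_def W_def)
    also have "\<dots> \<le> \<theta> * N + (1 / \<theta> - 1) * (?K * \<beta>)"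
      using W \<theta> by (intro add_left_mono mult_left_mono) auto
    finally show ?thesis .
  qed
  show ?thesis
  proof (intro exI conjI)
    show "0 \<le> M" using vol_pos by (simp add: M_def)
    show "0 \<le> N" "0 \<le> R" unfolding N_def R_def by (intro Bochner_Integration.integral_nonneg; simp)+
    show "0 \<le> \<beta>" unfolding \<beta>_def by (intro Bochner_Integration.integral_nonneg) simp
    show "?I (\<lambda>x. u x * u x) = M + N" unfolding M_def N_def by (rule sq[OF L(1) Iu iu])
    show "?I (\<lambda>x. w x * w x) = M + R" unfolding M_def R_def by (rule sq[OF L(2) Iw iw])
    show "?I (\<lambda>x. g x \<bullet> g x) = ?\<alpha> + \<beta>" by (rule gg)
    show "\<forall>\<theta>. 0 < \<theta> \<longrightarrow> \<theta> \<le> 1 \<longrightarrow> N - R \<le> \<theta> * N + (1 / \<theta> - 1) * (?K * \<beta>)" using NR by blast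
  qed (rule N, rule R)
qed

end

section \<open>The bound as an inequality between real numbers\<close>

lemma GLB_real_eq:
  assumes "t > 0" "\<epsilon> > 0" "\<delta> \<ge> 0"
  shows "GLB_real \<epsilon> \<delta> t = 1 / ((1 + \<delta>) / t + \<epsilon>\<^sup>2 / ((1 + \<delta>) / t + \<epsilon>))"
proof -
  have *: "1 + \<delta> + \<epsilon> * t > 0" using assms by (simp add: add_pos_pos)
  \<comment> \<open>Dividing by \<open>t\<close> leaves \<open>(1 + \<delta>) / t\<close> as the
    only place where \<open>t\<close> occurs. This shape matches the final constant of the estimate
    and exhibits the limit for large \<open>t\<close>.\<close>
  have e: "(1 + \<delta>) / t + \<epsilon> = (1 + \<delta> + \<epsilon> * t) / t" using assms by (simp add: divide_simps)
  have "\<epsilon>\<^sup>2 / ((1 + \<delta>) / t + \<epsilon>) = (\<epsilon>\<^sup>2 * t\<^sup>2 / (1 + \<delta> + \<epsilon> * t)) / t"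
    unfolding e using assms(1) * by (simp add: power2_eq_square)
  then have "(1 + \<delta>) / t + \<epsilon>\<^sup>2 / ((1 + \<delta>) / t + \<epsilon>) = (1 + \<delta> + \<epsilon>\<^sup>2 * t\<^sup>2 / (1 + \<delta> + \<epsilon> * t)) / t"
    by (simp only: add_divide_distrib[of "1 + \<delta>" _ t])
  then show ?thesis by (simp add: GLB_real_def)
qed

text \<open>The limit exists and equals \<open>1 / \<epsilon>\<close>, so \<open>Lim\<close> denotes
  it and inherits upper bounds. It serves the indices beyond the discrete dimension.\<close>

lemma Lim_GLB_real_le:
  assumes "\<epsilon> > 0" "\<delta> \<ge> 0" "\<And>t. t > 0 \<Longrightarrow> GLB_real \<epsilon> \<delta> t \<le> \<mu>"
  shows "Lim at_top (GLB_real \<epsilon> \<delta>) \<le> \<mu>"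
proof -
  have l: "((\<lambda>t::real. (1 + \<delta>) / t) \<longlongrightarrow> 0) at_top"
    by (rule tendsto_divide_0[OF tendsto_const]) (simp add: filterlim_at_top_imp_at_infinity
        filterlim_ident)
  have "((\<lambda>t. 1 / ((1 + \<delta>) / t + \<epsilon>\<^sup>2 / ((1 + \<delta>) / t + \<epsilon>))) \<longlongrightarrow> 1 / (0 + \<epsilon>\<^sup>2 / (0 + \<epsilon>))) at_top"
    by (intro tendsto_intros l) (use assms in auto)
  then have "(GLB_real \<epsilon> \<delta> \<longlongrightarrow> 1 / (0 + \<epsilon>\<^sup>2 / (0 + \<epsilon>))) at_top"
    by (rule Lim_transform_eventually)
       (use GLB_real_eq[OF _ assms(1,2)] in \<open>auto intro: eventually_mono[OF eventually_gt_at_top[of 0]]\<close>)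
  moreover from this have "1 / (0 + \<epsilon>\<^sup>2 / (0 + \<epsilon>)) \<le> \<mu>"
    by (rule tendsto_upperbound) (use assms(3) in \<open>auto intro: eventually_mono[OF
        eventually_gt_at_top[of 0]]\<close>)
  ultimately show ?thesis using tendsto_Lim[of at_top "GLB_real \<epsilon> \<delta>"] by simp
qed

text \<open>What remains when integrals are replaced by one number per simplex, named as in
  \<open>local_estimate\<close>; \<alpha> is the squared gradient norm of the interpolant and
  \<open>K\<close> the squared Poincare factor. \<open>exact\<close> bounds the Rayleigh quotient of
  \<open>u\<close> from above, \<open>discrete\<close> that of the interpolant from below.\<close>

lemma GLB_real_le_from_local_estimates:
  fixes V K M N R \<alpha> \<beta> :: "'i \<Rightarrow> real"
  assumes V: "\<And>T. T \<in> S \<Longrightarrow> 0 \<le> V T" and K: "\<And>T. T \<in> S \<Longrightarrow> 0 \<le> K T"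
    and K\<epsilon>: "\<And>T. T \<in> S \<Longrightarrow> K T \<le> \<epsilon>" and K\<delta>: "\<And>T. T \<in> S \<Longrightarrow> K T * V T \<le> \<delta>"
    and \<epsilon>: "\<epsilon> > 0" and \<delta>: "\<delta> \<ge> 0" and t: "t > 0"
    and nn: "\<And>T. T \<in> S \<Longrightarrow> 0 \<le> M T \<and> 0 \<le> N T \<and> 0 \<le> R T \<and> 0 \<le> \<alpha> T \<and> 0 \<le> \<beta> T"
    and N: "\<And>T. T \<in> S \<Longrightarrow> N T \<le> K T * (\<alpha> T + \<beta> T)" and R: "\<And>T. T \<in> S \<Longrightarrow> R T \<le> K T * \<alpha> T"
    and NR: "\<And>T \<theta>. T \<in> S \<Longrightarrow> 0 < \<theta> \<Longrightarrow> \<theta> \<le> 1 \<Longrightarrow> N T - R T \<le> \<theta> * N T + (1 / \<theta> - 1) * (K T * \<beta> T)"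
    and exact: "(\<Sum>T\<in>S. \<alpha> T + \<beta> T) + (\<Sum>T\<in>S. V T * (M T + N T)) \<le> \<mu> * (\<Sum>T\<in>S. M T + N T)"
    and discrete: "t * (\<Sum>T\<in>S. M T + R T) \<le> (\<Sum>T\<in>S. \<alpha> T) + (\<Sum>T\<in>S. V T * (M T + R T))"
    and pos: "(\<Sum>T\<in>S. M T + N T) > 0"
  shows "GLB_real \<epsilon> \<delta> t \<le> \<mu>"
proof -
  define A where "A = t / (1 + \<delta>)"
  define x where "x = \<epsilon> * A"
  \<comment> \<open>Chosen so that \<open>1 / \<theta> - 1 = 1 / (\<epsilon> * A)\<close>. Then
    \<open>q\<close> is multiplied by \<open>\<theta> * \<epsilon> + 1 / A\<close>, exactly as
    \<open>p\<close> is, and the two terms combine to a multiple of \<open>p + q\<close>.\<close>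
  define \<theta> where "\<theta> = x / (1 + x)"
  define p where "p = (\<Sum>T\<in>S. \<alpha> T) + (\<Sum>T\<in>S. V T * M T)"
  define q where "q = (\<Sum>T\<in>S. \<beta> T)"
  have A: "A > 0" using t \<delta> by (simp add: A_def)
  have x: "x > 0" using A \<epsilon> by (simp add: x_def)
  have \<theta>: "0 < \<theta>" "\<theta> \<le> 1" "1 / \<theta> - 1 = 1 / x" using x by (auto simp: \<theta>_def divide_simps)
  have sV: "0 \<le> (\<Sum>T\<in>S. V T * M T)" "0 \<le> (\<Sum>T\<in>S. V T * N T)"
    using V nn by (auto intro!: sum_nonneg mult_nonneg_nonneg)
  \<comment> \<open>The potential energy of the fluctuation of the interpolant is charged to its
    gradient by the Poincare inequality; \<delta> enters here, and with it the denominator of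
    \<open>A\<close>.\<close>
  have "(\<Sum>T\<in>S. V T * R T) \<le> (\<Sum>T\<in>S. \<delta> * \<alpha> T)"
  proof (rule sum_mono)
    fix T assume T: "T \<in> S"
    have "V T * R T \<le> V T * (K T * \<alpha> T)" by (rule mult_left_mono[OF R[OF T] V[OF T]])
    also have "\<dots> = (K T * V T) * \<alpha> T" by simp
    also have "\<dots> \<le> \<delta> * \<alpha> T" using K\<delta>[OF T] nn[OF T] by (intro mult_right_mono) auto
    finally show "V T * R T \<le> \<delta> * \<alpha> T" .
  qed
  then have "t * (\<Sum>T\<in>S. M T + R T) \<le> (1 + \<delta>) * (\<Sum>T\<in>S. \<alpha> T) + (\<Sum>T\<in>S. V T * M T)"
    using discrete by (simp add: distrib_left sum.distrib sum_distrib_left distrib_right)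
  \<comment> \<open>Enlarging the potential term by the same factor keeps \<open>p\<close> in one
    piece.\<close>
  also have "\<dots> \<le> (1 + \<delta>) * p"
    using sV(1) \<delta> mult_nonneg_nonneg[OF \<delta> sV(1)] by (simp add: p_def algebra_simps)
  finally have MR: "(\<Sum>T\<in>S. M T + R T) \<le> p / A"
    using t \<delta> by (simp add: A_def divide_simps mult.commute)
  have "(\<Sum>T\<in>S. N T) \<le> (\<Sum>T\<in>S. \<epsilon> * (\<alpha> T + \<beta> T))"
  proof (rule sum_mono)
    fix T assume T: "T \<in> S"
    show "N T \<le> \<epsilon> * (\<alpha> T + \<beta> T)"
      using order_trans[OF N[OF T] mult_right_mono[OF K\<epsilon>[OF T]]] nn[OF T] by simp
  qed
  also have "\<dots> \<le> \<epsilon> * (p + q)"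
    unfolding sum_distrib_left[symmetric] using sV(1) \<epsilon>
    by (intro mult_left_mono) (auto simp: p_def q_def sum.distrib)
  finally have Ns: "(\<Sum>T\<in>S. N T) \<le> \<epsilon> * (p + q)" .
  have "(\<Sum>T\<in>S. N T - R T) \<le> (\<Sum>T\<in>S. \<theta> * N T + (1 / x) * (\<epsilon> * \<beta> T))"
  proof (rule sum_mono)
    fix T assume T: "T \<in> S"
    have "N T - R T \<le> \<theta> * N T + (1 / x) * (K T * \<beta> T)" using NR[OF T \<theta>(1,2)] unfolding \<theta>(3) .
    also have "\<dots> \<le> \<theta> * N T + (1 / x) * (\<epsilon> * \<beta> T)"
      using K\<epsilon>[OF T] nn[OF T] x by (intro add_left_mono mult_left_mono mult_right_mono) auto
    finally show "N T - R T \<le> \<theta> * N T + (1 / x) * (\<epsilon> * \<beta> T)" .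
  qed
  also have "\<dots> = \<theta> * (\<Sum>T\<in>S. N T) + q / A"
    using \<epsilon> A by (simp add: sum.distrib sum_distrib_left q_def x_def sum_divide_distrib)
  also have "\<dots> \<le> \<theta> * (\<epsilon> * (p + q)) + q / A"
    using Ns \<theta> by (intro add_right_mono mult_left_mono) auto
  finally have NRs: "(\<Sum>T\<in>S. N T - R T) \<le> \<theta> * (\<epsilon> * (p + q)) + q / A" .
  define Z where "Z = 1 / A + \<theta> * \<epsilon>"
  have Z: "Z > 0" using A \<theta> \<epsilon> by (simp add: Z_def add_pos_pos)
  let ?U = "\<Sum>T\<in>S. M T + N T"
  have "?U = (\<Sum>T\<in>S. M T + R T) + (\<Sum>T\<in>S. N T - R T)"
    by (simp add: sum.distrib[symmetric])
  also have "\<dots> \<le> (p + q) * Z"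
    using MR NRs by (simp add: Z_def algebra_simps add_divide_distrib)
  also have "\<dots> \<le> (\<mu> * ?U) * Z"
  proof (rule mult_right_mono)
    \<comment> \<open>The potential energy of the fluctuation of \<open>u\<close> is nonnegative and
      is dropped.\<close>
    show "p + q \<le> \<mu> * ?U"
      using exact sV(2) by (simp add: p_def q_def sum.distrib distrib_left)
  qed (use Z in simp)
  finally have "1 * ?U \<le> (\<mu> * Z) * ?U" by (simp add: ac_simps)
  then have "1 \<le> \<mu> * Z" using pos by (simp add: mult_le_cancel_right)
  then have "1 / Z \<le> \<mu>" using Z by (simp add: divide_simps mult.commute)
  moreover have "Z = (1 + \<delta>) / t + \<epsilon>\<^sup>2 / ((1 + \<delta>) / t + \<epsilon>)"
  proof -
    have "1 / A = (1 + \<delta>) / t" by (simp add: A_def)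
    moreover have "\<theta> = \<epsilon> / (1 / A + \<epsilon>)" using A \<epsilon> by (simp add: \<theta>_def x_def divide_simps mult.commute)
    ultimately show ?thesis by (simp add: Z_def power2_eq_square)
  qed
  ultimately show ?thesis using GLB_real_eq[OF t \<epsilon> \<delta>] by simp
qed

section \<open>Essential bounds and the mesh size\<close>

lemma (in full_simplex) AE_interior_obtain:
  assumes "AE x in lebesgue_on (interior T). P x"
  obtains x where "x \<in> interior T" "P x"
proof -
  have "\<not> (AE x in lebesgue_on (interior T). False)"
  proof
    assume "AE x in lebesgue_on (interior T). False"
    then have "emeasure (lebesgue_on (interior T)) (space (lebesgue_on (interior T))) = 0"
      by (simp add: AE_iff_null null_sets_def)
    then have "vol = 0" using measure_interior_T by (simp add: measure_def)
    then show False using vol_pos by simp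
  qed
  moreover have "AE x in lebesgue_on (interior T). False" if no: "\<And>x. x \<in> interior T \<Longrightarrow> \<not> P x"
    using assms AE_space by eventually_elim (use no in auto)
  ultimately show ?thesis using that by blast
qed

context mesh
begin

text \<open>An open simplex has positive measure, so the essential bound holds at one of its points.
  The bound \<open>B\<close> makes the essential supremum finite: \<open>real_of_ereal\<close> would
  turn an infinite one into 0.\<close>

lemma piecewise_constant_le_Linfty_norm:
  assumes f: "f \<in> borel_measurable (lebesgue_on \<Omega>)" and B: "AE x in lebesgue_on \<Omega>. \<bar>f x\<bar> \<le> B"
    and tm: "T \<in> \<T>" and c: "\<And>x. x \<in> interior T \<Longrightarrow> f x = c"
  shows "\<bar>c\<bar> \<le> Linfty_norm \<Omega> f"
proof -
  let ?s = "esssup (lebesgue_on \<Omega>) (\<lambda>x. ereal \<bar>f x\<bar>)"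
  have "?s \<le> ereal B" by (rule esssup_I) (use f B in auto)
  have "AE x in lebesgue_on (interior T). ereal \<bar>f x\<bar> \<le> ?s"
    by (rule AE_split[OF esssup_AE tm])
  then obtain x where "x \<in> interior T" "ereal \<bar>f x\<bar> \<le> ?s"
    by (rule full_simplex.AE_interior_obtain[OF simplex_mesh[OF tm]])
  then have "ereal \<bar>c\<bar> \<le> ?s" using c by simp
  moreover obtain r where "?s = ereal r"
    using \<open>?s \<le> ereal B\<close> \<open>ereal \<bar>c\<bar> \<le> ?s\<close> by (cases ?s) auto
  ultimately show ?thesis by (simp add: Linfty_norm_def)
qed

lemma mesh_size_interior: "T \<in> \<T> \<Longrightarrow> x \<in> interior T \<Longrightarrow> mesh_size \<T> x = diameter T"
  using sum_interior_indicator[of T x diameter] by (simp add: mesh_size_def mult.commute)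

lemma diameter_mesh_pos: "T \<in> \<T> \<Longrightarrow> 0 < diameter T"
proof -
  assume tm: "T \<in> \<T>"
  interpret S: full_simplex "vertices T" T by (rule simplex_mesh[OF tm])
  obtain P where P: "P \<in> vertices T" using S.card_C by fastforce
  obtain Q where Q: "Q \<in> vertices T" "Q \<noteq> P" using S.facet_ne[OF P] by blast
  have "dist P Q \<le> diameter T"
    using S.C_sub_T P Q by (intro diameter_bounded_bound compact_imp_bounded S.compact_T) auto
  then show ?thesis using Q(2) by (smt (verit) zero_less_dist_iff)
qed

lemma mesh_nonempty: "\<T> \<noteq> {}"
proof
  assume "\<T> = {}"
  then have "closure \<Omega> = {}" using mesh by (simp add: triangulation_of_def)
  then show False using domain by (simp add: polyhedral_lipschitz_domain_def)
qed

lemma mesh_size_measurable: "mesh_size \<T> \<in> borel_measurable (lebesgue_on \<Omega>)"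
  unfolding mesh_size_def[abs_def]
  by (intro borel_measurable_sum borel_measurable_times borel_measurable_const
      measurable_restrict_space1 borel_measurable_indicator interior_sets)

lemma mesh_size_bounds: "0 \<le> mesh_size \<T> x" "mesh_size \<T> x \<le> (\<Sum>T\<in>\<T>. diameter T)"
  unfolding mesh_size_def using diameter_mesh_pos
  by (auto intro!: sum_nonneg sum_mono simp: indicator_def less_imp_le)

end

locale eCR_setting = mesh \<Omega> \<T> for \<Omega> :: "'a::euclidean_space set" and \<T> :: "'a set set" +
  fixes V :: "'a \<Rightarrow> real" and c :: "'a set \<Rightarrow> real"
  assumes V_Linfty: "V \<in> Linfty \<Omega>" and V_piece: "\<And>T x. T \<in> \<T> \<Longrightarrow> x \<in> interior T \<Longrightarrow> V x = c T"
    and c_nonneg: "\<And>T. T \<in> \<T> \<Longrightarrow> 0 \<le> c T"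
begin

lemma V_bounded: obtains B where "0 \<le> B" "AE x in lebesgue_on \<Omega>. \<bar>V x\<bar> \<le> B"
proof -
  let ?s = "esssup (lebesgue_on \<Omega>) (\<lambda>x. ereal \<bar>V x\<bar>)"
  have fin: "?s < \<infinity>" using V_Linfty by (simp add: Linfty_def)
  then obtain B where B: "?s \<le> ereal B" by (cases ?s) auto
  have "AE x in lebesgue_on \<Omega>. \<bar>V x\<bar> \<le> max B 0"
    using esssup_AE[of "\<lambda>x. ereal \<bar>V x\<bar>" "lebesgue_on \<Omega>"]
  proof eventually_elim
    case (elim x)
    then have "ereal \<bar>V x\<bar> \<le> ereal B" using B by (rule order_trans)
    then show ?case by simp
  qed
  then show ?thesis using that[of "max B 0"] by simp
qed

text \<open>Piecewise constancy of the potential enters here: on each simplex its energy is a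
  multiple of the inner product, so it splits into means and fluctuations as the squared norm
  does.\<close>

lemma V_integral:
  assumes "u \<in> L2 \<Omega>" "v \<in> L2 \<Omega>"
  shows "integrable (lebesgue_on \<Omega>) (\<lambda>x. V x * u x * v x)"
    "(LINT x|lebesgue_on \<Omega>. V x * u x * v x) = (\<Sum>T\<in>\<T>. c T * (LINT x|lebesgue_on (interior T). u x
        * v x))"
proof -
  have cong: "integrable (lebesgue_on (interior T)) (\<lambda>x. V x * u x * v x)
      \<longleftrightarrow> integrable (lebesgue_on (interior T)) (\<lambda>x. c T * (u x * v x))"
    "(LINT x|lebesgue_on (interior T). V x * u x * v x) = (LINT x|lebesgue_on (interior T). c T *
        (u x * v x))"
    if "T \<in> \<T>" for T
    by (intro Bochner_Integration.integrable_cong Bochner_Integration.integral_cong refl; simp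
        add: V_piece[OF that])+
  have i: "integrable (lebesgue_on (interior T)) (\<lambda>x. V x * u x * v x)" if "T \<in> \<T>" for T
    unfolding cong(1)[OF that]
    using L2_integrable_mult[OF L2_interior[OF assms(1) that] L2_interior[OF assms(2) that]] by simp
  show "integrable (lebesgue_on \<Omega>) (\<lambda>x. V x * u x * v x)" by (rule integral_split(1)[OF i])
  show "(LINT x|lebesgue_on \<Omega>. V x * u x * v x) = (\<Sum>T\<in>\<T>. c T * (LINT x|lebesgue_on (interior T). u
      x * v x))"
    using integral_split(2)[OF i] by (simp add: cong(2))
qed

abbreviation "a_exact \<equiv> schroedinger_form \<Omega> V"
abbreviation "a_pw \<equiv> pw_schroedinger_form \<Omega> \<T> V"

lemma a_exact_sym: "a_exact u v = a_exact v u"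
  unfolding schroedinger_form_def by (simp add: inner_commute mult.assoc mult.commute mult.left_commute)

lemma a_pw_sym: "a_pw u v = a_pw v u"
  unfolding pw_schroedinger_form_def by (simp add: inner_commute mult.assoc mult.commute
      mult.left_commute)

text \<open>\<open>wgrad\<close> is a choice, so its value at a combination need not be the
  combination of its values. Expanding bilinearly in the eigenfunctions allows the combined gradient
  to be used directly.\<close>

lemma a_exact_combination:
  assumes K: "finite K" and u: "\<And>j. j \<in> K \<Longrightarrow> u j \<in> H10 \<Omega>"
  shows "(\<Sum>i\<in>K. \<Sum>j\<in>K. d i * d j * a_exact (u i) (u j)) =
     (\<Sum>T\<in>\<T>. (LINT x|lebesgue_on (interior T). (\<Sum>j\<in>K. d j *\<^sub>R wgrad \<Omega> (u j) x) \<bullet> (\<Sum>j\<in>K. d j *\<^sub>R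
         wgrad \<Omega> (u j) x)))
     + (\<Sum>T\<in>\<T>. c T * (LINT x|lebesgue_on (interior T). (\<Sum>j\<in>K. d j * u j x) * (\<Sum>j\<in>K. d j * u j x)))"
proof -
  let ?g = "\<lambda>x. \<Sum>j\<in>K. d j *\<^sub>R wgrad \<Omega> (u j) x" and ?u = "\<lambda>x. \<Sum>j\<in>K. d j * u j x"
  note D = H10_D[OF u]
  have ig: "integrable (lebesgue_on \<Omega>) (\<lambda>x. wgrad \<Omega> (u i) x \<bullet> wgrad \<Omega> (u j) x)" if "i \<in> K" "j \<in> K"
      for i j
    by (rule L2_integrable_inner[OF D(2)[OF that(1)] D(2)[OF that(2)]])
  have iV: "integrable (lebesgue_on \<Omega>) (\<lambda>x. V x * u i x * u j x)" if "i \<in> K" "j \<in> K" for i j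
    by (rule V_integral(1)[OF D(1)[OF that(1)] D(1)[OF that(2)]])
  have gL2: "?g \<in> L2 \<Omega>" by (rule L2_sum_scaleR[OF K D(2)])
  have uL2: "?u \<in> L2 \<Omega>" by (rule L2_linear_combination[OF K D(1)])
  have "(\<Sum>T\<in>\<T>. (LINT x|lebesgue_on (interior T). ?g x \<bullet> ?g x)) = (LINT x|lebesgue_on \<Omega>. ?g x \<bullet> ?g x)"
    by (rule integral_split(2)[symmetric]) (intro L2_integrable_inner L2_interior gL2)
  also have "\<dots> = (LINT x|lebesgue_on \<Omega>. (\<Sum>i\<in>K. \<Sum>j\<in>K. d i * d j * (wgrad \<Omega> (u i) x \<bullet> wgrad \<Omega> (u j) x)))"
    by (intro Bochner_Integration.integral_cong refl)
       (simp add: inner_sum_left inner_sum_right sum_distrib_left mult.assoc, subst sum.swap, simp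
           add: mult.left_commute inner_commute)
  also have "\<dots> = (\<Sum>i\<in>K. \<Sum>j\<in>K. d i * d j * (LINT x|lebesgue_on \<Omega>. wgrad \<Omega> (u i) x \<bullet> wgrad \<Omega> (u j) x))"
    using ig by (simp add: Bochner_Integration.integral_sum)
  finally have G: "(\<Sum>T\<in>\<T>. (LINT x|lebesgue_on (interior T). ?g x \<bullet> ?g x)) =
      (\<Sum>i\<in>K. \<Sum>j\<in>K. d i * d j * (LINT x|lebesgue_on \<Omega>. wgrad \<Omega> (u i) x \<bullet> wgrad \<Omega> (u j) x))" .
  have "(\<Sum>T\<in>\<T>. c T * (LINT x|lebesgue_on (interior T). ?u x * ?u x))
      = (LINT x|lebesgue_on \<Omega>. V x * ?u x * ?u x)"
    by (rule V_integral(2)[OF uL2 uL2, symmetric])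
  also have "\<dots> = (LINT x|lebesgue_on \<Omega>. (\<Sum>i\<in>K. \<Sum>j\<in>K. d i * d j * (V x * u i x * u j x)))"
    by (intro Bochner_Integration.integral_cong refl)
       (simp only: mult.assoc sum_product, simp only: sum_distrib_left, intro sum.cong refl, simp
           add: ac_simps)
  also have "\<dots> = (\<Sum>i\<in>K. \<Sum>j\<in>K. d i * d j * (LINT x|lebesgue_on \<Omega>. V x * u i x * u j x))"
    using iV by (simp add: Bochner_Integration.integral_sum)
  finally have W: "(\<Sum>T\<in>\<T>. c T * (LINT x|lebesgue_on (interior T). ?u x * ?u x)) =
      (\<Sum>i\<in>K. \<Sum>j\<in>K. d i * d j * (LINT x|lebesgue_on \<Omega>. V x * u i x * u j x))" .
  show ?thesis unfolding G W schroedinger_form_def by (simp add: distrib_left sum.distrib)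
qed

lemma a_pw_self:
  assumes "w \<in> eCR0 \<Omega> \<T>"
  shows "a_pw w w = (\<Sum>T\<in>\<T>. (LINT x|lebesgue_on (interior T). grad w x \<bullet> grad w x))
     + (\<Sum>T\<in>\<T>. c T * (LINT x|lebesgue_on (interior T). w x * w x))"
proof -
  have "w \<in> L2 \<Omega>" using assms eCR0_L2 by blast
  then show ?thesis unfolding pw_schroedinger_form_def by (simp add: V_integral(2))
qed

lemma continuous_AE_zero:
  assumes tm: "T \<in> \<T>" and f: "continuous_on (interior T) f" and AE: "AE x in lebesgue_on (interior
      T). f x = 0"
    and x: "x \<in> interior T"
  shows "f x = (0 :: real)"
proof (rule ccontr)
  assume "f x \<noteq> 0"
  define S where "S = interior T \<inter> f -` (- {0})"
  have "open S" unfolding S_def by (rule continuous_open_preimage[OF f]) auto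
  moreover have "S \<noteq> {}" using x \<open>f x \<noteq> 0\<close> by (auto simp: S_def)
  ultimately have "\<not> negligible S" using open_not_negligible by blast
  moreover have "negligible S"
  proof -
    have "AE x in lebesgue. x \<in> interior T \<longrightarrow> f x = 0" using AE by (simp add: AE_restrict_space_iff)
    then have "AE x in lebesgue. x \<notin> S" by eventually_elim (auto simp: S_def)
    moreover have "S \<in> sets lebesgue" using \<open>open S\<close> by auto
    ultimately show ?thesis by (simp add: negligible_iff_null_sets AE_iff_null_sets)
  qed
  ultimately show False by blast
qed

text \<open>Dimension is counted up to null sets, whereas \<open>grad\<close> is pointwise. Discrete
  functions are continuous on the open simplices, so equality almost everywhere is equality there,
  and the gradients agree.\<close>

lemma a_pw_AE_combination:
  assumes K: "finite K" and w: "\<And>i. i \<in> K \<Longrightarrow> w i \<in> eCR0 \<Omega> \<T>" and v: "v \<in> eCR0 \<Omega> \<T>" and z: "z \<in> eCR0 \<Omega> \<T>"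
    and AE: "AE x in lebesgue_on \<Omega>. v x = (\<Sum>i\<in>K. d i * w i x)"
  shows "a_pw v z = (\<Sum>i\<in>K. d i * a_pw (w i) z)"
proof -
  have gr: "grad v x = (\<Sum>i\<in>K. d i *\<^sub>R grad (w i) x)" if tm: "T \<in> \<T>" and x: "x \<in> interior T" for T x
  proof -
    have der: "(y has_derivative (\<lambda>h. grad y x \<bullet> h)) (at x)" "continuous_on (interior T) y"
      if y: "y \<in> eCR0 \<Omega> \<T>" "x \<in> interior T" for y x
    proof -
      obtain a b \<beta> where q: "\<And>x. x \<in> interior T \<Longrightarrow> y x = quad a b \<beta> x" by (rule eCR0_local[OF y(1)
          tm]) blast
      show "(y has_derivative (\<lambda>h. grad y x \<bullet> h)) (at x)"
        by (rule has_derivative_if_quad(1)[OF open_interior q y(2)])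
      show "continuous_on (interior T) y"
        by (rule continuous_on_eq[OF continuous_quad[of _ a b \<beta>]]) (simp add: q)
    qed
    have "v y - (\<Sum>i\<in>K. d i * w i y) = 0" if "y \<in> interior T" for y
    proof (rule continuous_AE_zero[OF tm _ _ that])
      show "continuous_on (interior T) (\<lambda>y. v y - (\<Sum>i\<in>K. d i * w i y))"
        by (intro continuous_intros der(2)[OF v that] der(2)[OF w that])
      show "AE x in lebesgue_on (interior T). v x - (\<Sum>i\<in>K. d i * w i x) = 0"
        using AE_split[OF AE tm] by eventually_elim simp
    qed
    then have eq: "v y = (\<Sum>i\<in>K. d i * w i y)" if "y \<in> interior T" for y using that by simp
    have "((\<lambda>y. \<Sum>i\<in>K. d i * w i y) has_derivative (\<lambda>h. \<Sum>i\<in>K. d i * (grad (w i) x \<bullet> h))) (at x)"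
      by (intro has_derivative_sum has_derivative_mult_right der(1)[OF w x])
    then have "(v has_derivative (\<lambda>h. \<Sum>i\<in>K. d i * (grad (w i) x \<bullet> h))) (at x)"
      by (rule has_derivative_transform_within_open[OF _ open_interior x]) (simp add: eq)
    then have "(v has_derivative (\<lambda>h. (\<Sum>i\<in>K. d i *\<^sub>R grad (w i) x) \<bullet> h)) (at x)"
      by (simp add: inner_sum_left)
    then show ?thesis by (rule grad_eqI)
  qed
  have L: "v \<in> L2 \<Omega>" "z \<in> L2 \<Omega>" "\<And>i. i \<in> K \<Longrightarrow> w i \<in> L2 \<Omega>" using eCR0_L2 v z w by auto
  have G: "(LINT x|lebesgue_on (interior T). grad v x \<bullet> grad z x)
       = (\<Sum>i\<in>K. d i * (LINT x|lebesgue_on (interior T). grad (w i) x \<bullet> grad z x))" if tm: "T \<in> \<T>" for T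
  proof -
    have i: "integrable (lebesgue_on (interior T)) (\<lambda>x. grad (w i) x \<bullet> grad z x)" if "i \<in> K" for i
      by (rule L2_integrable_inner[OF eCR0_L2_local(2)[OF w[OF that] tm] eCR0_L2_local(2)[OF z tm]])
    have "(LINT x|lebesgue_on (interior T). grad v x \<bullet> grad z x)
        = (LINT x|lebesgue_on (interior T). (\<Sum>i\<in>K. d i * (grad (w i) x \<bullet> grad z x)))"
      by (intro Bochner_Integration.integral_cong refl) (simp add: gr[OF tm] inner_sum_left)
    also have "\<dots> = (\<Sum>i\<in>K. d i * (LINT x|lebesgue_on (interior T). grad (w i) x \<bullet> grad z x))"
      by (subst Bochner_Integration.integral_sum) (simp_all add: i)
    finally show ?thesis .
  qed
  have iV: "integrable (lebesgue_on \<Omega>) (\<lambda>x. V x * w i x * z x)" if "i \<in> K" for i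
    by (rule V_integral(1)[OF L(3)[OF that] L(2)])
  have "(LINT x|lebesgue_on \<Omega>. V x * v x * z x) = (LINT x|lebesgue_on \<Omega>. (\<Sum>i\<in>K. d i * (V x * w i x
      * z x)))"
  proof (rule integral_cong_AE)
    show "(\<lambda>x. V x * v x * z x) \<in> borel_measurable (lebesgue_on \<Omega>)" using V_integral(1)[OF L(1,2)]
        by auto
    show "(\<lambda>x. \<Sum>i\<in>K. d i * (V x * w i x * z x)) \<in> borel_measurable (lebesgue_on \<Omega>)"
      by (rule borel_measurable_integrable, rule Bochner_Integration.integrable_sum,
          rule integrable_mult_right, rule iV)
    show "AE x in lebesgue_on \<Omega>. V x * v x * z x = (\<Sum>i\<in>K. d i * (V x * w i x * z x))"
      using AE
    proof eventually_elim
      case (elim x)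
      then show ?case
        by (simp only: sum_distrib_left sum_distrib_right) (intro sum.cong refl, simp add: ac_simps)
    qed
  qed
  also have "\<dots> = (\<Sum>i\<in>K. d i * (LINT x|lebesgue_on \<Omega>. V x * w i x * z x))"
    by (subst Bochner_Integration.integral_sum) (simp_all add: iV)
  finally have W: "(LINT x|lebesgue_on \<Omega>. V x * v x * z x) = (\<Sum>i\<in>K. d i * (LINT x|lebesgue_on \<Omega>. V
      x * w i x * z x))" .
  have "(\<Sum>T\<in>\<T>. (LINT x|lebesgue_on (interior T). grad v x \<bullet> grad z x))
      = (\<Sum>T\<in>\<T>. \<Sum>i\<in>K. d i * (LINT x|lebesgue_on (interior T). grad (w i) x \<bullet> grad z x))"
    by (intro sum.cong refl G)
  also have "\<dots> = (\<Sum>i\<in>K. d i * (\<Sum>T\<in>\<T>. (LINT x|lebesgue_on (interior T). grad (w i) x \<bullet> grad z x)))"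
    by (subst sum.swap) (simp add: sum_distrib_left)
  finally show ?thesis unfolding pw_schroedinger_form_def W by (simp add: distrib_left sum.distrib)
qed

text \<open>The eigenfunctions are independent and as many as the dimension, so adding
  \<open>v\<close> makes them dependent, and \<open>v\<close> is almost everywhere a combination of
  them. This takes the place of a spectral theorem for the discrete problem.\<close>

lemma discrete_bound:
  assumes dim: "has_dim_ae \<Omega> (eCR0 \<Omega> \<T>) N" and es: "eigen_system \<Omega> (eCR0 \<Omega> \<T>) a_pw {1..N} ev w"
    and mono: "mono_on {1..N} ev" and v: "v \<in> eCR0 \<Omega> \<T>"
    and orth: "\<And>i. i \<in> {1..N} \<Longrightarrow> i < k \<Longrightarrow> L2_inner \<Omega> (w i) v = 0"
  shows "k \<in> {1..N} \<Longrightarrow> ev k * L2_inner \<Omega> v v \<le> a_pw v v"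
    and "k > N \<Longrightarrow> L2_inner \<Omega> v v = 0"
proof -
  interpret es: eigen_system \<Omega> "eCR0 \<Omega> \<T>" a_pw "{1..N}" ev w by (rule es)
  let ?K = "{1..N}"
  obtain e where e: "\<forall>f\<in>eCR0 \<Omega> \<T>. \<exists>b. AE x in lebesgue_on \<Omega>. f x = (\<Sum>l<N. b l * e l x)"
    using dim unfolding has_dim_ae_def by blast
  \<comment> \<open>Index 0 holds \<open>v\<close>; the indices from 1 on hold the
    eigenfunctions.\<close>
  define y where "y i = (if i = 0 then v else w i)" for i :: nat
  have yX: "y i \<in> eCR0 \<Omega> \<T>" if "i \<in> {0..N}" for i using that v es.wX[of i] by (auto simp: y_def)
  have "\<forall>i\<in>{0..N}. \<exists>b. AE x in lebesgue_on \<Omega>. y i x = (\<Sum>l<N. b l * e l x)"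
    using e yX by blast
  from bchoice[OF this] obtain b where
    b: "\<forall>i\<in>{0..N}. AE x in lebesgue_on \<Omega>. y i x = (\<Sum>l<N. b i l * e l x)"
    by blast
  obtain s where s: "\<exists>i\<in>{0..N}. s i \<noteq> 0" "\<forall>l\<in>{..<N}. (\<Sum>i\<in>{0..N}. b i l * s i) = 0"
    using homogeneous_system_nontrivial[of "{..<N}" "{0..N}" "\<lambda>l i. b i l"] by auto
  have "AE x in lebesgue_on \<Omega>. \<forall>i\<in>{0..N}. y i x = (\<Sum>l<N. b i l * e l x)"
    by (intro AE_finite_allI) (use b in auto)
  then have comb0: "AE x in lebesgue_on \<Omega>. (\<Sum>i\<in>{0..N}. s i * y i x) = 0"
  proof eventually_elim
    case (elim x)
    have "(\<Sum>i\<in>{0..N}. s i * y i x) = (\<Sum>i\<in>{0..N}. \<Sum>l<N. (b i l * s i) * e l x)"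
      using elim by (simp add: sum_distrib_left algebra_simps)
    also have "\<dots> = (\<Sum>l<N. (\<Sum>i\<in>{0..N}. b i l * s i) * e l x)"
      by (subst sum.swap) (simp add: sum_distrib_right)
    also have "\<dots> = 0" using s(2) by simp
    finally show ?case .
  qed
  have split: "(\<Sum>i\<in>{0..N}. s i * y i x) = s 0 * v x + (\<Sum>i\<in>?K. s i * w i x)" for x
    by (subst sum.atLeast_Suc_atMost) (auto simp: y_def intro!: sum.cong)
  \<comment> \<open>Otherwise the eigenfunctions alone would satisfy a nontrivial relation.\<close>
  have s0: "s 0 \<noteq> 0"
  proof
    assume "s 0 = 0"
    then have "AE x in lebesgue_on \<Omega>. (\<Sum>i\<in>?K. s i * w i x) = 0" using comb0 by (simp add: split)
    then have "\<forall>i\<in>?K. s i = 0" using es.independent[of ?K s] by blast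
    then show False using s(1) \<open>s 0 = 0\<close> by (auto simp: Suc_le_eq)
  qed
  define d where "d i = - s i / s 0" for i
  have comb: "AE x in lebesgue_on \<Omega>. v x = (\<Sum>i\<in>?K. d i * w i x)"
    using comb0 unfolding split
  proof eventually_elim
    case (elim x)
    have "(\<Sum>i\<in>?K. d i * w i x) = - (\<Sum>i\<in>?K. s i * w i x) / s 0"
      by (simp add: d_def sum_divide_distrib sum_negf)
    also have "\<dots> = v x" using elim s0 by (simp add: field_simps)
    finally show ?case by simp
  qed
  have wL: "w i \<in> L2 \<Omega>" if "i \<in> ?K" for i by (rule es.wL2[OF that])
  have vL: "v \<in> L2 \<Omega>" using v eCR0_L2 by blast
  have inn: "L2_inner \<Omega> v z = (\<Sum>i\<in>?K. d i * L2_inner \<Omega> (w i) z)" if z: "z \<in> L2 \<Omega>" for z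
  proof -
    have cL: "(\<lambda>x. \<Sum>i\<in>?K. d i * w i x) \<in> L2 \<Omega>" by (rule L2_linear_combination) (use wL in auto)
    have "L2_inner \<Omega> v z = L2_inner \<Omega> (\<lambda>x. \<Sum>i\<in>?K. d i * w i x) z"
      unfolding L2_inner_def
    proof (rule integral_cong_AE)
      show "(\<lambda>x. v x * z x) \<in> borel_measurable (lebesgue_on \<Omega>)"
        using L2_integrable_mult[OF vL z] by auto
      show "(\<lambda>x. (\<Sum>i\<in>?K. d i * w i x) * z x) \<in> borel_measurable (lebesgue_on \<Omega>)"
        using L2_integrable_mult[OF cL z] by auto
      show "AE x in lebesgue_on \<Omega>. v x * z x = (\<Sum>i\<in>?K. d i * w i x) * z x"
        using comb by eventually_elim simp
    qed
    also have "\<dots> = (\<Sum>i\<in>?K. d i * L2_inner \<Omega> (w i) z)"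
      by (rule L2_inner_sum_left) (use wL z in auto)
    finally show ?thesis .
  qed
  have av: "a_pw v v = (\<Sum>i\<in>?K. d i * (ev i * L2_inner \<Omega> (w i) v))"
  proof -
    have "a_pw v v = (\<Sum>i\<in>?K. d i * a_pw (w i) v)"
      by (rule a_pw_AE_combination[OF _ _ v v comb]) (use es.wX in auto)
    also have "\<dots> = (\<Sum>i\<in>?K. d i * (ev i * L2_inner \<Omega> (w i) v))"
      by (intro sum.cong refl) (simp add: es.eig[OF _ v])
    finally show ?thesis .
  qed
  \<comment> \<open>Beyond the dimension, \<open>v\<close> is orthogonal to all eigenfunctions and
    hence to itself.\<close>
  show "k > N \<Longrightarrow> L2_inner \<Omega> v v = 0"
    using inn[OF vL] orth by simp
  show "ev k * L2_inner \<Omega> v v \<le> a_pw v v" if k: "k \<in> ?K"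
  proof -
    \<comment> \<open>Smaller eigenvalues would make the weight \<open>\<mu> - ev k\<close>
      negative, hence the cut-off at 0. The terms of index below \<open>k\<close> vanish by
      orthogonality, so the cut-off is undone below.\<close>
    let ?\<kappa> = "\<lambda>\<mu>. max 0 (\<mu> - ev k)"
    have "0 \<le> (\<Sum>i\<in>?K. \<Sum>j\<in>?K. d i * d j * ?\<kappa> (ev i) * L2_inner \<Omega> (w i) (w j))"
      by (rule es.weighted_form_nonneg) auto
    also have "\<dots> = (\<Sum>i\<in>?K. d i * ?\<kappa> (ev i) * L2_inner \<Omega> (w i) v)"
    proof (intro sum.cong refl)
      fix i assume i: "i \<in> ?K"
      have "L2_inner \<Omega> (w i) v = (\<Sum>j\<in>?K. d j * L2_inner \<Omega> (w i) (w j))"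
        using inn[OF wL[OF i]] by (simp add: L2_inner_commute[of \<Omega> _ "w i"] L2_inner_commute[of \<Omega> v])
      then show "(\<Sum>j\<in>?K. d i * d j * ?\<kappa> (ev i) * L2_inner \<Omega> (w i) (w j))
          = d i * ?\<kappa> (ev i) * L2_inner \<Omega> (w i) v"
        by (simp add: sum_distrib_left ac_simps)
    qed
    also have "\<dots> = (\<Sum>i\<in>?K. d i * (ev i - ev k) * L2_inner \<Omega> (w i) v)"
    proof (intro sum.cong refl)
      fix i assume i: "i \<in> ?K"
      show "d i * ?\<kappa> (ev i) * L2_inner \<Omega> (w i) v = d i * (ev i - ev k) * L2_inner \<Omega> (w i) v"
      proof (cases "i < k")
        case True
        then show ?thesis using orth[OF i] by simp
      next
        case False
        then have "ev k \<le> ev i" using mono i k by (auto simp: mono_on_def)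
        then show ?thesis by simp
      qed
    qed
    also have "\<dots> = a_pw v v - ev k * L2_inner \<Omega> v v"
      unfolding av inn[OF vL] by (simp add: sum_subtractf sum_distrib_left algebra_simps)
    finally show ?thesis by simp
  qed
qed

end

section \<open>Eigenfunctions and the comparison function\<close>

context eCR_setting
begin

lemma eCR0_grad_sum:
  assumes K: "finite K" and w: "\<And>j. j \<in> K \<Longrightarrow> w j \<in> eCR0 \<Omega> \<T>" and tm: "T \<in> \<T>" and x: "x \<in> interior T"
  shows "grad (\<lambda>x. \<Sum>j\<in>K. d j * w j x) x = (\<Sum>j\<in>K. d j *\<^sub>R grad (w j) x)"
proof (rule grad_eqI)
  have der: "(w j has_derivative (\<lambda>h. grad (w j) x \<bullet> h)) (at x)" if j: "j \<in> K" for j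
  proof -
    obtain a b \<beta> where q: "\<And>x. x \<in> interior T \<Longrightarrow> w j x = quad a b \<beta> x"
      by (rule eCR0_local[OF w[OF j] tm]) blast
    show ?thesis by (rule has_derivative_if_quad(1)[OF open_interior q x])
  qed
  have "((\<lambda>y. \<Sum>j\<in>K. d j * w j y) has_derivative (\<lambda>h. \<Sum>j\<in>K. d j * (grad (w j) x \<bullet> h))) (at x)"
    by (intro has_derivative_sum has_derivative_mult_right der)
  then show "((\<lambda>y. \<Sum>j\<in>K. d j * w j y) has_derivative (\<lambda>h. (\<Sum>j\<in>K. d j *\<^sub>R grad (w j) x) \<bullet> h)) (at x)"
    by (simp add: inner_sum_left)
qed

lemma orthogonal_to_eCR0_gradient:
  assumes w: "w \<in> eCR0 \<Omega> \<T>" and tm: "T \<in> \<T>" and h: "h \<in> L2 (interior T)"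
    and h0: "(LINT x|lebesgue_on (interior T). h x) = 0" and h1: "(LINT x|lebesgue_on (interior
        T). h x \<bullet> x) = 0"
  shows "(LINT x|lebesgue_on (interior T). h x \<bullet> grad w x) = 0"
proof -
  interpret S: full_simplex "vertices T" T by (rule simplex_mesh[OF tm])
  obtain a b \<beta> where q: "\<And>x. x \<in> interior T \<Longrightarrow> w x = quad a b \<beta> x"
    by (rule eCR0_local[OF w tm]) blast
  \<comment> \<open>The zero function fills the scalar slot of \<open>face_mean_integrable\<close>,
    from which the integrability facts about \<open>h\<close> are read off.\<close>
  have one: "(\<lambda>_. 0 :: real) \<in> L2 (interior T)" by (rule S.continuous_L2) simp
  note i = S.face_mean_integrable[OF one h]
  have "(LINT x|lebesgue_on (interior T). h x \<bullet> grad w x)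
      = (LINT x|lebesgue_on (interior T). h x \<bullet> a + (2 * \<beta>) * (h x \<bullet> x))"
    by (intro Bochner_Integration.integral_cong refl)
       (simp add: has_derivative_if_quad(2)[OF open_interior q] inner_add_right)
  also have "\<dots> = (LINT x|lebesgue_on (interior T). h x) \<bullet> a + (2 * \<beta>) * (LINT x|lebesgue_on
      (interior T). h x \<bullet> x)"
    using i by simp
  finally show ?thesis by (simp add: h0 h1)
qed

lemma exact_eigen_system:
  assumes "exact_eigenvalues \<Omega> V ev"
  obtains u where "eigen_system \<Omega> (H10 \<Omega>) a_exact {1..} ev u"
proof -
  have en: "enumerates_eigenvalues \<Omega> (H10 \<Omega>) a_exact {1..} ev"
    using assms by (simp add: exact_eigenvalues_def)
  obtain u where u: "\<And>i. i \<in> {1..} \<Longrightarrow> u i \<in> H10 \<Omega>"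
    "\<And>i v. i \<in> {1..} \<Longrightarrow> v \<in> H10 \<Omega> \<Longrightarrow> a_exact (u i) v = ev i * L2_inner \<Omega> (u i) v"
    "\<And>\<mu> c. AE x in lebesgue_on \<Omega>. (\<Sum>i | i \<in> {1..} \<and> ev i = \<mu>. c i * u i x) = 0 \<Longrightarrow> \<forall>i\<in>{1..}. ev i
        = \<mu> \<longrightarrow> c i = 0"
    using enumerates_eigenvalues_basis[OF en] by blast
  have fin: "finite {i \<in> {1..}. ev i = \<mu>}" for \<mu>
  proof (cases "\<mu> > 0")
    case True
    then show ?thesis using en by (simp add: enumerates_eigenvalues_def)
  next
    case False
    then have "{i \<in> {1..}. ev i = \<mu>} = {}" using en by (force simp: enumerates_eigenvalues_def)
    then show ?thesis by (simp only: finite.emptyI)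
  qed
  have "eigen_system \<Omega> (H10 \<Omega>) a_exact {1..} ev u"
  proof
    show "H10 \<Omega> \<subseteq> L2 \<Omega>" using H10_D(1) by blast
    show "a_exact u v = a_exact v u" for u v by (rule a_exact_sym)
  qed (fact u fin)+
  then show ?thesis using that by blast
qed

lemma discrete_eigen_system:
  assumes en: "enumerates_eigenvalues \<Omega> (eCR0 \<Omega> \<T>) a_pw {1..N} ev"
  obtains w where "eigen_system \<Omega> (eCR0 \<Omega> \<T>) a_pw {1..N} ev w"
proof -
  obtain w where w: "\<And>i. i \<in> {1..N} \<Longrightarrow> w i \<in> eCR0 \<Omega> \<T>"
    "\<And>i v. i \<in> {1..N} \<Longrightarrow> v \<in> eCR0 \<Omega> \<T> \<Longrightarrow> a_pw (w i) v = ev i * L2_inner \<Omega> (w i) v"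
    "\<And>\<mu> c. AE x in lebesgue_on \<Omega>. (\<Sum>i | i \<in> {1..N} \<and> ev i = \<mu>. c i * w i x) = 0 \<Longrightarrow> \<forall>i\<in>{1..N}. ev i
        = \<mu> \<longrightarrow> c i = 0"
    using enumerates_eigenvalues_basis[OF en] by blast
  have "eigen_system \<Omega> (eCR0 \<Omega> \<T>) a_pw {1..N} ev w"
  proof
    show "eCR0 \<Omega> \<T> \<subseteq> L2 \<Omega>" by (rule eCR0_L2)
    show "a_pw u v = a_pw v u" for u v by (rule a_pw_sym)
    show "finite {i \<in> {1..N}. ev i = \<mu>}" for \<mu> by simp
  qed (fact w)+
  then show ?thesis using that by blast
qed

text \<open>The interpolants of the first \<open>k\<close> exact eigenfunctions may be linearly dependent. Choosing
  the linear combination by \<open>k - 1\<close> orthogonality constraints on its interpolant instead of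
  applying the min-max principle to a span avoids this case distinction, and covers \<open>k > N\<close>.\<close>

lemma exists_discrete_test_function:
  assumes Cp: "Cp > 0" and P: "\<And>T. T \<in> \<T> \<Longrightarrow> poincare_constant Cp T"
    and \<epsilon>: "\<epsilon> > 0" "\<And>T. T \<in> \<T> \<Longrightarrow> (Cp * diameter T)\<^sup>2 \<le> \<epsilon>"
    and \<delta>: "\<delta> \<ge> 0" "\<And>T. T \<in> \<T> \<Longrightarrow> (Cp * diameter T)\<^sup>2 * c T \<le> \<delta>"
    and es: "eigen_system \<Omega> (H10 \<Omega>) a_exact {1..} ev u" and mono: "mono_on {1..} ev"
    and k: "k \<ge> 1" and w: "\<And>i. i \<in> {1..N} \<Longrightarrow> w i \<in> eCR0 \<Omega> \<T>"
  shows "\<exists>v\<in>eCR0 \<Omega> \<T>. (\<forall>i\<in>{1..N}. i < k \<longrightarrow> L2_inner \<Omega> (w i) v = 0) \<and>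
    (\<forall>t>0. t * L2_inner \<Omega> v v \<le> a_pw v v \<longrightarrow> GLB_real \<epsilon> \<delta> t \<le> ev k)"
proof -
  interpret es: eigen_system \<Omega> "H10 \<Omega>" a_exact "{1..}" ev u by (rule es)
  let ?K = "{1..k}"
  have u: "u j \<in> H10 \<Omega>" if "j \<in> ?K" for j using es.wX[of j] that by simp
  note uD = H10_D[OF u]
  define Q where "Q j z \<longleftrightarrow> z \<in> eCR0 \<Omega> \<T> \<and>
      (\<forall>T\<in>\<T>. (LINT x|lebesgue_on (interior T). u j x - z x) = 0 \<and>
         (LINT x|lebesgue_on (interior T). wgrad \<Omega> (u j) x - grad z x) = 0 \<and>
         (LINT x|lebesgue_on (interior T). (wgrad \<Omega> (u j) x - grad z x) \<bullet> x) = 0)" for j z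
  have "\<forall>j\<in>?K. \<exists>z. Q j z"
  proof
    fix j assume j: "j \<in> ?K"
    show "\<exists>z. Q j z"
      unfolding Q_def by (rule interpolation[OF uD(1,2)[OF j] H10_matched[OF u[OF j]]]) blast
  qed
  from bchoice[OF this] obtain z where z: "\<forall>j\<in>?K. Q j (z j)" by blast
  have zX: "z j \<in> eCR0 \<Omega> \<T>" if "j \<in> ?K" for j using z that unfolding Q_def by blast
  have z0: "(LINT x|lebesgue_on (interior T). u j x - z j x) = 0"
     "(LINT x|lebesgue_on (interior T). wgrad \<Omega> (u j) x - grad (z j) x) = 0"
     "(LINT x|lebesgue_on (interior T). (wgrad \<Omega> (u j) x - grad (z j) x) \<bullet> x) = 0"
    if "j \<in> ?K" "T \<in> \<T>" for j T using z that unfolding Q_def by blast+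
  \<comment> \<open>At most \<open>k - 1\<close> constraints for \<open>k\<close> coefficients, also
    when \<open>N\<close> is smaller than \<open>k\<close>.\<close>
  let ?J = "{i \<in> {1..N}. i < k}"
  have "card ?J \<le> card {1..<k}" by (rule card_mono) auto
  then have "card ?J < card ?K" using k by simp
  then obtain d where d: "\<exists>j\<in>?K. d j \<noteq> 0" "\<forall>i\<in>?J. (\<Sum>j\<in>?K. L2_inner \<Omega> (z j) (w i) * d j) = 0"
    using homogeneous_system_nontrivial[of ?J ?K "\<lambda>i j. L2_inner \<Omega> (z j) (w i)"] by auto
  \<comment> \<open>Each eigenfunction has its own interpolant. The moment conditions are linear, so
    \<open>v\<close> satisfies them with respect to \<open>U\<close> and \<open>g\<close>.\<close>
  define v where "v x = (\<Sum>j\<in>?K. d j * z j x)" for x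
  define U where "U x = (\<Sum>j\<in>?K. d j * u j x)" for x
  define g where "g x = (\<Sum>j\<in>?K. d j *\<^sub>R wgrad \<Omega> (u j) x)" for x
  have vX: "v \<in> eCR0 \<Omega> \<T>" unfolding v_def[abs_def] by (rule eCR0_linear_combination[OF _ zX]) auto
  have vL: "v \<in> L2 \<Omega>" using vX eCR0_L2 by blast
  have UL: "U \<in> L2 \<Omega>" unfolding U_def[abs_def] by (rule L2_linear_combination[OF _ uD(1)]) auto
  have gL: "g \<in> L2 \<Omega>" unfolding g_def[abs_def] by (rule L2_sum_scaleR[OF _ uD(2)]) auto
  have Ug: "weak_gradient \<Omega> U g"
    unfolding U_def[abs_def] g_def[abs_def] by (rule weak_gradient_linear[OF _ domain_sets uD]) auto
  have orth: "L2_inner \<Omega> (w i) v = 0" if "i \<in> {1..N}" "i < k" for i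
  proof -
    have "L2_inner \<Omega> v (w i) = (\<Sum>j\<in>?K. d j * L2_inner \<Omega> (z j) (w i))"
      unfolding v_def[abs_def] by (rule L2_inner_sum_left) (use zX w that eCR0_L2 in blast)+
    also have "\<dots> = 0" using d(2) that by (simp add: mult.commute)
    finally show ?thesis by (simp only: L2_inner_commute)
  qed
  define \<alpha> where "\<alpha> T = (LINT x|lebesgue_on (interior T). grad v x \<bullet> grad v x)" for T
  define R where "R T M Nn r \<beta> \<longleftrightarrow> 0 \<le> M \<and> 0 \<le> Nn \<and> 0 \<le> r \<and> 0 \<le> \<beta> \<and>
     (LINT x|lebesgue_on (interior T). U x * U x) = M + Nn \<and>
     (LINT x|lebesgue_on (interior T). v x * v x) = M + r \<and>
     (LINT x|lebesgue_on (interior T). g x \<bullet> g x) = \<alpha> T + \<beta> \<and>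
     Nn \<le> (Cp * diameter T)\<^sup>2 * (\<alpha> T + \<beta>) \<and> r \<le> (Cp * diameter T)\<^sup>2 * \<alpha> T \<and>
     (\<forall>\<theta>. 0 < \<theta> \<longrightarrow> \<theta> \<le> 1 \<longrightarrow> Nn - r \<le> \<theta> * Nn + (1 / \<theta> - 1) * ((Cp * diameter T)\<^sup>2 * \<beta>))"
    for T M Nn r \<beta>
  have "\<forall>T\<in>\<T>. \<exists>M Nn r \<beta>. R T M Nn r \<beta>"
  proof
    fix T assume tm: "T \<in> \<T>"
    interpret S: full_simplex "vertices T" T by (rule simplex_mesh[OF tm])
    let ?I = "\<lambda>f :: 'a \<Rightarrow> real. LINT x|lebesgue_on (interior T). f x"
    note vT = eCR0_L2_local[OF vX tm]
    have gv: "grad v x = (\<Sum>j\<in>?K. d j *\<^sub>R grad (z j) x)" if "x \<in> interior T" for x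
      unfolding v_def[abs_def] by (rule eCR0_grad_sum[OF _ zX tm that]) auto
    have i: "integrable (lebesgue_on (interior T)) (\<lambda>x. u j x - z j x)"
       "integrable (lebesgue_on (interior T)) (\<lambda>x. wgrad \<Omega> (u j) x - grad (z j) x)"
       "integrable (lebesgue_on (interior T)) (\<lambda>x. (wgrad \<Omega> (u j) x - grad (z j) x) \<bullet> x)" if "j \<in>
           ?K" for j
      by (rule S.face_mean_integrable[OF
            L2_diff[OF L2_interior[OF uD(1)[OF that] tm] eCR0_L2_local(1)[OF zX[OF that] tm]]
            L2_diff[OF L2_interior[OF uD(2)[OF that] tm] eCR0_L2_local(2)[OF zX[OF that] tm]]])+
    have m0: "?I (\<lambda>x. U x - v x) = 0"
    proof -
      have "?I (\<lambda>x. U x - v x) = ?I (\<lambda>x. \<Sum>j\<in>?K. d j * (u j x - z j x))"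
        by (simp add: U_def v_def right_diff_distrib sum_subtractf)
      also have "\<dots> = (\<Sum>j\<in>?K. d j * ?I (\<lambda>x. u j x - z j x))"
        by (subst Bochner_Integration.integral_sum) (simp_all add: i del:
            Bochner_Integration.integral_diff)
      also have "\<dots> = 0" by (rule sum.neutral) (simp add: z0(1)[OF _ tm])
      finally show ?thesis .
    qed
    have gd: "g x - grad v x = (\<Sum>j\<in>?K. d j *\<^sub>R (wgrad \<Omega> (u j) x - grad (z j) x))" if "x \<in> interior
        T" for x
      by (simp add: g_def gv[OF that] scaleR_diff_right sum_subtractf)
    have g0: "(LINT x|lebesgue_on (interior T). g x - grad v x) = 0"
    proof -
      have "(LINT x|lebesgue_on (interior T). g x - grad v x)
          = (LINT x|lebesgue_on (interior T). (\<Sum>j\<in>?K. d j *\<^sub>R (wgrad \<Omega> (u j) x - grad (z j) x)))"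
        by (intro Bochner_Integration.integral_cong refl) (simp add: gd)
      also have "\<dots> = (\<Sum>j\<in>?K. d j *\<^sub>R (LINT x|lebesgue_on (interior T). wgrad \<Omega> (u j) x - grad (z j) x))"
        by (subst Bochner_Integration.integral_sum) (simp_all add: i del:
            Bochner_Integration.integral_diff)
      also have "\<dots> = 0" by (rule sum.neutral) (simp add: z0(2)[OF _ tm])
      finally show ?thesis .
    qed
    have g1: "?I (\<lambda>x. (g x - grad v x) \<bullet> x) = 0"
    proof -
      have "?I (\<lambda>x. (g x - grad v x) \<bullet> x)
          = ?I (\<lambda>x. \<Sum>j\<in>?K. d j * ((wgrad \<Omega> (u j) x - grad (z j) x) \<bullet> x))"
        by (intro Bochner_Integration.integral_cong refl) (simp add: gd inner_sum_left)
      also have "\<dots> = (\<Sum>j\<in>?K. d j * ?I (\<lambda>x. (wgrad \<Omega> (u j) x - grad (z j) x) \<bullet> x))"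
        by (subst Bochner_Integration.integral_sum) (simp_all add: i del:
            Bochner_Integration.integral_diff)
      also have "\<dots> = 0" by (rule sum.neutral) (simp add: z0(3)[OF _ tm])
      finally show ?thesis .
    qed
    have gT: "g \<in> L2 (interior T)" by (rule L2_interior[OF gL tm])
    have "?I (\<lambda>x. (g x - grad v x) \<bullet> grad v x) = 0"
      by (rule orthogonal_to_eCR0_gradient[OF vX tm L2_diff[OF gT vT(2)] g0 g1])
    from S.local_estimate[OF P[OF tm] Cp L2_interior[OF UL tm] vT(1) gT vT(2)
        weak_gradient_subset[OF Ug open_domain open_interior interior_in_domain[OF tm]] vT(3) m0 this]
    show "\<exists>M Nn r \<beta>. R T M Nn r \<beta>" unfolding R_def \<alpha>_def .
  qed
  then obtain M Nn r \<beta> where R: "\<And>T. T \<in> \<T> \<Longrightarrow> R T (M T) (Nn T) (r T) (\<beta> T)" by metis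
  have iUU: "L2_inner \<Omega> U U = (\<Sum>T\<in>\<T>. M T + Nn T)"
    unfolding L2_inner_def
    by (subst integral_split(2)) (use R L2_integrable_mult[OF L2_interior[OF UL] L2_interior[OF
        UL]] in \<open>auto simp: R_def\<close>)
  have ivv: "L2_inner \<Omega> v v = (\<Sum>T\<in>\<T>. M T + r T)"
    unfolding L2_inner_def
    by (subst integral_split(2)) (use R L2_integrable_mult[OF L2_interior[OF vL] L2_interior[OF
        vL]] in \<open>auto simp: R_def\<close>)
  \<comment> \<open>Independence of the exact eigenfunctions keeps \<open>U\<close> nonzero, whereas
    its interpolant \<open>v\<close> may be zero.\<close>
  have pos: "0 < (\<Sum>T\<in>\<T>. M T + Nn T)"
  proof (rule ccontr)
    assume "\<not> 0 < (\<Sum>T\<in>\<T>. M T + Nn T)"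
    then have "L2_inner \<Omega> U U = 0" using L2_inner_self_nonneg[of \<Omega> U] iUU by linarith
    then have "AE x in lebesgue_on \<Omega>. (\<Sum>j\<in>?K. d j * u j x) = 0"
      using L2_inner_self_eq_0[OF UL] by (simp add: U_def)
    then have "d j = 0" if "j \<in> ?K" for j using es.independent[of ?K d j] that by auto
    then show False using d(1) by blast
  qed
  have exact: "(\<Sum>T\<in>\<T>. \<alpha> T + \<beta> T) + (\<Sum>T\<in>\<T>. c T * (M T + Nn T)) \<le> ev k * (\<Sum>T\<in>\<T>. M T + Nn T)"
  proof -
    have "(\<Sum>T\<in>\<T>. \<alpha> T + \<beta> T) + (\<Sum>T\<in>\<T>. c T * (M T + Nn T))
        = (\<Sum>T\<in>\<T>. (LINT x|lebesgue_on (interior T). g x \<bullet> g x))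
          + (\<Sum>T\<in>\<T>. c T * (LINT x|lebesgue_on (interior T). U x * U x))"
      using R by (simp add: R_def)
    also have "\<dots> = (\<Sum>i\<in>?K. \<Sum>j\<in>?K. d i * d j * a_exact (u i) (u j))"
      unfolding g_def U_def by (rule a_exact_combination[OF _ u, symmetric]) auto
    also have "\<dots> = (\<Sum>i\<in>?K. \<Sum>j\<in>?K. d i * d j * (ev i * L2_inner \<Omega> (u i) (u j)))"
      using es.eig es.wX by (intro sum.cong refl) simp
    finally have 1: "(\<Sum>T\<in>\<T>. \<alpha> T + \<beta> T) + (\<Sum>T\<in>\<T>. c T * (M T + Nn T))
        = (\<Sum>i\<in>?K. \<Sum>j\<in>?K. d i * d j * (ev i * L2_inner \<Omega> (u i) (u j)))" .
    have 2: "L2_inner \<Omega> U U = (\<Sum>i\<in>?K. \<Sum>j\<in>?K. d i * d j * L2_inner \<Omega> (u i) (u j))"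
      unfolding U_def[abs_def] by (rule L2_inner_sum_sum[OF _ uD(1)]) auto
    \<comment> \<open>The weight \<open>ev k - \<mu>\<close> is nonnegative on the first
      \<open>k\<close> eigenvalues by monotonicity.\<close>
    have "0 \<le> (\<Sum>i\<in>?K. \<Sum>j\<in>?K. d i * d j * (ev k - ev i) * L2_inner \<Omega> (u i) (u j))"
      by (rule es.weighted_form_nonneg) (use mono in \<open>auto simp: mono_on_def\<close>)
    also have "\<dots> = ev k * L2_inner \<Omega> U U - (\<Sum>i\<in>?K. \<Sum>j\<in>?K. d i * d j * (ev i * L2_inner \<Omega> (u i) (u j)))"
      unfolding 2 by (simp add: sum_distrib_left sum_subtractf[symmetric] algebra_simps)
    finally show ?thesis using 1 iUU by simp
  qed
  show ?thesis
  proof (intro bexI[OF _ vX] conjI ballI allI impI)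
    show "L2_inner \<Omega> (w i) v = 0" if "i \<in> {1..N}" "i < k" for i by (rule orth[OF that])
    fix t :: real assume t: "t > 0" "t * L2_inner \<Omega> v v \<le> a_pw v v"
    have "a_pw v v = (\<Sum>T\<in>\<T>. \<alpha> T) + (\<Sum>T\<in>\<T>. c T * (M T + r T))"
      using R unfolding a_pw_self[OF vX] by (simp add: R_def \<alpha>_def)
    then have discrete: "t * (\<Sum>T\<in>\<T>. M T + r T) \<le> (\<Sum>T\<in>\<T>. \<alpha> T) + (\<Sum>T\<in>\<T>. c T * (M T + r T))"
      using t(2) ivv by simp
    have \<alpha>0: "0 \<le> \<alpha> T" for T unfolding \<alpha>_def by (intro Bochner_Integration.integral_nonneg) simp
    show "GLB_real \<epsilon> \<delta> t \<le> ev k"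
    proof (rule GLB_real_le_from_local_estimates[where S = \<T> and V = c and K = "\<lambda>T. (Cp * diameter T)\<^sup>2"
          and M = M and N = Nn and R = r and \<alpha> = \<alpha> and \<beta> = \<beta>])
      fix T \<theta> assume T: "T \<in> \<T>" and \<theta>: "0 < \<theta>" "\<theta> \<le> (1::real)"
      then show "Nn T - r T \<le> \<theta> * Nn T + (1 / \<theta> - 1) * ((Cp * diameter T)\<^sup>2 * \<beta> T)"
        using R[OF T] unfolding R_def by blast
    next
      fix T assume T: "T \<in> \<T>"
      show "0 \<le> M T \<and> 0 \<le> Nn T \<and> 0 \<le> r T \<and> 0 \<le> \<alpha> T \<and> 0 \<le> \<beta> T"
        "Nn T \<le> (Cp * diameter T)\<^sup>2 * (\<alpha> T + \<beta> T)" "r T \<le> (Cp * diameter T)\<^sup>2 * \<alpha> T"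
        using R[OF T] \<alpha>0[of T] unfolding R_def by blast+
    qed (use c_nonneg \<epsilon> \<delta> t exact discrete pos in auto)
  qed
qed

text \<open>The form in which \<epsilon> and \<delta> enter the estimates on a single simplex.
  Boundedness of the mesh size and of the potential secures finite norms.\<close>

lemma Linfty_norm_coefficients:
  assumes tm: "T \<in> \<T>"
  shows "(Cp * diameter T)\<^sup>2 \<le> Linfty_norm \<Omega> (\<lambda>x. Cp\<^sup>2 * (mesh_size \<T> x)\<^sup>2)"
    "(Cp * diameter T)\<^sup>2 * c T \<le> Linfty_norm \<Omega> (\<lambda>x. Cp\<^sup>2 * (mesh_size \<T> x)\<^sup>2 * V x)"
proof -
  let ?H = "\<Sum>T\<in>\<T>. diameter T"
  have sq: "Cp\<^sup>2 * (mesh_size \<T> x)\<^sup>2 \<le> Cp\<^sup>2 * ?H\<^sup>2" for x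
    using mesh_size_bounds[of x] by (intro mult_left_mono power_mono) auto
  have m: "(\<lambda>x. Cp\<^sup>2 * (mesh_size \<T> x)\<^sup>2) \<in> borel_measurable (lebesgue_on \<Omega>)"
    using mesh_size_measurable by (intro borel_measurable_times borel_measurable_power
        borel_measurable_const) auto
  have "\<bar>(Cp * diameter T)\<^sup>2\<bar> \<le> Linfty_norm \<Omega> (\<lambda>x. Cp\<^sup>2 * (mesh_size \<T> x)\<^sup>2)"
    by (rule piecewise_constant_le_Linfty_norm[OF m _ tm, of "Cp\<^sup>2 * ?H\<^sup>2"])
       (use sq in \<open>auto simp: mesh_size_interior[OF tm] power_mult_distrib\<close>)
  then show "(Cp * diameter T)\<^sup>2 \<le> Linfty_norm \<Omega> (\<lambda>x. Cp\<^sup>2 * (mesh_size \<T> x)\<^sup>2)" by simp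
  obtain B where B: "0 \<le> B" "AE x in lebesgue_on \<Omega>. \<bar>V x\<bar> \<le> B" by (rule V_bounded)
  have Vm: "V \<in> borel_measurable (lebesgue_on \<Omega>)" using V_Linfty by (simp add: Linfty_def)
  have "\<bar>(Cp * diameter T)\<^sup>2 * c T\<bar> \<le> Linfty_norm \<Omega> (\<lambda>x. Cp\<^sup>2 * (mesh_size \<T> x)\<^sup>2 * V x)"
  proof (rule piecewise_constant_le_Linfty_norm[OF borel_measurable_times[OF m Vm] _ tm])
    show "AE x in lebesgue_on \<Omega>. \<bar>Cp\<^sup>2 * (mesh_size \<T> x)\<^sup>2 * V x\<bar> \<le> (Cp\<^sup>2 * ?H\<^sup>2) * B"
      using B(2)
    proof eventually_elim
      case (elim x)
      have "\<bar>Cp\<^sup>2 * (mesh_size \<T> x)\<^sup>2 * V x\<bar> = (Cp\<^sup>2 * (mesh_size \<T> x)\<^sup>2) * \<bar>V x\<bar>" by (simp add: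
          abs_mult)
      also have "\<dots> \<le> (Cp\<^sup>2 * ?H\<^sup>2) * B" by (rule mult_mono[OF sq elim]) auto
      finally show ?case .
    qed
  qed (simp add: mesh_size_interior[OF tm] V_piece[OF tm] power_mult_distrib)
  then show "(Cp * diameter T)\<^sup>2 * c T \<le> Linfty_norm \<Omega> (\<lambda>x. Cp\<^sup>2 * (mesh_size \<T> x)\<^sup>2 * V x)" by simp
qed

end

section \<open>Assembly of the guaranteed lower bound\<close>

theorem theorem3p4:
  fixes \<Omega> :: "'a::euclidean_space set"
    and \<T> :: "'a set set"
    and V :: "'a \<Rightarrow> real"
    and C\<^sub>P \<epsilon> \<delta> :: real
    and ev :: "nat \<Rightarrow> real"
    and ev_eCR :: "nat \<Rightarrow> ereal"
    and k :: nat
  assumes "DIM('a) \<ge> 2"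
    and "polyhedral_lipschitz_domain \<Omega>"
    and "triangulation_of \<T> \<Omega>"
    and "V \<in> Linfty \<Omega>"
    and "essinf (lebesgue_on \<Omega>) V = 0"
    and "V \<in> pw_poly 0 \<T>"
    and "C\<^sub>P > 0"
    and "\<And>T. T \<in> \<T> \<Longrightarrow> poincare_constant C\<^sub>P T"
    and "\<epsilon> = Linfty_norm \<Omega> (\<lambda>x. C\<^sub>P\<^sup>2 * (mesh_size \<T> x)\<^sup>2)"
    and "\<delta> = Linfty_norm \<Omega> (\<lambda>x. C\<^sub>P\<^sup>2 * (mesh_size \<T> x)\<^sup>2 * V x)"
    and "exact_eigenvalues \<Omega> V ev"
    and "eCR_eigenvalues \<Omega> \<T> V ev_eCR"
    and "k \<ge> 1"
  shows "GLB_eCR \<epsilon> \<delta> (ev_eCR k) \<le> ev k"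
proof -
  interpret mesh \<Omega> \<T> by unfold_locales (fact assms)+
  have "\<forall>T\<in>\<T>. \<exists>c. \<forall>x\<in>interior T. V x = c"
    using \<open>V \<in> pw_poly 0 \<T>\<close> poly_total_degree_le_0 unfolding pw_poly_def by fastforce
  from bchoice[OF this] obtain c where c: "\<forall>T\<in>\<T>. \<forall>x\<in>interior T. V x = c T" by blast
  have c0: "0 \<le> c T" if tm: "T \<in> \<T>" for T
  proof -
    \<comment> \<open>The essential infimum controls \<open>V\<close> only almost everywhere. On an
      open simplex, a set of positive measure, \<open>V\<close> is constant, so the constant
      inherits the sign.\<close>
    have "esssup (lebesgue_on \<Omega>) (\<lambda>x. - ereal (V x)) = 0"
      using \<open>essinf (lebesgue_on \<Omega>) V = 0\<close> by (simp add: essinf_def ereal_uminus_eq_reorder)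
    then have "AE x in lebesgue_on \<Omega>. - ereal (V x) \<le> 0"
      using esssup_AE[of "\<lambda>x. - ereal (V x)" "lebesgue_on \<Omega>"] by simp
    then have "AE x in lebesgue_on (interior T). - ereal (V x) \<le> 0" by (rule AE_split[OF _ tm])
    then obtain x where "x \<in> interior T" "- ereal (V x) \<le> 0"
      by (rule full_simplex.AE_interior_obtain[OF simplex_mesh[OF tm]])
    then show ?thesis using c tm by auto
  qed
  interpret eCR_setting \<Omega> \<T> V c
    by unfold_locales (use assms c c0 in auto)
  note coeff = Linfty_norm_coefficients[of _ "C\<^sub>P", folded \<open>\<epsilon> = _\<close> \<open>\<delta> = _\<close>]
  \<comment> \<open>Some simplex must exist for \<epsilon> to be positive and \<delta>
    nonnegative.\<close>
  obtain T0 where T0: "T0 \<in> \<T>" using mesh_nonempty by blast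
  have \<epsilon>0: "0 < \<epsilon>"
    using coeff(1)[OF T0] diameter_mesh_pos[OF T0] \<open>C\<^sub>P > 0\<close> by (smt (verit) mult_pos_pos
        zero_less_power)
  have \<delta>0: "0 \<le> \<delta>" using order_trans[OF _ coeff(2)[OF T0]] c0[OF T0] by simp
  obtain u where es: "eigen_system \<Omega> (H10 \<Omega>) a_exact {1..} ev u"
    by (rule exact_eigen_system[OF \<open>exact_eigenvalues \<Omega> V ev\<close>])
  have mono: "mono_on {1..} ev"
    using \<open>exact_eigenvalues \<Omega> V ev\<close> by (simp add: exact_eigenvalues_def enumerates_eigenvalues_def)
  obtain N ev' where dim: "has_dim_ae \<Omega> (eCR0 \<Omega> \<T>) N"
    and en: "enumerates_eigenvalues \<Omega> (eCR0 \<Omega> \<T>) a_pw {1..N} ev'"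
    and ev': "\<forall>k\<in>{1..N}. ev_eCR k = ereal (ev' k)" and inf: "\<forall>k>N. ev_eCR k = \<infinity>"
    using \<open>eCR_eigenvalues \<Omega> \<T> V ev_eCR\<close> unfolding eCR_eigenvalues_def by blast
  obtain w where esd: "eigen_system \<Omega> (eCR0 \<Omega> \<T>) a_pw {1..N} ev' w"
    by (rule discrete_eigen_system[OF en])
  interpret esd: eigen_system \<Omega> "eCR0 \<Omega> \<T>" a_pw "{1..N}" ev' w by (rule esd)
  have mono': "mono_on {1..N} ev'" and pos': "\<And>i. i \<in> {1..N} \<Longrightarrow> 0 < ev' i"
    using en by (auto simp: enumerates_eigenvalues_def)
  have "\<exists>v\<in>eCR0 \<Omega> \<T>. (\<forall>i\<in>{1..N}. i < k \<longrightarrow> L2_inner \<Omega> (w i) v = 0) \<and>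
    (\<forall>t>0. t * L2_inner \<Omega> v v \<le> a_pw v v \<longrightarrow> GLB_real \<epsilon> \<delta> t \<le> ev k)"
    by (rule exists_discrete_test_function[OF \<open>C\<^sub>P > 0\<close> assms(8) \<epsilon>0 coeff(1) \<delta>0 coeff(2) es mono
        \<open>k \<ge> 1\<close> esd.wX])
  then obtain v where v: "v \<in> eCR0 \<Omega> \<T>" "\<And>i. i \<in> {1..N} \<Longrightarrow> i < k \<Longrightarrow> L2_inner \<Omega> (w i) v = 0"
    and bound: "\<And>t. t > 0 \<Longrightarrow> t * L2_inner \<Omega> v v \<le> a_pw v v \<Longrightarrow> GLB_real \<epsilon> \<delta> t \<le> ev k"
    by blast
  show ?thesis
  proof (cases "k \<le> N")
    case True
    then have k: "k \<in> {1..N}" using \<open>k \<ge> 1\<close> by simp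
    have "GLB_real \<epsilon> \<delta> (ev' k) \<le> ev k"
      by (rule bound[OF pos'[OF k] discrete_bound(1)[OF dim esd mono' v(1) v(2) k]])
    then show ?thesis using ev' k by (simp add: GLB_eCR_def)
  next
    case False
    \<comment> \<open>Beyond the discrete dimension \<open>v\<close> has zero norm, so its energy
      inequality holds for every \<open>t > 0\<close>, and the bound passes to the limit for large
      \<open>t\<close>.\<close>
    have "0 \<le> (LINT x|M. v x * v x)" "0 \<le> (LINT x|M. grad v x \<bullet> grad v x)" for M
      by (rule Bochner_Integration.integral_nonneg; simp)+
    then have "0 \<le> a_pw v v"
      unfolding a_pw_self[OF v(1)] using c0 by (simp add: sum_nonneg)
    then have "GLB_real \<epsilon> \<delta> t \<le> ev k" if "t > 0" for t
      using bound[OF that] discrete_bound(2)[OF dim esd mono' v(1) v(2), of k] False by simp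
    then have "Lim at_top (GLB_real \<epsilon> \<delta>) \<le> ev k" by (rule Lim_GLB_real_le[OF \<epsilon>0 \<delta>0])
    then show ?thesis using inf False by (simp add: GLB_eCR_def)
  qed
qed

end
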